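(* Assume that the parameters $\delta$, $\varepsilon=(\varepsilon_1,\varepsilon_2)$, $h$ satisfy the additional condition $$h\,\varepsilon_1^{-1}+h^{1/2}\varepsilon_2^{-1/2}\to0.$$ Then the following hold for the functionals with quadrature $E^{\rm quad}_{\delta,\varepsilon,h}$. (1) $E^{\rm quad}_{\delta,\varepsilon,h}$ approximates the constrained functional $E$ in the following sense. (i) Let $(y,b)\in V$ be admissible. If $(\sigma,\varepsilon_1,\varepsilon_2,\delta)\to0$ as $h\to0$ such that $h^2\varepsilon_1^{-1}+\sigma^2\varepsilon_2^{-1}+h^2[y,b]_\sigma^2\varepsilon_2^{-1}\to0$, then there exists a sequence of discrete admissible pairs $(y_h,b_h)\in V_h$ with $y_h\to y$ in $H^2$ and $b_h\to b$ in $H^1$ as $h\to0$ and $E^{\rm quad}_{\delta,\varepsilon,h}[y_h,b_h]\to E[y,b]$. (ii) For every bounded sequence $(y_h,b_h)\in V_h$ of discrete admissible pairs with weak limit $(y,b)\in V$, the limiting pair is admissible and $E[y,b]\le\liminf_{(\varepsilon,\delta,h)\to0}E^{\rm quad}_{\delta,\varepsilon,h}[y_h,b_h]$. (2) Let $(y_h,b_h)_{h>0}$ be a sequence of minimizers of $E^{\rm quad}_{\delta,\varepsilon,h}$ among discrete admissible pairs, possibly up to tolerances $\varepsilon_{\rm tol}$ that vanish as $h\to0$. If an accumulation point $(y,b)\in V$ of the sequence is such that there exists a sequence $\sigma\to0$ with $h^2\varepsilon_1^{-1}+\sigma^2\varepsilon_2^{-1}+h^2[y,b]_\sigma^2\varepsilon_2^{-1}\to0$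 as $h\to0$, then every weak accumulation point $(y,b)\in V$ of the sequence as $(\delta,\varepsilon,h)\to0$ minimizes the constrained functional $E$. (3) Assume that for every admissible $(y,b)$ and every $\sigma>0$ there exists a smooth approximating frame $(y_\sigma,b_\sigma)$ as in the context with the additional property that $y_\sigma'\cdot b_\sigma'=0$ in $(0,L)$. If $\varepsilon_1,\varepsilon_2>0$ are chosen such that $h^2\varepsilon_1^{-1}+h^2\varepsilon_2^{-1}\to0$ as $h\to0$, then the constrained functionals $E^{\rm quad}_{\delta,\varepsilon,h}$ are $\Gamma$-convergent to the constrained functional $E$ as $(\delta,\varepsilon,h)\to0$. (4) Let $\varepsilon_2>0$ be fixed. Then the constrained functionals $E^{\rm quad}_{\delta,\varepsilon,h}$ are $\Gamma$-convergent to the constrained functional $E_{0,\varepsilon_2}$ as $(\delta,\varepsilon_1,h)\to0$, provided that $h^2\varepsilon_1^{-1}\to0$.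
   Context: Let $L>0$, $V=H^2(0,L;\mathbb{R}^3)\times H^1(0,L;\mathbb{R}^3)$, and let $L_{\rm bc}$ be a bounded linear operator on $V$ that depends only on the boundary values (at $0$ and $L$) of $y$, $y'$ and $b$; $\ell_{\rm bc}$ is given data. Set $$\mathcal{A}_{\rm frame}=\{(y,b)\in V:\ [y',b,y'\times b]\in SO(3)\text{ a.e. in }(0,L),\ L_{\rm bc}[y,b]=\ell_{\rm bc}\}.$$ A pair $(y,b)$ is called admissible if $(y,b)\in\mathcal{A}_{\rm frame}$ and $y'\cdot b'=0$ a.e. The function $\overline{Q}$ is $\overline{Q}(\alpha,\beta)=(\alpha^2+\beta^2)^2/\alpha^2$ if $|\alpha|\ge|\beta|$ and $\overline{Q}(\alpha,\beta)=4\beta^2$ if $|\alpha|\le|\beta|$ (value $0$ at $(0,0)$). The constrained functional $E$ is $E[y,b]=\int_0^L\overline{Q}(|y''|,|b'|)\,dx$ for admissible $(y,b)$ and $+\infty$ for other elements of $V$. For $\varepsilon_2>0$, $E_{0,\varepsilon_2}[y,b]=\int_0^L\overline{Q}(|y''|,|b'|)\,dx+\frac1{2\varepsilon_2}\int_0^L(y'\cdot b')^2dx$ for $(y,b)\in\mathcal{A}_{\rm frame}$ and $+\infty$ otherwise. Smooth approximating frames: for admissible $(y,b)$ and $\sigma>0$, $(y_\sigma,b_\sigma)\in[C^\infty(0,L;\mathbb{R}^3)]^2\cap\mathcal{A}_{\rm frame}$ denotes a pair with $$\|y-y_\sigma\|_{H^2(0,L)}+\|b-b_\sigma\|_{H^1(0,L)}+\|y_\sigma'\cdot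 b_\sigma'\|_{L^2(0,L)}\le\sigma,$$ and $[y,b]_\sigma=\|y_\sigma\|_{H^3(0,L)}+\|b_\sigma\|_{H^2(0,L)}$. Regularized modulus: for every $\delta>0$ a function $|\cdot|_\delta\in C^2(\mathbb{R};\mathbb{R}_{\ge0})$ is given such that, with constants $c_0,c_1,c_2,c_{\rm uni}$ independent of $\delta$, $|x|_\delta\ge c_0\delta$, $\big|(|\cdot|_\delta)'\big|\le c_1$, $\big|(|\cdot|_\delta)''\big|\le c_2\delta^{-1}$, and $\big||x|_\delta-|x|\big|\le c_{\rm uni}\delta$ for all $x\in\mathbb{R}$. Set $$\psi_\delta(\alpha^2,\beta^2)=|\alpha^2-\beta^2|_\delta+\frac{4\beta^4}{\alpha^2+\beta^2+|\alpha^2-\beta^2|_\delta}.$$ Discretization: $\mathcal{T}_h$ is a quasiuniform family (minimal element length $\ge c\,h$) of partitions $0=x_0<x_1<\dots<x_N=L$ of $(0,L)$ with maximal element length $h$. $\mathcal{S}^{p,k}(\mathcal{T}_h)$ is the space of $C^k$ functions on $[0,L]$ that are polynomials of degree at most $p$ on each element; $\mathcal{I}_h^{1,0}$ is the nodal interpolation operator onto $\mathcal{S}^{1,0}(\mathcal{T}_h)$. $V_h=\mathcal{S}^{3,1}(\mathcal{T}_h)^3\times\mathcal{S}^{1,0}(\mathcal{T}_h)^3\subset V$. A pair $(y_h,b_h)\in V_h$ is called discrete admissible if $|y_h'(x_j)|=|b_h(x_j)|=1$ for $j=0,\dots,N$ and $L_{\rm bc}[y_h,b_h]=\ell_{\rm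 bc}$. Averaging operators: on each element $T=[x_{j-1},x_j]$, $\mathcal{A}_hv|_T=|T|^{-1}\int_Tv\,dx$ and $\mathcal{M}_hr|_T=\frac12(r(x_{j-1})+r(x_j))$. For $\delta>0$, $\varepsilon=(\varepsilon_1,\varepsilon_2)$ with $\varepsilon_1,\varepsilon_2>0$, and discrete admissible pairs, $$E^{\rm quad}_{\delta,\varepsilon,h}[y_h,b_h]=\frac12\int_0^L|y_h''|^2+5|b_h'|^2+\psi_\delta(|\mathcal{A}_hy_h''|^2,|b_h'|^2)\,dx+\frac1{2\varepsilon_1}\int_0^L\mathcal{I}_h^{1,0}\big[(y_h'\cdot b_h)^2\big]dx+\frac1{2\varepsilon_2}\int_0^L(\mathcal{M}_hy_h'\cdot b_h')^2dx,$$ and $E^{\rm quad}_{\delta,\varepsilon,h}=+\infty$ on all other elements of $V$. Being a minimizer up to the tolerance $\varepsilon_{\rm tol}$ means that the value exceeds the value at any discrete admissible pair by at most $\varepsilon_{\rm tol}$. $\Gamma$-convergence of $F_h$ to $F$ on $V$ is understood with respect to weak convergence in $V$: (a) $F[y,b]\le\liminf F_h[y_h,b_h]$ whenever $(y_h,b_h)\rightharpoonup(y,b)$ in $V$; (b) for each $(y,b)\in V$ there are $(y_h,b_h)\rightharpoonup(y,b)$ in $V$ with $F_h[y_h,b_h]\to F[y,b]$.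
   Formalization: In (1)(ii), "bounded sequence" is taken to mean bounded energies for admissibility of the limit, since boundedness in V does not suffice (y_h = x e_1, b_h = e_1 with trivial boundary conditions); the liminf inequality is stated for all weakly convergent discrete admissible sequences. *)

theory Defs
  imports "HOL-Analysis.Analysis" "HOL-Computational_Algebra.Polynomial"
begin

section \<open>Sobolev spaces on an interval\<close>

text \<open>\<open>C\<^sup>k\<close> functions on an interval \<open>S\<close>; derivatives at end points contained in \<open>S\<close> are one-sided.\<close>

definition Ck_on :: "real set \<Rightarrow> nat \<Rightarrow> (real \<Rightarrow> 'a::real_normed_vector) \<Rightarrow> bool" where
  "Ck_on S k f \<longleftrightarrow> (\<exists>F :: nat \<Rightarrow> real \<Rightarrow> 'a. F 0 = f \<and>
      (\<forall>i<k. \<forall>x\<in>S. (F i has_vector_derivative F (Suc i) x) (at x within S)) \<and>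
      (\<forall>i\<le>k. continuous_on S (F i)))"

definition smooth_on :: "real set \<Rightarrow> (real \<Rightarrow> 'a::real_normed_vector) \<Rightarrow> bool" where
  "smooth_on S f \<longleftrightarrow> (\<forall>k. Ck_on S k f)"

definition test_function :: "real \<Rightarrow> (real \<Rightarrow> real) \<Rightarrow> bool" where
  "test_function L \<phi> \<longleftrightarrow> smooth_on UNIV \<phi> \<and> (\<exists>a b. 0 < a \<and> b < L \<and> (\<forall>x. x \<notin> {a..b} \<longrightarrow> \<phi> x = 0))"

definition has_weak_deriv :: "real \<Rightarrow> (real \<Rightarrow> real^3) \<Rightarrow> (real \<Rightarrow> real^3) \<Rightarrow> bool" where
  "has_weak_deriv L f g \<longleftrightarrow>
     set_integrable lborel {0<..<L} f \<and> set_integrable lborel {0<..<L} g \<and>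
     (\<forall>\<phi>. test_function L \<phi> \<longrightarrow>
        (LINT x:{0<..<L}|lborel. deriv \<phi> x *\<^sub>R f x) = - (LINT x:{0<..<L}|lborel. \<phi> x *\<^sub>R g x))"

definition L2_fun :: "real \<Rightarrow> (real \<Rightarrow> real^3) \<Rightarrow> bool" where
  "L2_fun L g \<longleftrightarrow> set_borel_measurable lborel {0<..<L} g \<and>
     set_integrable lborel {0<..<L} (\<lambda>x. (norm (g x))\<^sup>2)"

definition L2_norm :: "real \<Rightarrow> (real \<Rightarrow> 'a::real_normed_vector) \<Rightarrow> real" where
  "L2_norm L g = sqrt (LINT x:{0<..<L}|lborel. (norm (g x))\<^sup>2)"

text \<open>Elements of \<open>H\<^sup>k(0,L)\<close>, \<open>k \<ge> 1\<close>, are represented by functions that are continuous on \<open>[0,L]\<close>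
  (the continuous representative); the values outside of \<open>[0,L]\<close> are irrelevant.\<close>

primrec sobolev :: "real \<Rightarrow> nat \<Rightarrow> (real \<Rightarrow> real^3) \<Rightarrow> bool" where
  "sobolev L 0 f \<longleftrightarrow> L2_fun L f"
| "sobolev L (Suc k) f \<longleftrightarrow> continuous_on {0..L} f \<and> (\<exists>g. has_weak_deriv L f g \<and> sobolev L k g)"

text \<open>The weak derivative: the representative that is continuous on \<open>[0,L]\<close> whenever there is one
  (so that \<open>y'\<close> has point values for \<open>y \<in> H\<^sup>2\<close>), and otherwise an arbitrary representative, which is
  determined almost everywhere.\<close>

definition D :: "real \<Rightarrow> (real \<Rightarrow> real^3) \<Rightarrow> (real \<Rightarrow> real^3)" where
  "D L f = (if \<exists>g. has_weak_deriv L f g \<and> continuous_on {0..L} g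
            then SOME g. has_weak_deriv L f g \<and> continuous_on {0..L} g
            else SOME g. has_weak_deriv L f g)"

definition sobolev_norm :: "real \<Rightarrow> nat \<Rightarrow> (real \<Rightarrow> real^3) \<Rightarrow> real" where
  "sobolev_norm L k f = sqrt (\<Sum>i\<le>k. (L2_norm L ((D L ^^ i) f))\<^sup>2)"

section \<open>The space V\<close>

type_synonym frame = "(real \<Rightarrow> real^3) \<times> (real \<Rightarrow> real^3)"

definition V_space :: "real \<Rightarrow> frame set" where
  "V_space L = {(y, b). sobolev L 2 y \<and> sobolev L 1 b}"

fun V_norm :: "real \<Rightarrow> frame \<Rightarrow> real" where
  "V_norm L (y, b) = sqrt ((sobolev_norm L 2 y)\<^sup>2 + (sobolev_norm L 1 b)\<^sup>2)"

fun lin_comb :: "real \<Rightarrow> frame \<Rightarrow> real \<Rightarrow> frame \<Rightarrow> frame" where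
  "lin_comb r (y, b) s (z, c) = (\<lambda>x. r *\<^sub>R y x + s *\<^sub>R z x, \<lambda>x. r *\<^sub>R b x + s *\<^sub>R c x)"

definition bounded_linear_on_V :: "real \<Rightarrow> (frame \<Rightarrow> 'w::real_normed_vector) \<Rightarrow> bool" where
  "bounded_linear_on_V L T \<longleftrightarrow>
     (\<forall>u\<in>V_space L. \<forall>v\<in>V_space L. \<forall>r s. T (lin_comb r u s v) = r *\<^sub>R T u + s *\<^sub>R T v) \<and>
     (\<exists>C. \<forall>u\<in>V_space L. norm (T u) \<le> C * V_norm L u)"

definition weakly_conv :: "real \<Rightarrow> (nat \<Rightarrow> frame) \<Rightarrow> frame \<Rightarrow> bool" where
  "weakly_conv L U u \<longleftrightarrow> (\<forall>n. U n \<in> V_space L) \<and> u \<in> V_space L \<and>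
     (\<forall>\<Phi> :: frame \<Rightarrow> real. bounded_linear_on_V L \<Phi> \<longrightarrow> (\<lambda>n. \<Phi> (U n)) \<longlonglongrightarrow> \<Phi> u)"

definition weak_accumulation_point :: "real \<Rightarrow> (nat \<Rightarrow> frame) \<Rightarrow> frame \<Rightarrow> bool" where
  "weak_accumulation_point L U u \<longleftrightarrow> (\<exists>r :: nat \<Rightarrow> nat. strict_mono r \<and> weakly_conv L (U \<circ> r) u)"

definition gamma_conv :: "real \<Rightarrow> (nat \<Rightarrow> frame \<Rightarrow> ereal) \<Rightarrow> (frame \<Rightarrow> ereal) \<Rightarrow> bool" where
  "gamma_conv L F E \<longleftrightarrow>
     (\<forall>U u. weakly_conv L U u \<longrightarrow> E u \<le> liminf (\<lambda>n. F n (U n))) \<and>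
     (\<forall>u\<in>V_space L. \<exists>U. weakly_conv L U u \<and> (\<lambda>n. F n (U n)) \<longlonglongrightarrow> E u)"

section \<open>Admissible pairs and the limiting functionals\<close>

fun boundary_values :: "real \<Rightarrow> frame \<Rightarrow> (real^3) list" where
  "boundary_values L (y, b) = [y 0, y L, D L y 0, D L y L, b 0, b L]"

definition boundary_operator :: "real \<Rightarrow> (frame \<Rightarrow> 'w::real_normed_vector) \<Rightarrow> bool" where
  "boundary_operator L Lbc \<longleftrightarrow> bounded_linear_on_V L Lbc \<and>
     (\<forall>u\<in>V_space L. \<forall>v\<in>V_space L. boundary_values L u = boundary_values L v \<longrightarrow> Lbc u = Lbc v)"

definition column_matrix :: "real^3 \<Rightarrow> real^3 \<Rightarrow> real^3 \<Rightarrow> real^3^3" where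
  "column_matrix u v w = transpose (vector [u, v, w])"

definition A_frame :: "real \<Rightarrow> (frame \<Rightarrow> 'w::real_normed_vector) \<Rightarrow> 'w \<Rightarrow> frame set" where
  "A_frame L Lbc lbc = {(y, b). (y, b) \<in> V_space L \<and>
     (AE x in lborel. x \<in> {0<..<L} \<longrightarrow>
        rotation_matrix (column_matrix (D L y x) (b x) (cross3 (D L y x) (b x)))) \<and>
     Lbc (y, b) = lbc}"

definition admissible :: "real \<Rightarrow> (frame \<Rightarrow> 'w::real_normed_vector) \<Rightarrow> 'w \<Rightarrow> frame set" where
  "admissible L Lbc lbc = {(y, b). (y, b) \<in> A_frame L Lbc lbc \<and>
     (AE x in lborel. x \<in> {0<..<L} \<longrightarrow> D L y x \<bullet> D L b x = 0)}"

text \<open>At \<open>(0,0)\<close> the value is \<open>0\<close> since \<open>0 / 0 = 0\<close>.\<close>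

definition Qbar :: "real \<Rightarrow> real \<Rightarrow> real" where
  "Qbar \<alpha> \<beta> = (if \<bar>\<alpha>\<bar> \<ge> \<bar>\<beta>\<bar> then (\<alpha>\<^sup>2 + \<beta>\<^sup>2)\<^sup>2 / \<alpha>\<^sup>2 else 4 * \<beta>\<^sup>2)"

fun E_constr :: "real \<Rightarrow> (frame \<Rightarrow> 'w::real_normed_vector) \<Rightarrow> 'w \<Rightarrow> frame \<Rightarrow> ereal" where
  "E_constr L Lbc lbc (y, b) =
     (if (y, b) \<in> admissible L Lbc lbc
      then ereal (LINT x:{0<..<L}|lborel. Qbar (norm (D L (D L y) x)) (norm (D L b x)))
      else \<infinity>)"

fun E_pen :: "real \<Rightarrow> (frame \<Rightarrow> 'w::real_normed_vector) \<Rightarrow> 'w \<Rightarrow> real \<Rightarrow> frame \<Rightarrow> ereal" where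
  "E_pen L Lbc lbc \<epsilon>2 (y, b) =
     (if (y, b) \<in> A_frame L Lbc lbc
      then ereal ((LINT x:{0<..<L}|lborel. Qbar (norm (D L (D L y) x)) (norm (D L b x)))
                  + 1 / (2 * \<epsilon>2) * (LINT x:{0<..<L}|lborel. (D L y x \<bullet> D L b x)\<^sup>2))
      else \<infinity>)"

definition minimizer_of :: "real \<Rightarrow> (frame \<Rightarrow> ereal) \<Rightarrow> frame \<Rightarrow> bool" where
  "minimizer_of L F u \<longleftrightarrow> u \<in> V_space L \<and> (\<forall>v\<in>V_space L. F u \<le> F v)"

text \<open>The pair \<open>(ys, bs)\<close> is a smooth approximating frame of \<open>(y, b)\<close> with parameter \<open>\<sigma>\<close>. Smoothness on
  the open interval does not bound derivatives near the end points, hence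
  \<open>ys \<in> H\<^sup>3\<close> and \<open>bs \<in> H\<^sup>2\<close> are part of the notion, so that \<open>smooth_frame_norm\<close> is the finite norm.\<close>

fun smooth_frame ::
  "real \<Rightarrow> (frame \<Rightarrow> 'w::real_normed_vector) \<Rightarrow> 'w \<Rightarrow> frame \<Rightarrow> real \<Rightarrow> frame \<Rightarrow> bool" where
  "smooth_frame L Lbc lbc (y, b) \<sigma> (ys, bs) \<longleftrightarrow>
     smooth_on {0<..<L} ys \<and> smooth_on {0<..<L} bs \<and> sobolev L 3 ys \<and> sobolev L 2 bs \<and>
     (ys, bs) \<in> A_frame L Lbc lbc \<and>
     sobolev_norm L 2 (\<lambda>x. y x - ys x) + sobolev_norm L 1 (\<lambda>x. b x - bs x)
       + L2_norm L (\<lambda>x. D L ys x \<bullet> D L bs x) \<le> \<sigma>"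

fun smooth_frame_norm :: "real \<Rightarrow> frame \<Rightarrow> real" where
  "smooth_frame_norm L (ys, bs) = sobolev_norm L 3 ys + sobolev_norm L 2 bs"

section \<open>Regularized modulus\<close>

definition regularized_modulus ::
  "real \<Rightarrow> real \<Rightarrow> real \<Rightarrow> real \<Rightarrow> (real \<Rightarrow> real \<Rightarrow> real) \<Rightarrow> bool" where
  "regularized_modulus c0 c1 c2 cuni m \<longleftrightarrow> c0 > 0 \<and>
     (\<forall>\<delta>>0. Ck_on UNIV 2 (m \<delta>) \<and>
        (\<forall>x. 0 \<le> m \<delta> x \<and> c0 * \<delta> \<le> m \<delta> x \<and>
             \<bar>deriv (m \<delta>) x\<bar> \<le> c1 \<and> \<bar>deriv (deriv (m \<delta>)) x\<bar> \<le> c2 / \<delta> \<and>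
             \<bar>m \<delta> x - \<bar>x\<bar>\<bar> \<le> cuni * \<delta>))"

text \<open>The arguments \<open>A\<close> and \<open>B\<close> stand for \<open>\<alpha>\<^sup>2\<close> and \<open>\<beta>\<^sup>2\<close>, and \<open>md\<close> for the regularized modulus.\<close>

definition psi :: "(real \<Rightarrow> real) \<Rightarrow> real \<Rightarrow> real \<Rightarrow> real" where
  "psi md A B = md (A - B) + 4 * B\<^sup>2 / (A + B + md (A - B))"

section \<open>Discretization\<close>

text \<open>A partition of \<open>(0,L)\<close> is given by the number \<open>N\<close> of its elements and its nodes
  \<open>X 0, \<dots>, X N\<close>.\<close>

definition mesh :: "real \<Rightarrow> nat \<Rightarrow> (nat \<Rightarrow> real) \<Rightarrow> bool" where
  "mesh L N X \<longleftrightarrow> X 0 = 0 \<and> X N = L \<and> (\<forall>j<N. X j < X (Suc j))"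

definition mesh_size :: "nat \<Rightarrow> (nat \<Rightarrow> real) \<Rightarrow> real" where
  "mesh_size N X = Max ((\<lambda>j. X (Suc j) - X j) ` {..<N})"

definition quasiuniform :: "(nat \<Rightarrow> nat) \<Rightarrow> (nat \<Rightarrow> nat \<Rightarrow> real) \<Rightarrow> bool" where
  "quasiuniform N X \<longleftrightarrow>
     (\<exists>c>0. \<forall>n. \<forall>j<N n. c * mesh_size (N n) (X n) \<le> X n (Suc j) - X n j)"

definition spline :: "real \<Rightarrow> nat \<Rightarrow> (nat \<Rightarrow> real) \<Rightarrow> nat \<Rightarrow> nat \<Rightarrow> (real \<Rightarrow> real) \<Rightarrow> bool" where
  "spline L N X p k f \<longleftrightarrow> Ck_on {0..L} k f \<and>
     (\<forall>j<N. \<exists>q :: real poly. degree q \<le> p \<and> (\<forall>x\<in>{X j..X (Suc j)}. f x = poly q x))"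

definition V_h :: "real \<Rightarrow> nat \<Rightarrow> (nat \<Rightarrow> real) \<Rightarrow> frame set" where
  "V_h L N X = {(y, b). \<forall>i. spline L N X 3 1 (\<lambda>x. y x $ i) \<and> spline L N X 1 0 (\<lambda>x. b x $ i)}"

definition discrete_admissible ::
  "real \<Rightarrow> (frame \<Rightarrow> 'w::real_normed_vector) \<Rightarrow> 'w \<Rightarrow> nat \<Rightarrow> (nat \<Rightarrow> real) \<Rightarrow> frame set" where
  "discrete_admissible L Lbc lbc N X = {(y, b). (y, b) \<in> V_h L N X \<and>
     (\<forall>j\<le>N. norm (D L y (X j)) = 1 \<and> norm (b (X j)) = 1) \<and> Lbc (y, b) = lbc}"

text \<open>Index \<open>j\<close> of an element \<open>[X j, X (j+1)]\<close> containing the point \<open>x \<in> [0,L]\<close>; at interior nodes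
  the left element is selected, which is immaterial under the integrals.\<close>

definition elem :: "(nat \<Rightarrow> real) \<Rightarrow> real \<Rightarrow> nat" where
  "elem X x = (LEAST j. x \<le> X (Suc j))"

definition nodal_interp :: "(nat \<Rightarrow> real) \<Rightarrow> (real \<Rightarrow> real) \<Rightarrow> real \<Rightarrow> real" where
  "nodal_interp X r x = (let j = elem X x in
     r (X j) + (x - X j) / (X (Suc j) - X j) * (r (X (Suc j)) - r (X j)))"

definition avg :: "(nat \<Rightarrow> real) \<Rightarrow> (real \<Rightarrow> real^3) \<Rightarrow> real \<Rightarrow> real^3" where
  "avg X v x = (let j = elem X x in
     (1 / (X (Suc j) - X j)) *\<^sub>R (LINT t:{X j..X (Suc j)}|lborel. v t))"

definition midavg :: "(nat \<Rightarrow> real) \<Rightarrow> (real \<Rightarrow> real^3) \<Rightarrow> real \<Rightarrow> real^3" where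
  "midavg X r x = (let j = elem X x in (1 / 2) *\<^sub>R (r (X j) + r (X (Suc j))))"

fun E_quad ::
  "real \<Rightarrow> (frame \<Rightarrow> 'w::real_normed_vector) \<Rightarrow> 'w \<Rightarrow> (real \<Rightarrow> real) \<Rightarrow> real \<Rightarrow> real \<Rightarrow>
   nat \<Rightarrow> (nat \<Rightarrow> real) \<Rightarrow> frame \<Rightarrow> ereal" where
  "E_quad L Lbc lbc md \<epsilon>1 \<epsilon>2 N X (y, b) =
     (if (y, b) \<in> discrete_admissible L Lbc lbc N X
      then ereal (
        1 / 2 * (LINT x:{0<..<L}|lborel.
            (norm (D L (D L y) x))\<^sup>2 + 5 * (norm (D L b x))\<^sup>2
            + psi md ((norm (avg X (D L (D L y)) x))\<^sup>2) ((norm (D L b x))\<^sup>2))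
        + 1 / (2 * \<epsilon>1) * (LINT x:{0<..<L}|lborel. nodal_interp X (\<lambda>t. (D L y t \<bullet> b t)\<^sup>2) x)
        + 1 / (2 * \<epsilon>2) * (LINT x:{0<..<L}|lborel. (midavg X (D L y) x \<bullet> D L b x)\<^sup>2))
      else \<infinity>)"

end

theory Submission
  imports Defs
begin

text \<open>No smoothing is needed for the recovery sequence: the nodal interpolants \<open>(y\<^sub>h, b\<^sub>h)\<close> of \<open>(y, b)\<close> itself
  (cubic Hermite for \<open>y\<close>, linear for \<open>b\<close>) converge strongly, inherit the constraints and the boundary values,
  and make the first penalty term vanish. As \<open>b\<^sub>h'\<close> is the elementwise mean of \<open>b'\<close>, the constraint
  \<open>y' \<bullet> b' = 0\<close> implies that \<open>M y\<^sub>h' \<bullet> b\<^sub>h'\<close> is the elementwise mean of \<open>(M y' - y') \<bullet> b'\<close>, whose squared \<open>L\<^sup>2\<close> norm is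
  at most \<open>h \<parallel>y''\<parallel>\<^sup>2 \<parallel>b'\<parallel>\<^sup>2\<close>. Hence the second penalty vanishes in the limit because \<open>h / \<epsilon>2\<close> tends to \<open>0\<close>.

  For the lower bound, replacing \<open>|\<cdot>|\<^sub>\<delta>\<close> by the modulus costs \<open>O(\<delta>)\<close>, and averaging \<open>y\<^sub>h''\<close> decreases its \<open>L\<^sup>2\<close> norm;
  what remains is the integral of \<open>Qbar\<close> at the averaged second derivative. This integral is convex, hence weakly lower
  semicontinuous, and averaging does not change the weak limit because the averages of a fixed \<open>L\<^sup>2\<close>
  function converge strongly. Bounded energies moreover force the nodal constraints and the orthogonality
  relations to hold everywhere in the limit.\<close>

section \<open>Square integrable functions\<close>

text \<open>Derivatives are given by a choice operator and are determined only almost everywhere.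
  The estimates therefore run on \<open>primitive_of L f g\<close>, meaning that \<open>f\<close> is
  an integral of \<open>g\<close>; for continuous \<open>f\<close> this is equivalent to weak
  differentiability. It gives point values, the Hoelder bound with \<open>sqrt h\<close> behind the
  nodal limits, and a way to build splines upward from their highest derivative.

  Two obstacles shape the lower bound. \<open>Lbc\<close> has values in an arbitrary normed space,
  whereas weak convergence is tested by real functionals. Its value at the limit is reached through
  the finitely many boundary vectors, whose errors are lifted to polynomials of vanishing norm. The
  second penalty is a product with a factor that converges only weakly; it is tested against its own
  limit, which pairs weak with strong convergence.

  Semicontinuity of the bending part uses a subgradient at the limit pair. It grows linearly, hence
  is square integrable, and since averaging is symmetric in \<open>L\<^sup>2\<close> the average can
  be moved from the varying second derivative to this fixed function.\<close>

definition sq_int :: "'a measure \<Rightarrow> ('a \<Rightarrow> 'b::euclidean_space) \<Rightarrow> bool" where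
  "sq_int M f \<longleftrightarrow> f \<in> borel_measurable M \<and> integrable M (\<lambda>x. (norm (f x))\<^sup>2)"

definition l2n :: "'a measure \<Rightarrow> ('a \<Rightarrow> 'b::euclidean_space) \<Rightarrow> real" where
  "l2n M f = sqrt (\<integral>x. (norm (f x))\<^sup>2 \<partial>M)"

lemma sq_int_measurable [measurable_dest]: "sq_int M f \<Longrightarrow> f \<in> borel_measurable M"
  by (simp add: sq_int_def)

lemma sq_intD: "sq_int M f \<Longrightarrow> integrable M (\<lambda>x. (norm (f x))\<^sup>2)"
  by (simp add: sq_int_def)

lemma l2n_nonneg [simp]: "0 \<le> l2n M f"
  by (simp add: l2n_def)

lemma l2n_power2: "(l2n M f)\<^sup>2 = (\<integral>x. (norm (f x))\<^sup>2 \<partial>M)"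
  by (simp add: l2n_def)

lemma sq_int_bound:
  fixes f :: "'a \<Rightarrow> 'b::euclidean_space" and g :: "'a \<Rightarrow> real"
  assumes "f \<in> borel_measurable M" "integrable M g" "AE x in M. (norm (f x))\<^sup>2 \<le> g x"
  shows "sq_int M f"
  unfolding sq_int_def
proof
  show "integrable M (\<lambda>x. (norm (f x))\<^sup>2)"
    by (rule Bochner_Integration.integrable_bound[OF assms(2)]) (use assms in auto)
qed (use assms in simp)

lemma norm_add_square_le: "(norm (a + b))\<^sup>2 \<le> 2 * (norm a)\<^sup>2 + 2 * (norm (b::'b::real_normed_vector))\<^sup>2"
proof -
  have "(norm (a + b))\<^sup>2 \<le> (norm a + norm b)\<^sup>2"
    by (simp add: norm_triangle_ineq power_mono)
  also have "\<dots> \<le> 2 * (norm a)\<^sup>2 + 2 * (norm b)\<^sup>2"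
    using zero_le_power2[of "norm a - norm b"] by (simp add: power2_eq_square algebra_simps)
  finally show ?thesis .
qed

lemma sq_int_add:
  assumes "sq_int M f" "sq_int M g" shows "sq_int M (\<lambda>x. f x + g x)"
proof (rule sq_int_bound)
  show "integrable M (\<lambda>x. 2 * (norm (f x))\<^sup>2 + 2 * (norm (g x))\<^sup>2)"
    using assms by (auto simp: sq_int_def)
qed (use assms norm_add_square_le in \<open>auto simp: sq_int_def\<close>)

lemma sq_int_scaleR:
  assumes "sq_int M f" shows "sq_int M (\<lambda>x. c *\<^sub>R f x)"
  using assms by (auto simp: sq_int_def power_mult_distrib)

lemma sq_int_diff:
  assumes "sq_int M f" "sq_int M g" shows "sq_int M (\<lambda>x. f x - g x)"
  using sq_int_add[OF assms(1) sq_int_scaleR[OF assms(2), of "-1"]] by simp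

lemma sq_int_bounded_mult:
  fixes c :: "'a \<Rightarrow> real"
  assumes "sq_int M f" and [measurable]: "c \<in> borel_measurable M" and "\<And>x. x \<in> space M \<Longrightarrow> \<bar>c x\<bar> \<le> B"
  shows "sq_int M (\<lambda>x. c x *\<^sub>R f x)"
proof (rule sq_int_bound)
  show "integrable M (\<lambda>x. B\<^sup>2 * (norm (f x))\<^sup>2)"
    using assms by (auto simp: sq_int_def)
  show "(\<lambda>x. c x *\<^sub>R f x) \<in> borel_measurable M"
    using assms(1) by measurable
  show "AE x in M. (norm (c x *\<^sub>R f x))\<^sup>2 \<le> B\<^sup>2 * (norm (f x))\<^sup>2"
    using assms(3) by (intro AE_I2) (simp add: power_mult_distrib mult_right_mono abs_le_square_iff[symmetric] order_trans[OF _ abs_ge_self])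
qed

lemma sq_int_norm: "sq_int M f \<Longrightarrow> sq_int M (\<lambda>x. norm (f x))"
  by (auto simp: sq_int_def)

lemma sq_int_cong_AE:
  assumes "sq_int M f" "AE x in M. f x = g x" "g \<in> borel_measurable M" shows "sq_int M g"
  by (rule sq_int_bound[OF assms(3) sq_intD[OF assms(1)]]) (use assms(2) in auto)

lemma l2n_cong_AE:
  assumes "AE x in M. f x = g x" "f \<in> borel_measurable M" "g \<in> borel_measurable M"
  shows "l2n M f = l2n M g"
  unfolding l2n_def using assms by (intro arg_cong[of _ _ sqrt] integral_cong_AE) auto

lemma sq_int_mult_integrable:
  assumes [measurable_dest]: "sq_int M f" "sq_int M g"
  shows "integrable M (\<lambda>x. norm (f x) * norm (g x))"
proof (rule Bochner_Integration.integrable_bound)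
  show "integrable M (\<lambda>x. (norm (f x))\<^sup>2 + (norm (g x))\<^sup>2)"
    using assms by (auto simp: sq_int_def)
  show "AE x in M. norm (norm (f x) * norm (g x)) \<le> norm ((norm (f x))\<^sup>2 + (norm (g x))\<^sup>2)"
  proof (intro AE_I2)
    fix x
    have a: "2 * norm (f x) * norm (g x) \<le> (norm (f x))\<^sup>2 + (norm (g x))\<^sup>2"
      using zero_le_power2[of "norm (f x) - norm (g x)"] by (simp add: power2_diff)
    have b: "0 \<le> norm (f x) * norm (g x)" by simp
    have "norm (f x) * norm (g x) \<le> (norm (f x))\<^sup>2 + (norm (g x))\<^sup>2"
      using a b by linarith
    thus "norm (norm (f x) * norm (g x)) \<le> norm ((norm (f x))\<^sup>2 + (norm (g x))\<^sup>2)"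
      by simp
  qed
qed (use assms in measurable)

lemma sq_int_inner_integrable:
  assumes [measurable_dest]: "sq_int M f" "sq_int M g"
  shows "integrable M (\<lambda>x. f x \<bullet> g x)"
  by (rule Bochner_Integration.integrable_bound[OF sq_int_mult_integrable[OF assms]])
     (use assms Cauchy_Schwarz_ineq2 in \<open>auto simp: sq_int_def abs_mult\<close>)

text \<open>The squared norm of \<open>t * norm (f x) - norm (g x)\<close> is a nonnegative
  quadratic polynomial in \<open>t\<close>; its discriminant gives the inequality.\<close>

lemma Cauchy_Schwarz_l2n:
  assumes f: "sq_int M f" and g: "sq_int M g"
  shows "(\<integral>x. norm (f x) * norm (g x) \<partial>M) \<le> l2n M f * l2n M g"
proof -
  define A B I where "A = (\<integral>x. (norm (f x))\<^sup>2 \<partial>M)" and "B = (\<integral>x. (norm (g x))\<^sup>2 \<partial>M)"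
    and "I = (\<integral>x. norm (f x) * norm (g x) \<partial>M)"
  have pos: "A \<ge> 0" "B \<ge> 0" "I \<ge> 0" by (auto simp: A_def B_def I_def)
  have q: "0 \<le> t\<^sup>2 * A - 2 * t * I + B" for t
  proof -
    have "0 \<le> (\<integral>x. (t * norm (f x) - norm (g x))\<^sup>2 \<partial>M)" by simp
    also have "\<dots> = (\<integral>x. t\<^sup>2 * (norm (f x))\<^sup>2 - 2 * t * (norm (f x) * norm (g x)) + (norm (g x))\<^sup>2 \<partial>M)"
      by (simp add: power2_eq_square algebra_simps)
    also have "\<dots> = t\<^sup>2 * A - 2 * t * I + B"
      unfolding A_def B_def I_def
      using sq_intD[OF f] sq_intD[OF g] sq_int_mult_integrable[OF f g] by simp
    finally show ?thesis .
  qed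
  have "I\<^sup>2 \<le> A * B"
  proof (cases "A = 0")
    case True
    have "I = 0"
    proof (rule ccontr)
      assume "I \<noteq> 0"
      \<comment> \<open>For \<open>A = 0\<close> the polynomial is affine in \<open>t\<close>, and
        this \<open>t\<close> gives it the value \<open>-1\<close>.\<close>
      with pos q[of "(B + 1) / (2 * I)"] True show False by simp
    qed
    thus ?thesis using True by simp
  next
    case False
    with pos have "A > 0" by simp
    \<comment> \<open>The minimizer of the quadratic polynomial.\<close>
    with q[of "I / A"] have "0 \<le> B - I\<^sup>2 / A"
      by (simp add: power2_eq_square field_simps)
    with \<open>A > 0\<close> show ?thesis by (simp add: field_simps)
  qed
  hence "I \<le> sqrt (A * B)"
    using real_le_rsqrt by blast
  thus ?thesis by (simp add: I_def A_def B_def l2n_def real_sqrt_mult)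
qed

lemma integral_inner_le:
  assumes f: "sq_int M f" and g: "sq_int M g"
  shows "\<bar>\<integral>x. f x \<bullet> g x \<partial>M\<bar> \<le> l2n M f * l2n M g"
proof -
  have "\<bar>\<integral>x. f x \<bullet> g x \<partial>M\<bar> \<le> (\<integral>x. \<bar>f x \<bullet> g x\<bar> \<partial>M)" by (rule integral_abs_bound)
  also have "\<dots> \<le> (\<integral>x. norm (f x) * norm (g x) \<partial>M)"
    by (intro integral_mono integrable_abs sq_int_inner_integrable sq_int_mult_integrable assms
        Cauchy_Schwarz_ineq2)
  also have "\<dots> \<le> l2n M f * l2n M g" by (rule Cauchy_Schwarz_l2n[OF assms])
  finally show ?thesis .
qed

lemma l2n_scaleR: "l2n M (\<lambda>x. c *\<^sub>R f x) = \<bar>c\<bar> * l2n M f"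
  by (simp add: l2n_def power_mult_distrib real_sqrt_mult)

lemma l2n_minus: "l2n M (\<lambda>x. f x - g x) = l2n M (\<lambda>x. g x - f x)"
  by (simp add: l2n_def norm_minus_commute)

lemma l2n_triangle:
  assumes f: "sq_int M f" and g: "sq_int M g"
  shows "l2n M (\<lambda>x. f x + g x) \<le> l2n M f + l2n M g"
proof -
  have "(l2n M (\<lambda>x. f x + g x))\<^sup>2 \<le> (\<integral>x. (norm (f x))\<^sup>2 + 2 * (norm (f x) * norm (g x)) + (norm (g x))\<^sup>2 \<partial>M)"
    unfolding l2n_power2
  proof (intro integral_mono)
    show "integrable M (\<lambda>x. (norm (f x + g x))\<^sup>2)" using sq_intD[OF sq_int_add[OF f g]] .
    show "integrable M (\<lambda>x. (norm (f x))\<^sup>2 + 2 * (norm (f x) * norm (g x)) + (norm (g x))\<^sup>2)"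
      using sq_intD[OF f] sq_intD[OF g] sq_int_mult_integrable[OF f g] by simp
    fix x
    have "(norm (f x + g x))\<^sup>2 \<le> (norm (f x) + norm (g x))\<^sup>2"
      by (simp add: norm_triangle_ineq power_mono)
    thus "(norm (f x + g x))\<^sup>2 \<le> (norm (f x))\<^sup>2 + 2 * (norm (f x) * norm (g x)) + (norm (g x))\<^sup>2"
      by (simp add: power2_eq_square algebra_simps)
  qed
  also have "\<dots> = (l2n M f)\<^sup>2 + 2 * (\<integral>x. norm (f x) * norm (g x) \<partial>M) + (l2n M g)\<^sup>2"
    unfolding l2n_power2 using sq_intD[OF f] sq_intD[OF g] sq_int_mult_integrable[OF f g] by simp
  also have "\<dots> \<le> (l2n M f)\<^sup>2 + 2 * (l2n M f * l2n M g) + (l2n M g)\<^sup>2"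
    using Cauchy_Schwarz_l2n[OF f g] by simp
  also have "\<dots> = (l2n M f + l2n M g)\<^sup>2" by (simp add: power2_eq_square algebra_simps)
  finally show ?thesis by (rule power2_le_imp_le) simp
qed

lemma l2n_mono:
  assumes "sq_int M g" "\<And>x. x \<in> space M \<Longrightarrow> norm (f x) \<le> norm (g x)"
  shows "l2n M f \<le> l2n M g"
  unfolding l2n_def
  by (intro real_sqrt_le_mono integral_mono_AE') (use assms in \<open>auto simp: sq_int_def power_mono\<close>)

text \<open>Factor the difference of squares and use
  \<open>norm (f x) \<le> norm (f x - g x) + norm (g x)\<close>. The bound then involves only the
  difference and the fixed function \<open>g\<close>, so it tends to zero under strong
  convergence.\<close>

lemma l2n_square_diff:
  assumes f: "sq_int M f" and g: "sq_int M g"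
  shows "(\<integral>x. \<bar>(norm (f x))\<^sup>2 - (norm (g x))\<^sup>2\<bar> \<partial>M) \<le>
    l2n M (\<lambda>x. f x - g x) * (l2n M (\<lambda>x. f x - g x) + 2 * l2n M g)"
proof -
  note d = sq_int_diff[OF f g]
  have "(\<integral>x. \<bar>(norm (f x))\<^sup>2 - (norm (g x))\<^sup>2\<bar> \<partial>M) \<le>
      (\<integral>x. (norm (f x - g x))\<^sup>2 + 2 * (norm (f x - g x) * norm (g x)) \<partial>M)"
  proof (intro integral_mono)
    show "integrable M (\<lambda>x. (norm (f x - g x))\<^sup>2 + 2 * (norm (f x - g x) * norm (g x)))"
      using sq_intD[OF d] sq_int_mult_integrable[OF d g] by simp
    show "integrable M (\<lambda>x. \<bar>(norm (f x))\<^sup>2 - (norm (g x))\<^sup>2\<bar>)"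
      using sq_intD[OF f] sq_intD[OF g] by simp
    fix x
    have e: "\<bar>norm (f x) - norm (g x)\<bar> \<le> norm (f x - g x)" by (rule norm_triangle_ineq3)
    have "\<bar>(norm (f x))\<^sup>2 - (norm (g x))\<^sup>2\<bar> = \<bar>norm (f x) - norm (g x)\<bar> * (norm (f x) + norm (g x))"
      by (simp add: power2_eq_square square_diff_square_factored abs_mult)
    also have "\<dots> \<le> norm (f x - g x) * (norm (f x - g x) + 2 * norm (g x))"
      using e by (intro mult_mono) auto
    finally show "\<bar>(norm (f x))\<^sup>2 - (norm (g x))\<^sup>2\<bar> \<le> (norm (f x - g x))\<^sup>2 + 2 * (norm (f x - g x) * norm (g x))"
      by (simp add: power2_eq_square algebra_simps)
  qed
  also have "\<dots> = (l2n M (\<lambda>x. f x - g x))\<^sup>2 + 2 * (\<integral>x. norm (f x - g x) * norm (g x) \<partial>M)"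
    unfolding l2n_power2 using sq_intD[OF d] sq_int_mult_integrable[OF d g] by simp
  also have "\<dots> \<le> (l2n M (\<lambda>x. f x - g x))\<^sup>2 + 2 * (l2n M (\<lambda>x. f x - g x) * l2n M g)"
    using Cauchy_Schwarz_l2n[OF d g] by simp
  finally show ?thesis by (simp add: power2_eq_square algebra_simps)
qed

lemma (in finite_measure) sq_int_const: "sq_int M (\<lambda>x. c)"
  by (auto simp: sq_int_def)

lemma (in finite_measure) sq_int_integrable:
  assumes "sq_int M f" shows "integrable M f"
proof -
  have "integrable M (\<lambda>x. norm (f x))"
    using sq_int_mult_integrable[OF assms sq_int_const[of "1::real"]] by simp
  thus ?thesis using assms by (simp add: integrable_norm_iff sq_int_def)
qed

section \<open>Smooth cut-off functions\<close>

lemma Ck_on_0: "Ck_on S 0 f \<longleftrightarrow> continuous_on S f"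
  unfolding Ck_on_def by (auto intro: exI[of _ "\<lambda>_. f"])

text \<open>Replaces the tower of derivatives in \<open>Ck_on\<close> by a recursion in
  \<open>k\<close>, so that the closure properties below are plain inductions.\<close>

lemma Ck_on_Suc:
  "Ck_on UNIV (Suc k) f \<longleftrightarrow> (\<exists>g. (\<forall>x. (f has_vector_derivative g x) (at x)) \<and> Ck_on UNIV k g)"
proof
  assume "Ck_on UNIV (Suc k) f"
  then obtain F where F: "F 0 = f"
    "\<forall>i<Suc k. \<forall>x. (F i has_vector_derivative F (Suc i) x) (at x)"
    "\<forall>i\<le>Suc k. continuous_on UNIV (F i)"
    unfolding Ck_on_def by auto
  have "\<forall>x. (f has_vector_derivative F 1 x) (at x)" using F(1,2) by auto
  moreover have "Ck_on UNIV k (F 1)"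
    unfolding Ck_on_def using F by (intro exI[of _ "\<lambda>i. F (Suc i)"]) auto
  ultimately show "\<exists>g. (\<forall>x. (f has_vector_derivative g x) (at x)) \<and> Ck_on UNIV k g" by blast
next
  assume "\<exists>g. (\<forall>x. (f has_vector_derivative g x) (at x)) \<and> Ck_on UNIV k g"
  then obtain g G where g: "\<And>x. (f has_vector_derivative g x) (at x)" and G: "G 0 = g"
    "\<forall>i<k. \<forall>x. (G i has_vector_derivative G (Suc i) x) (at x)"
    "\<forall>i\<le>k. continuous_on UNIV (G i)"
    unfolding Ck_on_def by auto
  have "continuous_on UNIV f"
    using g by (meson continuous_at_imp_continuous_on has_vector_derivative_continuous)
  with g G show "Ck_on UNIV (Suc k) f"
    unfolding Ck_on_def
    by (intro exI[of _ "case_nat f G"]) (auto split: nat.splits simp: less_Suc_eq_0_disj)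
qed

lemma Ck_on_SucD: "Ck_on UNIV (Suc k) f \<Longrightarrow> Ck_on UNIV k f"
  unfolding Ck_on_def
  by (elim exE, rule_tac x=F in exI) auto

lemma Ck_on_add:
  "Ck_on UNIV k f \<Longrightarrow> Ck_on UNIV k g \<Longrightarrow> Ck_on UNIV k (\<lambda>x. f x + g x)"
proof (induction k arbitrary: f g)
  case 0
  then show ?case by (simp add: Ck_on_0 continuous_on_add)
next
  case (Suc k)
  then obtain f' g' where "\<forall>x. (f has_vector_derivative f' x) (at x)" "Ck_on UNIV k f'"
    "\<forall>x. (g has_vector_derivative g' x) (at x)" "Ck_on UNIV k g'"
    unfolding Ck_on_Suc by blast
  with Suc.IH[of f' g'] show ?case
    unfolding Ck_on_Suc by (intro exI[of _ "\<lambda>x. f' x + g' x"]) (auto intro!: has_vector_derivative_add)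
qed

lemma Ck_on_mult:
  fixes f g :: "real \<Rightarrow> real"
  shows "Ck_on UNIV k f \<Longrightarrow> Ck_on UNIV k g \<Longrightarrow> Ck_on UNIV k (\<lambda>x. f x * g x)"
proof (induction k arbitrary: f g)
  case 0
  then show ?case by (simp add: Ck_on_0 continuous_on_mult)
next
  case (Suc k)
  then obtain f' g' where d: "\<forall>x. (f has_vector_derivative f' x) (at x)" "Ck_on UNIV k f'"
    "\<forall>x. (g has_vector_derivative g' x) (at x)" "Ck_on UNIV k g'"
    unfolding Ck_on_Suc by blast
  have "Ck_on UNIV k (\<lambda>x. f x * g' x + f' x * g x)"
    using d Suc by (intro Ck_on_add Suc.IH) (auto dest: Ck_on_SucD)
  with d show ?case
    unfolding Ck_on_Suc
    by (intro exI[of _ "\<lambda>x. f x * g' x + f' x * g x"]) (auto intro!: has_vector_derivative_mult)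
qed

text \<open>The outer factor \<open>r\<close> keeps the induction closed: differentiation turns it
  into \<open>r * c\<close>.\<close>

lemma Ck_on_affine:
  fixes f :: "real \<Rightarrow> real"
  shows "Ck_on UNIV k f \<Longrightarrow> Ck_on UNIV k (\<lambda>x. r * f (c * x + d))"
proof (induction k arbitrary: f r)
  case 0
  then have "continuous_on UNIV f" by (simp add: Ck_on_0)
  then have "continuous_on UNIV (\<lambda>x. f (c * x + d))"
    by (rule continuous_on_compose2) (auto intro!: continuous_intros)
  then show ?case by (simp add: Ck_on_0 continuous_on_mult_left)
next
  case (Suc k)
  then obtain f' where d: "\<forall>x. (f has_vector_derivative f' x) (at x)" "Ck_on UNIV k f'"
    unfolding Ck_on_Suc by blast
  have "((\<lambda>x. r * f (c * x + d)) has_vector_derivative (r * c) * f' (c * x + d)) (at x)" for x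
  proof -
    have "(f has_real_derivative f' (c * x + d)) (at (c * x + d))"
      using d(1) by (simp add: has_real_derivative_iff_has_vector_derivative)
    then show ?thesis
      unfolding has_real_derivative_iff_has_vector_derivative[symmetric]
      by (auto intro!: derivative_eq_intros DERIV_chain2[of f])
  qed
  with Suc.IH[OF d(2), of "r * c"] show ?case
    unfolding Ck_on_Suc by (intro exI[of _ "\<lambda>x. (r * c) * f' (c * x + d)"]) simp
qed

text \<open>The functions \<open>exp_flat p\<close> are closed under differentiation, and \<open>exp_flat 1\<close> is the classical
  smooth function that is positive exactly on the positive half line.\<close>

definition exp_flat :: "real poly \<Rightarrow> real \<Rightarrow> real" where
  "exp_flat p x = (if x > 0 then poly p (1 / x) * exp (- (1 / x)) else 0)"

lemma poly_times_exp_tendsto_0: "((\<lambda>t. poly p t * exp (- t)) \<longlongrightarrow> (0::real)) at_top"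
proof -
  have "((\<lambda>t. \<Sum>i\<le>degree p. coeff p i * (t ^ i / exp t)) \<longlongrightarrow> (\<Sum>i\<le>degree p. coeff p i * 0)) at_top"
    by (intro tendsto_intros tendsto_power_div_exp_0)
  then show ?thesis
    by (simp add: poly_altdef exp_minus divide_inverse sum_distrib_right mult.assoc)
qed

lemma exp_flat_tendsto_0: "((\<lambda>x. exp_flat p x) \<longlongrightarrow> 0) (at 0)"
proof (rule filterlim_split_at)
  have "((\<lambda>x. 0) \<longlongrightarrow> (0::real)) (at_left 0)" by simp
  moreover have "\<forall>\<^sub>F x in at_left 0. exp_flat p x = 0"
    by (auto simp: exp_flat_def eventually_at_filter)
  ultimately show "((\<lambda>x. exp_flat p x) \<longlongrightarrow> 0) (at_left 0)"
    by (simp add: tendsto_cong)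
  have "((\<lambda>x. poly p (inverse x) * exp (- (inverse x))) \<longlongrightarrow> 0) (at_right 0)"
    using filterlim_compose[OF poly_times_exp_tendsto_0 filterlim_inverse_at_top_right] .
  moreover have "\<forall>\<^sub>F x in at_right 0. exp_flat p x = poly p (inverse x) * exp (- (inverse x))"
    by (auto simp: exp_flat_def eventually_at_filter inverse_eq_divide)
  ultimately show "((\<lambda>x. exp_flat p x) \<longlongrightarrow> 0) (at_right 0)"
    by (simp add: tendsto_cong)
qed

text \<open>With \<open>t = 1 / x\<close> the derivative in \<open>x\<close> is
  \<open>- t\<^sup>2\<close> times the derivative in \<open>t\<close>, and
  \<open>p(t) exp(-t)\<close> is turned into \<open>t\<^sup>2 (p - p')(t) exp(-t)\<close>; the
  factor \<open>[:0, 0, 1:]\<close> is \<open>t\<^sup>2\<close>.\<close>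

lemma exp_flat_deriv:
  "(exp_flat p has_real_derivative exp_flat ([:0, 0, 1:] * (p - pderiv p)) x) (at x)"
proof (cases "x = 0")
  case True
  \<comment> \<open>At the origin the difference quotient of \<open>exp_flat p\<close> is
    \<open>exp_flat\<close> of \<open>p\<close> multiplied by its variable, so it tends to zero as
    well.\<close>
  have "((\<lambda>h. exp_flat (pCons 0 p) h) \<longlongrightarrow> 0) (at 0)" by (rule exp_flat_tendsto_0)
  moreover have "exp_flat (pCons 0 p) = (\<lambda>h. (exp_flat p (0 + h) - exp_flat p 0) / h)"
    by (auto simp: exp_flat_def)
  ultimately show ?thesis
    using True by (simp add: DERIV_def exp_flat_def)
next
  case False
  show ?thesis
  proof (cases "x > 0")
    case True
    have "((\<lambda>x. poly p (1 / x) * exp (- (1 / x))) has_real_derivative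
        exp_flat ([:0, 0, 1:] * (p - pderiv p)) x) (at x)"
      using True
      by (auto intro!: derivative_eq_intros DERIV_chain2[OF poly_DERIV]
          simp: exp_flat_def field_simps power2_eq_square)
    moreover have "\<forall>\<^sub>F y in nhds x. exp_flat p y = poly p (1 / y) * exp (- (1 / y))"
      using eventually_nhds_in_open[of "{0<..}" x] True
      by (auto simp: exp_flat_def elim: eventually_mono)
    ultimately show ?thesis by (subst DERIV_cong_ev) auto
  next
    case neg: False
    with False have "x < 0" by simp
    have "((\<lambda>x. 0) has_real_derivative exp_flat ([:0, 0, 1:] * (p - pderiv p)) x) (at x)"
      using \<open>x < 0\<close> by (auto simp: exp_flat_def)
    moreover have "\<forall>\<^sub>F y in nhds x. exp_flat p y = 0"
      using eventually_nhds_in_open[of "{..<0}" x] \<open>x < 0\<close>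
      by (auto simp: exp_flat_def elim: eventually_mono)
    ultimately show ?thesis by (subst DERIV_cong_ev) auto
  qed
qed

lemma Ck_exp_flat: "Ck_on UNIV k (exp_flat p)"
proof (induction k arbitrary: p)
  case 0
  then show ?case
    using exp_flat_deriv by (auto simp: Ck_on_0 intro!: continuous_at_imp_continuous_on DERIV_isCont)
next
  case (Suc k)
  then show ?case
    unfolding Ck_on_Suc using exp_flat_deriv has_real_derivative_iff_has_vector_derivative by blast
qed

text \<open>Both functions are used: differences of rescaled copies of \<open>s\<close> approximate
  indicators of intervals, and the rescaled derivative \<open>k\<close> is a mollifier of mass
  one.\<close>

lemma smooth_step_exists:
  obtains s k :: "real \<Rightarrow> real" where
    "\<And>x. (s has_real_derivative k x) (at x)" "\<And>i. Ck_on UNIV i s" "continuous_on UNIV k"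
    "\<And>x. x \<le> 0 \<Longrightarrow> s x = 0" "\<And>x. x \<ge> 1 \<Longrightarrow> s x = 1" "\<And>x. 0 \<le> s x \<and> s x \<le> 1"
    "\<And>x. 0 \<le> k x" "\<And>x. x \<notin> {0..1} \<Longrightarrow> k x = 0"
proof -
  \<comment> \<open>A bump that is positive exactly on the open unit interval; its normalized
    antiderivative is the step.\<close>
  define u where "u x = exp_flat 1 x * exp_flat 1 (1 - x)" for x
  have Cu: "Ck_on UNIV i u" for i
    unfolding u_def using Ck_on_mult[OF Ck_exp_flat[of i 1] Ck_on_affine[OF Ck_exp_flat[of i 1], of 1 "-1" 1]]
    by simp
  have u0: "u x = 0" if "x \<notin> {0<..<1}" for x
    using that by (auto simp: u_def exp_flat_def)
  have upos: "u x > 0" if "x \<in> {0<..<1}" for x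
    using that by (auto simp: u_def exp_flat_def)
  have unn: "u x \<ge> 0" for x using u0[of x] upos[of x] by fastforce
  have contu: "continuous_on UNIV u" using Cu[of 0] by (simp add: Ck_on_0)
  have "\<exists>K. \<forall>x::real. (-\<infinity>::ereal) < x \<longrightarrow> x < \<infinity> \<longrightarrow> (K has_vector_derivative u x) (at x)"
    using contu by (intro einterval_antiderivative) (auto simp: continuous_on_eq_continuous_at)
  then obtain K where K: "\<And>x. (K has_real_derivative u x) (at x)"
    by (auto simp: has_real_derivative_iff_has_vector_derivative)
  have mono: "K x \<le> K y" if "x \<le> y" for x y
    using DERIV_nonneg_imp_nondecreasing[OF that, of K] K unn by blast
  have mvt: "\<exists>z. a < z \<and> z < b \<and> K b - K a = (b - a) * u z" if "a < b" for a b
    using MVT2[OF that, of K u] K by blast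
  have left: "K x = K 0" if "x \<le> 0" for x
    using mvt[of x 0] u0 that by (cases "x = 0") fastforce+
  have right: "K x = K 1" if "x \<ge> 1" for x
    using mvt[of 1 x] u0 that by (cases "x = 1") fastforce+
  have str: "K 0 < K 1"
    using mvt[of 0 1] upos by fastforce
  define c where "c = K 1 - K 0"
  have c: "c > 0" using str by (simp add: c_def)
  show ?thesis
  proof (rule that[of "\<lambda>x. (K x - K 0) / c" "\<lambda>x. u x / c"])
    show d: "((\<lambda>x. (K x - K 0) / c) has_real_derivative u x / c) (at x)" for x
      using K c by (auto intro!: derivative_eq_intros)
    show "Ck_on UNIV i (\<lambda>x. (K x - K 0) / c)" for i
    proof -
      have "Ck_on UNIV i (\<lambda>x. u x / c)"
        using Ck_on_affine[OF Cu[of i], of "1 / c" 1 0] by simp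
      then have "Ck_on UNIV (Suc i) (\<lambda>x. (K x - K 0) / c)"
        unfolding Ck_on_Suc using d
        by (intro exI[of _ "\<lambda>x. u x / c"]) (simp add: has_real_derivative_iff_has_vector_derivative)
      then show ?thesis by (rule Ck_on_SucD)
    qed
    show "continuous_on UNIV (\<lambda>x. u x / c)" using contu c by (intro continuous_intros) auto
    show "(K x - K 0) / c = 0" if "x \<le> 0" for x using left[OF that] by simp
    show "(K x - K 0) / c = 1" if "x \<ge> 1" for x using right[OF that] c by (simp add: c_def)
    show "0 \<le> (K x - K 0) / c \<and> (K x - K 0) / c \<le> 1" for x
      using mono[of 0 x] mono[of x 1] left[of x] right[of x] c
      by (cases "x \<le> 0"; cases "x \<ge> 1") (auto simp: c_def)
    show "0 \<le> u x / c" for x using unn c by simp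
    show "u x / c = 0" if "x \<notin> {0..1}" for x using u0[of x] that by auto
  qed
qed

section \<open>Integration on an interval\<close>

text \<open>A finite measure of its own, to which the facts on \<open>sq_int\<close> and
  \<open>l2n\<close> apply directly; the set integrals of the definitions are translated to it
  once.\<close>

definition intv :: "real \<Rightarrow> real measure" where
  "intv L = restrict_space lborel {0<..<L}"

lemma space_intv [simp]: "space (intv L) = {0<..<L}"
  by (simp add: intv_def space_restrict_space)

lemma measurable_ident_intv [measurable]: "(\<lambda>x. x) \<in> borel_measurable (intv L)"
  unfolding intv_def by (rule measurable_restrict_space1) simp

lemma measurable_intv_borel: "f \<in> borel_measurable borel \<Longrightarrow> f \<in> borel_measurable (intv L)"
  unfolding intv_def by (rule measurable_restrict_space1) simp

lemma emeasure_intv: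
  assumes "A \<in> sets borel" "A \<subseteq> {0<..<L}" shows "emeasure (intv L) A = emeasure lborel A"
  using assms by (simp add: intv_def emeasure_restrict_space)

lemma finite_measure_intv: "finite_measure (intv L)"
proof (rule finite_measureI)
  have "emeasure (intv L) {0<..<L} = emeasure lborel {0<..<L}" by (rule emeasure_intv) auto
  thus "emeasure (intv L) (space (intv L)) \<noteq> \<infinity>"
    by (cases "0 \<le> L") auto
qed

lemma integral_intv:
  fixes f :: "real \<Rightarrow> 'b::{banach,second_countable_topology}"
  shows "(LINT x:{0<..<L}|lborel. f x) = (\<integral>x. f x \<partial>intv L)"
  by (simp add: intv_def integral_restrict_space set_lebesgue_integral_def)

lemma integrable_intv:
  fixes f :: "real \<Rightarrow> 'b::{banach,second_countable_topology}"
  shows "set_integrable lborel {0<..<L} f \<longleftrightarrow> integrable (intv L) f"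
  by (simp add: intv_def integrable_restrict_space set_integrable_def)

lemma measurable_intv:
  fixes f :: "real \<Rightarrow> 'b::real_normed_vector"
  shows "f \<in> borel_measurable (intv L) \<longleftrightarrow> set_borel_measurable lborel {0<..<L} f"
  by (simp add: intv_def borel_measurable_restrict_space_iff set_borel_measurable_def)

lemma AE_intv: "(AE x in lborel. x \<in> {0<..<L} \<longrightarrow> P x) \<longleftrightarrow> (AE x in intv L. P x)"
  unfolding intv_def by (rule AE_restrict_space_iff[symmetric]) simp

lemma AE_intv_neq: "AE x in intv L. x \<noteq> c"
  unfolding AE_intv[symmetric] using AE_lborel_singleton[of c] by eventually_elim auto

lemma L2_fun_iff: "L2_fun L g \<longleftrightarrow> sq_int (intv L) g"
  by (simp add: L2_fun_def sq_int_def measurable_intv integrable_intv)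

lemma L2_norm_eq: "L2_norm L g = l2n (intv L) g"
  by (simp add: L2_norm_def l2n_def integral_intv)

lemma integrable_intv_const [simp]: "integrable (intv L) (\<lambda>x. c)"
  by (rule finite_measure.integrable_const[OF finite_measure_intv])

lemma continuous_measurable_intv:
  fixes f :: "real \<Rightarrow> 'b::real_normed_vector"
  assumes "continuous_on {0..L} f" shows "f \<in> borel_measurable (intv L)"
  unfolding measurable_intv set_borel_measurable_def
  using borel_measurable_continuous_on_indicator[of "{0<..<L}" f]
    continuous_on_subset[OF assms, of "{0<..<L}"]
  by (simp add: greaterThanLessThan_subseteq_atLeastAtMost_iff)

lemma continuous_bounded_Icc:
  fixes f :: "real \<Rightarrow> 'b::real_normed_vector"
  assumes "continuous_on {0..L} f"
  obtains B where "B > 0" "\<And>x. x \<in> {0..L} \<Longrightarrow> norm (f x) \<le> B"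
proof -
  have "bounded (f ` {0..L})"
    by (intro compact_imp_bounded compact_continuous_image assms) auto
  thus ?thesis using that unfolding bounded_pos by blast
qed

lemma bounded_integrable_intv:
  fixes f :: "real \<Rightarrow> 'b::{banach,second_countable_topology}"
  assumes "f \<in> borel_measurable (intv L)" "\<And>x. x \<in> {0<..<L} \<Longrightarrow> norm (f x) \<le> B"
  shows "integrable (intv L) f"
  by (rule Bochner_Integration.integrable_bound[OF integrable_intv_const[of L B] assms(1)])
     (use assms(2) in \<open>force intro!: AE_I2\<close>)

lemma bounded_sq_int_intv:
  fixes f :: "real \<Rightarrow> 'b::euclidean_space"
  assumes "f \<in> borel_measurable (intv L)" "\<And>x. x \<in> {0<..<L} \<Longrightarrow> norm (f x) \<le> B"
  shows "sq_int (intv L) f"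
  by (rule sq_int_bound[OF assms(1) integrable_intv_const[of L "B\<^sup>2"]])
     (use assms(2) in \<open>force intro!: AE_I2 power_mono\<close>)

lemma continuous_integrable_intv:
  fixes f :: "real \<Rightarrow> 'b::{banach,second_countable_topology}"
  assumes "continuous_on {0..L} f" shows "integrable (intv L) f"
proof -
  obtain B where "\<And>x. x \<in> {0..L} \<Longrightarrow> norm (f x) \<le> B"
    using continuous_bounded_Icc[OF assms] by blast
  thus ?thesis by (intro bounded_integrable_intv[of f L B] continuous_measurable_intv assms) auto
qed

lemma continuous_sq_int_intv:
  fixes f :: "real \<Rightarrow> 'b::euclidean_space"
  assumes "continuous_on {0..L} f" shows "sq_int (intv L) f"
proof -
  obtain B where "\<And>x. x \<in> {0..L} \<Longrightarrow> norm (f x) \<le> B"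
    using continuous_bounded_Icc[OF assms] by blast
  thus ?thesis by (intro bounded_sq_int_intv[of f L B] continuous_measurable_intv assms) auto
qed

section \<open>Integrals over half-open segments\<close>

lemma indicator_measurable_intv [measurable]: "A \<in> sets borel \<Longrightarrow> indicat_real A \<in> borel_measurable (intv L)"
  by (rule measurable_intv_borel) simp

lemma integrable_indicator_scaleR:
  fixes g :: "real \<Rightarrow> 'b::{banach,second_countable_topology}"
  assumes "integrable (intv L) g" "A \<in> sets borel"
  shows "integrable (intv L) (\<lambda>t. indicator A t *\<^sub>R g t)"
proof (rule Bochner_Integration.integrable_bound[OF assms(1)])
  have [measurable]: "g \<in> borel_measurable (intv L)" using assms(1) by simp
  have [measurable]: "indicat_real A \<in> borel_measurable (intv L)" using assms(2) by measurable
  show "(\<lambda>t. indicator A t *\<^sub>R g t) \<in> borel_measurable (intv L)" by measurable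
qed (auto simp: indicator_def)

text \<open>Half-open segments make adjacent ones disjoint, so that additivity needs no null sets,
  and they agree with the choice of \<open>elem\<close> at the nodes.\<close>

definition seg :: "real \<Rightarrow> (real \<Rightarrow> 'b::{banach,second_countable_topology}) \<Rightarrow> real \<Rightarrow> real \<Rightarrow> 'b" where
  "seg L g a b = (\<integral>t. indicator {a<..b} t *\<^sub>R g t \<partial>intv L)"

lemma seg_same [simp]: "seg L g a a = 0"
  by (simp add: seg_def)

lemma seg_add:
  assumes "integrable (intv L) g" "a \<le> b" "b \<le> c"
  shows "seg L g a b + seg L g b c = seg L g a c"
proof -
  have "indicator {a<..c} t *\<^sub>R g t = indicator {a<..b} t *\<^sub>R g t + indicator {b<..c} t *\<^sub>R g t" for t
    using assms by (auto simp: indicator_def)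
  thus ?thesis unfolding seg_def using integrable_indicator_scaleR[OF assms(1)] by simp
qed

lemma seg_linear:
  assumes "integrable (intv L) f" "integrable (intv L) g"
  shows "seg L (\<lambda>t. r *\<^sub>R f t + s *\<^sub>R g t) a b = r *\<^sub>R seg L f a b + s *\<^sub>R seg L g a b"
proof -
  have "seg L (\<lambda>t. r *\<^sub>R f t + s *\<^sub>R g t) a b =
     (\<integral>t. r *\<^sub>R (indicator {a<..b} t *\<^sub>R f t) + s *\<^sub>R (indicator {a<..b} t *\<^sub>R g t) \<partial>intv L)"
    unfolding seg_def by (intro Bochner_Integration.integral_cong) (simp_all add: scaleR_add_right mult.commute)
  also have "\<dots> = (\<integral>t. r *\<^sub>R (indicator {a<..b} t *\<^sub>R f t) \<partial>intv L)
      + (\<integral>t. s *\<^sub>R (indicator {a<..b} t *\<^sub>R g t) \<partial>intv L)"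
    using integrable_indicator_scaleR[OF assms(1)] integrable_indicator_scaleR[OF assms(2)]
    by (intro Bochner_Integration.integral_add Bochner_Integration.integrable_scaleR_right) auto
  finally show ?thesis unfolding seg_def by (simp only: integral_scaleR_right)
qed

lemma seg_cong_AE:
  assumes "AE t in intv L. f t = g t" "f \<in> borel_measurable (intv L)" "g \<in> borel_measurable (intv L)"
  shows "seg L f a b = seg L g a b"
  unfolding seg_def
proof (rule integral_cong_AE)
  have [measurable]: "indicat_real {a<..b} \<in> borel_measurable (intv L)" by measurable
  note [measurable] = assms(2,3)
  show "(\<lambda>t. indicat_real {a<..b} t *\<^sub>R f t) \<in> borel_measurable (intv L)" by measurable
  show "(\<lambda>t. indicat_real {a<..b} t *\<^sub>R g t) \<in> borel_measurable (intv L)" by measurable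
qed (use assms(1) in auto)

lemma seg_cong: "(\<And>t. a < t \<Longrightarrow> t \<le> b \<Longrightarrow> 0 < t \<Longrightarrow> t < L \<Longrightarrow> f t = g t) \<Longrightarrow> seg L f a b = seg L g a b"
  unfolding seg_def by (intro Bochner_Integration.integral_cong) (auto simp: indicator_def)

lemma seg_full:
  assumes "0 \<le> L" shows "seg L g 0 L = (\<integral>t. g t \<partial>intv L)"
  unfolding seg_def by (intro Bochner_Integration.integral_cong) auto

lemma seg_const:
  assumes "0 \<le> a" "a \<le> b" "b \<le> L" shows "seg L (\<lambda>_. c) a b = (b - a) *\<^sub>R c"
proof -
  have "seg L (\<lambda>_. c) a b = (\<integral>t. indicator ({a<..b} \<inter> {0<..<L}) t *\<^sub>R c \<partial>intv L)"
    unfolding seg_def by (intro Bochner_Integration.integral_cong) (auto simp: indicator_def)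
  also have "\<dots> = measure (intv L) ({a<..b} \<inter> {0<..<L}) *\<^sub>R c"
  proof -
    have "{a<..b} \<inter> {0<..<L} \<in> sets (intv L)"
      by (auto simp: intv_def sets_restrict_space)
    moreover have "emeasure (intv L) ({a<..b} \<inter> {0<..<L}) < \<infinity>"
      using finite_measure.emeasure_finite[OF finite_measure_intv] by (simp add: less_top)
    ultimately show ?thesis
      by (rule has_bochner_integral_integral_eq[OF has_bochner_integral_indicator])
  qed
  also have "measure (intv L) ({a<..b} \<inter> {0<..<L}) = measure lborel {a<..<b}"
    unfolding measure_def
  proof (rule arg_cong[of _ _ enn2real])
    have "emeasure (intv L) ({a<..b} \<inter> {0<..<L}) = emeasure lborel ({a<..b} \<inter> {0<..<L})"
      by (rule emeasure_intv) auto
    \<comment> \<open>If \<open>b = L\<close>, the point \<open>b\<close> is missing from the open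
      interval; the two sets agree up to that point.\<close>
    also have "\<dots> = emeasure lborel {a<..<b}"
    proof (rule emeasure_eq_AE)
      show "AE x in lborel. (x \<in> {a<..b} \<inter> {0<..<L}) = (x \<in> {a<..<b})"
        using AE_lborel_singleton[of b] by eventually_elim (use assms in auto)
    qed auto
    finally show "emeasure (intv L) ({a<..b} \<inter> {0<..<L}) = emeasure lborel {a<..<b}" .
  qed
  finally show ?thesis using assms by simp
qed

lemma seg_norm_le:
  assumes "integrable (intv L) g"
  shows "norm (seg L g a b) \<le> seg L (\<lambda>t. norm (g t)) a b"
proof -
  have "norm (seg L g a b) \<le> (\<integral>t. norm (indicator {a<..b} t *\<^sub>R g t) \<partial>intv L)"
    unfolding seg_def by (rule integral_norm_bound)
  thus ?thesis by (simp add: seg_def)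
qed

lemma seg_mono:
  fixes f g :: "real \<Rightarrow> real"
  assumes "integrable (intv L) f" "integrable (intv L) g" "\<And>t. 0 < t \<Longrightarrow> t < L \<Longrightarrow> a < t \<Longrightarrow> t \<le> b \<Longrightarrow> f t \<le> g t"
  shows "seg L f a b \<le> seg L g a b"
  unfolding seg_def
  by (intro integral_mono integrable_indicator_scaleR assms) (use assms(3) in \<open>auto simp: indicator_def\<close>)

lemma seg_nonneg: "(\<And>t. 0 \<le> g t) \<Longrightarrow> 0 \<le> seg L (g::_\<Rightarrow>real) a b"
  unfolding seg_def by (intro integral_nonneg_AE AE_I2) (auto simp: indicator_def)

lemma seg_subset_mono:
  fixes g :: "real \<Rightarrow> real"
  assumes "integrable (intv L) g" "\<And>t. 0 \<le> g t" "c \<le> a" "b \<le> d"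
  shows "seg L g a b \<le> seg L g c d"
  unfolding seg_def
  by (intro integral_mono integrable_indicator_scaleR assms) (use assms in \<open>auto simp: indicator_def\<close>)

text \<open>Cauchy-Schwarz for the indicator of the segment and the truncated \<open>g\<close>. The
  factor \<open>b - a\<close> is the origin of the Hoelder exponent one half for primitives and of
  the contraction property of averages.\<close>

lemma seg_Cauchy_Schwarz:
  fixes g :: "real \<Rightarrow> 'b::euclidean_space"
  assumes g: "sq_int (intv L) g" and ab: "0 \<le> a" "a \<le> b" "b \<le> L"
  shows "(norm (seg L g a b))\<^sup>2 \<le> (b - a) * seg L (\<lambda>t. (norm (g t))\<^sup>2) a b"
proof -
  interpret finite_measure "intv L" by (rule finite_measure_intv)
  have i1: "sq_int (intv L) (indicat_real {a<..b})"
    by (rule bounded_sq_int_intv[of _ _ 1]) (auto simp: indicator_def)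
  have i2: "sq_int (intv L) (\<lambda>t. indicat_real {a<..b} t *\<^sub>R g t)"
    by (rule sq_int_bounded_mult[OF g, of _ 1]) (auto simp: indicator_def)
  have n: "(l2n (intv L) (indicat_real {a<..b}))\<^sup>2 = b - a"
  proof -
    have "(l2n (intv L) (indicat_real {a<..b}))\<^sup>2 = seg L (\<lambda>_. 1::real) a b"
      unfolding l2n_power2 seg_def by (intro Bochner_Integration.integral_cong) (auto simp: indicator_def)
    thus ?thesis using seg_const[OF ab, of "1::real"] by simp
  qed
  have n2: "(l2n (intv L) (\<lambda>t. indicat_real {a<..b} t *\<^sub>R g t))\<^sup>2 = seg L (\<lambda>t. (norm (g t))\<^sup>2) a b"
    unfolding l2n_power2 seg_def by (intro Bochner_Integration.integral_cong) (auto simp: indicator_def)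
  have "norm (seg L g a b) \<le> seg L (\<lambda>t. norm (g t)) a b"
    by (rule seg_norm_le[OF sq_int_integrable[OF g]])
  also have "\<dots> = (\<integral>t. norm (indicat_real {a<..b} t) * norm (indicat_real {a<..b} t *\<^sub>R g t) \<partial>intv L)"
    unfolding seg_def by (intro Bochner_Integration.integral_cong) (auto simp: indicator_def)
  also have "\<dots> \<le> l2n (intv L) (indicat_real {a<..b}) * l2n (intv L) (\<lambda>t. indicat_real {a<..b} t *\<^sub>R g t)"
    by (rule Cauchy_Schwarz_l2n[OF i1 i2])
  finally have "(norm (seg L g a b))\<^sup>2 \<le> (l2n (intv L) (indicat_real {a<..b}) * l2n (intv L) (\<lambda>t. indicat_real {a<..b} t *\<^sub>R g t))\<^sup>2"
    by (rule power_mono) simp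
  thus ?thesis by (simp add: power_mult_distrib n n2)
qed

text \<open>Dominated convergence with majorant \<open>norm (g t)\<close>: the indicators of the
  segments converge at every point except possibly the limiting end point \<open>c\<close>.\<close>

lemma seg_continuous:
  fixes g :: "real \<Rightarrow> 'b::{banach,second_countable_topology}"
  assumes g: "integrable (intv L) g"
  shows "continuous_on S (seg L g a)"
  unfolding continuous_on_sequentially o_def
proof (intro allI ballI impI)
  fix x :: "nat \<Rightarrow> real" and c assume "c \<in> S" and "(\<forall>n. x n \<in> S) \<and> x \<longlonglongrightarrow> c"
  hence x: "x \<longlonglongrightarrow> c" by simp
  show "(\<lambda>n. seg L g a (x n)) \<longlonglongrightarrow> seg L g a c"
    unfolding seg_def
  proof (rule integral_dominated_convergence)
    show "integrable (intv L) (\<lambda>t. norm (g t))" using g by simp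
    show "(\<lambda>t. indicat_real {a<..c} t *\<^sub>R g t) \<in> borel_measurable (intv L)"
      "\<And>n. (\<lambda>t. indicat_real {a<..x n} t *\<^sub>R g t) \<in> borel_measurable (intv L)"
      using integrable_indicator_scaleR[OF g] by auto
    show "AE t in intv L. (\<lambda>n. indicat_real {a<..x n} t *\<^sub>R g t) \<longlonglongrightarrow> indicat_real {a<..c} t *\<^sub>R g t"
      using AE_intv_neq[where L=L and c=c]
    proof eventually_elim
      fix t assume "t \<noteq> c"
      have "\<forall>\<^sub>F n in sequentially. (t \<le> x n) = (t \<le> c)"
      proof (cases "t < c")
        case True
        with order_tendstoD(1)[OF x, of t] show ?thesis by (auto elim!: eventually_mono)
      next
        case False
        with \<open>t \<noteq> c\<close> have "c < t" by simp
        with order_tendstoD(2)[OF x, of t] show ?thesis by (auto elim!: eventually_mono)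
      qed
      hence "\<forall>\<^sub>F n in sequentially. indicat_real {a<..x n} t *\<^sub>R g t = indicat_real {a<..c} t *\<^sub>R g t"
        by eventually_elim (auto simp: indicator_def)
      thus "(\<lambda>n. indicat_real {a<..x n} t *\<^sub>R g t) \<longlonglongrightarrow> indicat_real {a<..c} t *\<^sub>R g t"
        by (rule tendsto_eventually)
    qed
  qed (auto simp: indicator_def)
qed

text \<open>The function \<open>v\<close> is only known to be measurable on the open interval, but a finite set of
  end points does not affect measurability.\<close>

lemma seg_eq_lborel:
  fixes v :: "real \<Rightarrow> 'b::{banach,second_countable_topology}"
  assumes v: "v \<in> borel_measurable (intv L)" and ab: "0 \<le> a" "a \<le> b" "b \<le> L"
  shows "seg L v a b = (LINT t:{a..b}|lborel. v t)"
proof -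
  have m: "(\<lambda>t. indicat_real {0<..<L} t *\<^sub>R v t) \<in> borel_measurable borel"
    using v unfolding measurable_intv set_borel_measurable_def by simp
  have "seg L v a b = (\<integral>t. indicator {0<..<L} t *\<^sub>R (indicator {a<..b} t *\<^sub>R v t) \<partial>lborel)"
    unfolding seg_def intv_def by (simp add: integral_restrict_space)
  also have "\<dots> = (\<integral>t. indicator {a..b} t *\<^sub>R v t \<partial>lborel)"
  proof (rule integral_cong_AE)
    have eq: "(\<lambda>t. indicat_real {0<..<L} t *\<^sub>R (indicat_real {a<..b} t *\<^sub>R v t)) =
        (\<lambda>t. indicat_real {a<..b} t *\<^sub>R (indicat_real {0<..<L} t *\<^sub>R v t))"
      by (auto simp: indicator_def)
    show "(\<lambda>t. indicat_real {0<..<L} t *\<^sub>R (indicat_real {a<..b} t *\<^sub>R v t)) \<in> borel_measurable lborel"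
      unfolding eq measurable_lborel2 by (rule borel_measurable_scaleR[OF _ m]) simp
    have "(\<lambda>t. indicator {a..b} t *\<^sub>R v t) = (\<lambda>t. indicator {a..b} t *\<^sub>R (indicat_real {0<..<L} t *\<^sub>R v t)
        + indicator ({a..b} \<inter> {0}) t *\<^sub>R v 0 + indicator ({a..b} \<inter> ({L} - {0})) t *\<^sub>R v L)"
      using ab by (auto simp: indicator_def fun_eq_iff)
    also have "\<dots> \<in> borel_measurable borel"
      by (intro borel_measurable_add borel_measurable_scaleR[OF _ m] borel_measurable_scaleR[OF _ borel_measurable_const]) simp_all
    finally show "(\<lambda>t. indicat_real {a..b} t *\<^sub>R v t) \<in> borel_measurable lborel" by simp
    show "AE t in lborel. indicat_real {0<..<L} t *\<^sub>R (indicator {a<..b} t *\<^sub>R v t) = indicator {a..b} t *\<^sub>R v t"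
      using AE_lborel_singleton[of a] AE_lborel_singleton[of L]
      by eventually_elim (use ab in \<open>auto simp: indicator_def\<close>)
  qed
  finally show ?thesis by (simp add: set_lebesgue_integral_def)
qed

section \<open>Weak derivatives and primitives\<close>

text \<open>Absolute continuity of \<open>f\<close> with derivative \<open>g\<close>, which is the
  working form of \<open>has_weak_deriv\<close>. Unlike the latter it fixes the continuous
  representative and is meaningful in any Banach space.\<close>

definition primitive_of :: "real \<Rightarrow> (real \<Rightarrow> 'b::{banach,second_countable_topology}) \<Rightarrow> (real \<Rightarrow> 'b) \<Rightarrow> bool" where
  "primitive_of L f g \<longleftrightarrow> integrable (intv L) g \<and> (\<forall>x\<in>{0..L}. f x = f 0 + seg L g 0 x)"

lemma primitive_of_eq: "primitive_of L f g \<Longrightarrow> 0 \<le> x \<Longrightarrow> x \<le> L \<Longrightarrow> f x = f 0 + seg L g 0 x"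
  by (simp only: primitive_of_def atLeastAtMost_iff)

lemma primitive_of_integrable: "primitive_of L f g \<Longrightarrow> integrable (intv L) g"
  by (simp only: primitive_of_def)

lemma primitive_ofD:
  assumes "primitive_of L f g" "0 \<le> a" "a \<le> b" "b \<le> L"
  shows "f b - f a = seg L g a b"
proof -
  have "f b = f 0 + seg L g 0 b" "f a = f 0 + seg L g 0 a"
    using assms by (auto intro!: primitive_of_eq[OF assms(1)])
  moreover have "seg L g 0 a + seg L g a b = seg L g 0 b"
    using assms by (intro seg_add primitive_of_integrable)
  ultimately show ?thesis by (metis add_diff_cancel_left add_diff_cancel_left')
qed

lemma primitive_of_continuous:
  assumes "primitive_of L f g" shows "continuous_on {0..L} f"
proof -
  have "continuous_on {0..L} (\<lambda>x. f 0 + seg L g 0 x)"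
    using assms by (intro continuous_intros seg_continuous primitive_of_integrable)
  thus ?thesis by (rule continuous_on_eq) (metis primitive_of_eq[OF assms] atLeastAtMost_iff)
qed

text \<open>The substitution \<open>x = c + t / (n + 1)\<close> turns the concentrating kernels into
  the fixed kernel \<open>k\<close>, of mass \<open>s 1 - s 0 = 1\<close>, and moves the limit into
  the argument of \<open>f\<close>, where dominated convergence and continuity at \<open>c\<close>
  apply.\<close>

lemma approximate_identity:
  fixes f :: "real \<Rightarrow> 'b::euclidean_space"
  assumes s: "\<And>x. (s has_real_derivative k x) (at x)" and k: "continuous_on UNIV k" "\<And>x. 0 \<le> k x"
      "\<And>x. x \<notin> {0..1} \<Longrightarrow> k x = 0" "s 0 = 0" "s 1 = 1"
    and f: "continuous_on {0..L} f" and c: "0 < c" "c < L"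
  shows "(\<lambda>n. \<integral>x. (real (Suc n) * k (real (Suc n) * (x - c))) *\<^sub>R f x \<partial>intv L) \<longlonglongrightarrow> f c"
proof -
  obtain B where B: "B > 0" "\<And>x. x \<in> {0..L} \<Longrightarrow> norm (f x) \<le> B"
    using continuous_bounded_Icc[OF f] by blast
  \<comment> \<open>Extension by zero, because the substitution is a change of variables on the
    whole line.\<close>
  define F where "F x = indicator {0<..<L} x *\<^sub>R f x" for x
  have F_meas [measurable]: "F \<in> borel_measurable borel"
    using continuous_measurable_intv[OF f] unfolding measurable_intv set_borel_measurable_def F_def by simp
  have F_bound: "norm (F x) \<le> B" for x
    using B by (auto simp: F_def indicator_def)
  have k_meas: "k \<in> borel_measurable borel"
    using k(1) by (rule borel_measurable_continuous_onI)
  have hb: "has_bochner_integral lborel (\<lambda>x. indicator {0..1} x *\<^sub>R k x) (s 1 - s 0)"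
    using s k(1) by (intro has_bochner_integral_FTC_Icc)
       (auto simp: has_real_derivative_iff_has_vector_derivative
             intro: has_vector_derivative_at_within continuous_on_subset)
  have "(\<lambda>x. indicator {0..1} x *\<^sub>R k x) = k"
    using k(3) by (auto simp: indicator_def fun_eq_iff)
  with hb k(4,5) have k_int: "integrable lborel k" "(\<integral>x. k x \<partial>lborel) = 1"
    by (auto simp: has_bochner_integral_iff)
  have eq: "(\<integral>x. (real (Suc n) * k (real (Suc n) * (x - c))) *\<^sub>R f x \<partial>intv L) =
      (\<integral>t. k t *\<^sub>R F (c + t / real (Suc n)) \<partial>lborel)" for n
  proof -
    let ?r = "1 / real (Suc n)"
    have "(\<integral>x. (real (Suc n) * k (real (Suc n) * (x - c))) *\<^sub>R f x \<partial>intv L) =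
        (\<integral>x. (real (Suc n) * k (real (Suc n) * (x - c))) *\<^sub>R F x \<partial>lborel)"
      unfolding F_def intv_def
      by (simp add: integral_restrict_space mult.commute del: of_nat_Suc)
    also have "\<dots> = \<bar>?r\<bar> *\<^sub>R (\<integral>t. (real (Suc n) * k (real (Suc n) * ((c + ?r * t) - c))) *\<^sub>R F (c + ?r * t) \<partial>lborel)"
      by (rule lborel_integral_real_affine) simp
    also have "\<dots> = (\<integral>t. k t *\<^sub>R F (c + t / real (Suc n)) \<partial>lborel)"
      by (simp flip: integral_scaleR_right del: of_nat_Suc)
    finally show ?thesis .
  qed
  have "(\<lambda>n. \<integral>t. k t *\<^sub>R F (c + t / real (Suc n)) \<partial>lborel) \<longlonglongrightarrow> (\<integral>t. k t *\<^sub>R f c \<partial>lborel)"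
  proof (rule integral_dominated_convergence)
    show "integrable lborel (\<lambda>t. k t * B)" using k_int by simp
    show "AE t in lborel. norm (k t *\<^sub>R F (c + t / real (Suc n))) \<le> k t * B" for n
      using k(2) F_bound by (auto intro!: AE_I2 mult_left_mono)
    have "isCont F c"
    proof -
      have "isCont f c"
        using f c by (auto intro: continuous_on_interior)
      moreover have "\<forall>\<^sub>F x in nhds c. F x = f x"
        using eventually_nhds_in_open[of "{0<..<L}" c] c
        by (auto simp: F_def elim: eventually_mono)
      ultimately show ?thesis
        using isCont_cong by blast
    qed
    moreover have "F c = f c" using c by (simp add: F_def)
    moreover have "(\<lambda>n. c + t / real (Suc n)) \<longlonglongrightarrow> c" for t
    proof -
      have "(\<lambda>n. c + t * (1 / real (Suc n))) \<longlonglongrightarrow> c + t * 0"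
        by (intro tendsto_intros LIMSEQ_Suc[OF lim_1_over_n])
      thus ?thesis by simp
    qed
    ultimately have "(\<lambda>n. F (c + t / real (Suc n))) \<longlonglongrightarrow> f c" for t
      by (metis isCont_tendsto_compose)
    thus "AE t in lborel. (\<lambda>n. k t *\<^sub>R F (c + t / real (Suc n))) \<longlonglongrightarrow> k t *\<^sub>R f c"
      by (intro AE_I2 tendsto_intros)
    show "(\<lambda>t. k t *\<^sub>R f c) \<in> borel_measurable lborel"
      unfolding measurable_lborel2
      by (rule borel_measurable_scaleR[OF k_meas borel_measurable_const])
    show "(\<lambda>t. k t *\<^sub>R F (c + t / real (Suc n))) \<in> borel_measurable lborel" for n
      unfolding measurable_lborel2
      by (intro borel_measurable_scaleR[OF k_meas] measurable_compose[OF _ F_meas]) simp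
  qed
  also have "(\<integral>t. k t *\<^sub>R f c \<partial>lborel) = f c" using k_int by simp
  finally show ?thesis unfolding eq .
qed

text \<open>Test with smooth approximations of the indicator of a segment. Their derivatives are two
  mollifiers, concentrating at \<open>a\<close> and \<open>b\<close> with opposite signs, so the
  defining identity tends to \<open>f a - f b = - seg L g a b\<close>.\<close>

lemma weak_deriv_imp_primitive:
  assumes w: "has_weak_deriv L f g" and f: "continuous_on {0..L} f" and L: "L > 0"
  shows "primitive_of L f g"
proof -
  have g: "integrable (intv L) g" using w by (simp add: has_weak_deriv_def integrable_intv)
  have [measurable]: "g \<in> borel_measurable (intv L)" using g by simp
  obtain s k :: "real \<Rightarrow> real" where s: "\<And>x. (s has_real_derivative k x) (at x)" "\<And>i. Ck_on UNIV i s"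
    "continuous_on UNIV k" "\<And>x. x \<le> 0 \<Longrightarrow> s x = 0" "\<And>x. x \<ge> 1 \<Longrightarrow> s x = 1"
    "\<And>x. 0 \<le> s x \<and> s x \<le> 1" "\<And>x. 0 \<le> k x" "\<And>x. x \<notin> {0..1} \<Longrightarrow> k x = 0"
    using smooth_step_exists by metis
  have interior: "f b - f a = seg L g a b" if ab: "0 < a" "a \<le> b" "b < L" for a b
  proof -
    define \<phi> where "\<phi> n x = s (real (Suc n) * (x - a)) - s (real (Suc n) * (x - b))" for n x
    define \<phi>' where "\<phi>' n x = real (Suc n) * k (real (Suc n) * (x - a)) - real (Suc n) * k (real (Suc n) * (x - b))" for n x
    have der: "(\<phi> n has_real_derivative \<phi>' n x) (at x)" for n x
      unfolding \<phi>_def \<phi>'_def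
      by (auto intro!: derivative_eq_intros DERIV_chain2[OF s(1)] simp: algebra_simps)
    have Ck: "Ck_on UNIV i (\<phi> n)" for i n
    proof -
      have "Ck_on UNIV i (\<lambda>x. 1 * s (real (Suc n) * x + (- real (Suc n) * a)) + (-1) * s (real (Suc n) * x + (- real (Suc n) * b)))"
        by (intro Ck_on_add Ck_on_affine s(2))
      thus ?thesis by (simp add: \<phi>_def[abs_def] algebra_simps del: of_nat_Suc)
    qed
    \<comment> \<open>The step at \<open>b\<close> needs room to its right: the support reaches up
      to \<open>b + 1 / (n + 1)\<close> and has to stay inside the interval.\<close>
    obtain n0 :: nat where n0: "b + 1 / real (Suc n0) < L"
      using nat_approx_posE[of "L - b"] ab(3) by (metis diff_gt_0_iff_gt less_diff_eq add.commute)
    have test: "test_function L (\<phi> n)" if "n \<ge> n0" for n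
      unfolding test_function_def
    proof (intro conjI exI)
      show "smooth_on UNIV (\<phi> n)" using Ck by (simp add: smooth_on_def)
      show "0 < a" by fact
      have "1 / real (Suc n) \<le> 1 / real (Suc n0)" using that by (simp add: frac_le)
      with n0 show "b + 1 / real (Suc n) < L" by linarith
      show "\<forall>x. x \<notin> {a..b + 1 / real (Suc n)} \<longrightarrow> \<phi> n x = 0"
      proof (intro allI impI)
        fix x assume "x \<notin> {a..b + 1 / real (Suc n)}"
        then consider "x \<le> a" | "x \<ge> b + 1 / real (Suc n)" by fastforce
        thus "\<phi> n x = 0"
        proof cases
          case 1
          hence "real (Suc n) * (x - a) \<le> 0" "real (Suc n) * (x - b) \<le> 0"
            using ab by (auto intro!: mult_nonneg_nonpos simp del: of_nat_Suc)
          thus ?thesis by (simp add: \<phi>_def s(4) del: of_nat_Suc)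
        next
          case 2
          hence "real (Suc n) * (x - b) \<ge> 1"
            by (simp add: field_simps del: of_nat_Suc)
          moreover from this have "real (Suc n) * (x - a) \<ge> 1"
            using ab by (smt (verit) mult_left_mono of_nat_0_le_iff)
          ultimately show ?thesis by (simp add: \<phi>_def s(5) del: of_nat_Suc)
        qed
      qed
    qed
    have id: "(\<integral>x. \<phi>' n x *\<^sub>R f x \<partial>intv L) = - (\<integral>x. \<phi> n x *\<^sub>R g x \<partial>intv L)" if "n \<ge> n0" for n
    proof -
      have "deriv (\<phi> n) = \<phi>' n" using der by (auto intro!: DERIV_imp_deriv)
      thus ?thesis using w test[OF that] unfolding has_weak_deriv_def integral_intv by metis
    qed
    have kf: "integrable (intv L) (\<lambda>x. (real (Suc n) * k (real (Suc n) * (x - c))) *\<^sub>R f x)" for n c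
      by (intro continuous_integrable_intv continuous_intros f continuous_on_compose2[OF s(3)]) auto
    have "(\<lambda>n. (\<integral>x. (real (Suc n) * k (real (Suc n) * (x - a))) *\<^sub>R f x \<partial>intv L)
        - (\<integral>x. (real (Suc n) * k (real (Suc n) * (x - b))) *\<^sub>R f x \<partial>intv L)) \<longlonglongrightarrow> f a - f b"
      using ab s f by (intro tendsto_diff approximate_identity[of s k]) auto
    hence lim1: "(\<lambda>n. \<integral>x. \<phi>' n x *\<^sub>R f x \<partial>intv L) \<longlonglongrightarrow> f a - f b"
      using kf by (simp add: \<phi>'_def scaleR_diff_left del: of_nat_Suc)
    have lim2: "(\<lambda>n. \<integral>x. \<phi> n x *\<^sub>R g x \<partial>intv L) \<longlonglongrightarrow> seg L g a b"
      unfolding seg_def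
    proof (rule integral_dominated_convergence)
      show "integrable (intv L) (\<lambda>x. norm (g x))" using g by simp
      have [measurable]: "\<phi> n \<in> borel_measurable (intv L)" for n
        using Ck[of 0 n] unfolding Ck_on_0
        by (intro measurable_intv_borel borel_measurable_continuous_onI)
      show "(\<lambda>x. \<phi> n x *\<^sub>R g x) \<in> borel_measurable (intv L)" for n by measurable
      show "(\<lambda>x. indicat_real {a<..b} x *\<^sub>R g x) \<in> borel_measurable (intv L)"
        using integrable_indicator_scaleR[OF g] by auto
      have "\<bar>\<phi> n x\<bar> \<le> 1" for n x
        using s(6)[of "real (Suc n) * (x - a)"] s(6)[of "real (Suc n) * (x - b)"] by (auto simp: \<phi>_def)
      thus "AE x in intv L. norm (\<phi> n x *\<^sub>R g x) \<le> norm (g x)" for n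
        by (intro AE_I2) (simp add: mult_left_le_one_le)
      \<comment> \<open>Since \<open>s\<close> vanishes at \<open>0\<close>, the limit at
        \<open>x = c\<close> is \<open>0\<close>. The difference of two steps thus tends everywhere
        to the indicator of the half-open segment.\<close>
      have step: "(\<lambda>n. s (real (Suc n) * (x - c))) \<longlonglongrightarrow> (if x > c then 1 else 0)" for x c
      proof (cases "x > c")
        case True
        then obtain m :: nat where m: "1 / real (Suc m) < x - c"
          using nat_approx_posE[of "x - c"] by auto
        have "s (real (Suc n) * (x - c)) = 1" if "n \<ge> m" for n
        proof -
          have "1 < real (Suc m) * (x - c)" using m by (simp add: field_simps)
          also have "\<dots> \<le> real (Suc n) * (x - c)" using that True by (intro mult_right_mono) auto
          finally show ?thesis by (simp add: s(5))
        qed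
        thus ?thesis using True by (intro tendsto_eventually) (auto simp: eventually_sequentially)
      next
        case False
        hence "s (real (Suc n) * (x - c)) = 0" for n
          by (intro s(4) mult_nonneg_nonpos) auto
        thus ?thesis using False by simp
      qed
      have "(\<lambda>n. \<phi> n x) \<longlonglongrightarrow> indicat_real {a<..b} x" for x
      proof -
        have "(\<lambda>n. \<phi> n x) \<longlonglongrightarrow> (if x > a then 1 else 0) - (if x > b then 1 else 0)"
          unfolding \<phi>_def by (intro tendsto_diff step)
        also have "(if x > a then 1 else 0) - (if x > b then 1 else 0) = indicat_real {a<..b} x"
          using ab by (auto simp: indicator_def)
        finally show ?thesis .
      qed
      thus "AE x in intv L. (\<lambda>n. \<phi> n x *\<^sub>R g x) \<longlonglongrightarrow> indicat_real {a<..b} x *\<^sub>R g x"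
        by (intro AE_I2 tendsto_intros)
    qed
    have "(\<lambda>n. \<integral>x. \<phi>' n x *\<^sub>R f x \<partial>intv L) \<longlonglongrightarrow> - seg L g a b"
      using tendsto_minus[OF lim2] by (rule Lim_transform_eventually)
        (use id in \<open>auto simp: eventually_sequentially intro!: exI[of _ n0]\<close>)
    with lim1 have "f a - f b = - seg L g a b" by (rule LIMSEQ_unique)
    thus ?thesis by (metis minus_diff_eq minus_equation_iff)
  qed
  \<comment> \<open>So far end points in the open interval only. The function \<open>d\<close> is
    constant there, and its continuity carries the constant to the closed interval.\<close>
  define d where "d x = f x - seg L g 0 x" for x
  have d: "continuous_on {0..L} d"
    unfolding d_def by (intro continuous_intros f seg_continuous g)
  have dI: "d x = d (L/2)" if "x \<in> {0<..<L}" for x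
  proof (cases "x \<le> L/2")
    case True
    with interior[of x "L/2"] seg_add[OF g, of 0 x "L/2"] that L show ?thesis
      by (simp add: d_def algebra_simps)
  next
    case False
    with interior[of "L/2" x] seg_add[OF g, of 0 "L/2" x] that L show ?thesis
      by (simp add: d_def algebra_simps)
  qed
  have dC: "d x = d (L/2)" if "x \<in> {0..L}" for x
  proof (rule continuous_constant_on_closure[of "{0<..<L}"])
    show "continuous_on (closure {0<..<L}) d" "x \<in> closure {0<..<L}"
      using d that L by simp_all
  qed (rule dI)
  have "d x = d 0" if "x \<in> {0..L}" for x
    using dC[OF that] dC[of 0] L by simp
  thus ?thesis unfolding primitive_of_def using g
    by (simp only: d_def seg_same diff_zero diff_eq_eq simp_thms) blast
qed

text \<open>Integration by parts as an exchange of integrals over the triangle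
  \<open>t \<le> x\<close>: the inner integral of \<open>\<phi>'\<close> from \<open>t\<close> to
  \<open>L\<close> is \<open>- \<phi> t\<close>.\<close>

lemma primitive_imp_weak_deriv:
  assumes p: "primitive_of L f g" and L: "L > 0"
  shows "has_weak_deriv L f g"
  unfolding has_weak_deriv_def integral_intv integrable_intv
proof (intro conjI allI impI)
  interpret M: finite_measure "intv L" by (rule finite_measure_intv)
  interpret P: pair_sigma_finite "intv L" "intv L" ..
  show g: "integrable (intv L) g" using p by (rule primitive_of_integrable)
  show "integrable (intv L) f"
    by (rule continuous_integrable_intv[OF primitive_of_continuous[OF p]])
  have [measurable]: "g \<in> borel_measurable (intv L)" using g by simp
  fix \<phi> assume "test_function L \<phi>"
  then obtain a b where "smooth_on UNIV \<phi>" and ab: "0 < a" "b < L" "\<And>x. x \<notin> {a..b} \<Longrightarrow> \<phi> x = 0"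
    unfolding test_function_def by blast
  hence "Ck_on UNIV (Suc 0) \<phi>" by (simp add: smooth_on_def)
  then obtain \<phi>' where \<phi>': "\<And>x. (\<phi> has_vector_derivative \<phi>' x) (at x)" "continuous_on UNIV \<phi>'"
    unfolding Ck_on_Suc Ck_on_0 by blast
  have deriv: "deriv \<phi> x = \<phi>' x" for x
    using \<phi>'(1) by (auto intro!: DERIV_imp_deriv simp: has_real_derivative_iff_has_vector_derivative)
  have cont: "continuous_on S \<phi>'" for S using \<phi>'(2) by (rule continuous_on_subset) simp
  have [measurable]: "\<phi>' \<in> borel_measurable (intv L)"
    by (rule continuous_measurable_intv[OF cont])
  obtain B where B: "B > 0" "\<And>x. x \<in> {0..L} \<Longrightarrow> norm (\<phi>' x) \<le> B"
    using continuous_bounded_Icc[OF cont] by blast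
  have seg\<phi>: "seg L \<phi>' t L = - \<phi> t" if "0 \<le> t" "t \<le> L" for t
  proof -
    have "seg L \<phi>' t L = (LINT x:{t..L}|lborel. \<phi>' x)"
      by (rule seg_eq_lborel) (use that in auto)
    also have "\<dots> = \<phi> L - \<phi> t"
      unfolding set_lebesgue_integral_def
      by (rule integral_FTC_Icc) (use that \<phi>' cont in \<open>auto intro: has_vector_derivative_at_within\<close>)
    also have "\<phi> L = 0" using ab by simp
    finally show ?thesis by simp
  qed
  have zero: "(\<integral>x. \<phi>' x \<partial>intv L) = 0"
    using seg\<phi>[of 0] seg_full[of L \<phi>'] L ab(1) ab(3)[of 0] by simp
  \<comment> \<open>The triangle is written as a factor of the integrand, which makes joint
    measurability and the bound \<open>B * norm (g t)\<close> direct.\<close>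
  define F where "F x t = (\<phi>' x * of_bool (0 < t \<and> t \<le> x)) *\<^sub>R g t" for x t
  have F_int: "integrable (intv L \<Otimes>\<^sub>M intv L) (case_prod F)"
  proof (rule P.Fubini_integrable)
    show "case_prod F \<in> borel_measurable (intv L \<Otimes>\<^sub>M intv L)"
      unfolding F_def by measurable
    have bd: "norm (F x t) \<le> B * norm (g t)" if "x \<in> {0<..<L}" for x t
      using B(2)[of x] that B(1) by (auto simp: F_def mult_right_mono)
    have i: "integrable (intv L) (F x)" if "x \<in> {0<..<L}" for x
    proof (rule Bochner_Integration.integrable_bound)
      show "integrable (intv L) (\<lambda>t. B * norm (g t))" using g by simp
      show "F x \<in> borel_measurable (intv L)" unfolding F_def by measurable
      show "AE t in intv L. norm (F x t) \<le> norm (B * norm (g t))"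
        using bd[OF that] B(1) by (intro AE_I2) auto
    qed
    thus "AE x in intv L. integrable (intv L) (\<lambda>y. case (x, y) of (x, xa) \<Rightarrow> F x xa)"
      by (intro AE_I2) simp
    show "integrable (intv L) (\<lambda>x. \<integral>y. norm (case (x, y) of (x, xa) \<Rightarrow> F x xa) \<partial>intv L)"
    proof (rule bounded_integrable_intv[where B = "\<integral>t. B * norm (g t) \<partial>intv L"])
      show "(\<lambda>x. \<integral>y. norm (case (x, y) of (x, xa) \<Rightarrow> F x xa) \<partial>intv L) \<in> borel_measurable (intv L)"
        unfolding F_def by measurable
      fix x assume x: "x \<in> {0<..<L}"
      have "(\<integral>y. norm (F x y) \<partial>intv L) \<le> (\<integral>t. B * norm (g t) \<partial>intv L)"
        using i[OF x] g bd[OF x] by (intro integral_mono) auto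
      thus "norm (\<integral>y. norm (case (x, y) of (x, xa) \<Rightarrow> F x xa) \<partial>intv L) \<le> (\<integral>t. B * norm (g t) \<partial>intv L)"
        by simp
    qed
  qed
  have segF: "\<phi>' x *\<^sub>R seg L g 0 x = (\<integral>t. F x t \<partial>intv L)" for x
    unfolding seg_def F_def
    by (subst integral_scaleR_right[symmetric])
       (auto intro!: Bochner_Integration.integral_cong simp: indicator_def)
  have "(\<integral>x. \<phi>' x *\<^sub>R f x \<partial>intv L) = (\<integral>x. \<phi>' x *\<^sub>R f 0 + \<phi>' x *\<^sub>R seg L g 0 x \<partial>intv L)"
  proof (intro Bochner_Integration.integral_cong refl)
    fix x assume "x \<in> space (intv L)"
    hence "f x = f 0 + seg L g 0 x" by (intro primitive_of_eq[OF p]) auto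
    thus "\<phi>' x *\<^sub>R f x = \<phi>' x *\<^sub>R f 0 + \<phi>' x *\<^sub>R seg L g 0 x"
      by (simp only: scaleR_add_right[symmetric])
  qed
  also have "\<dots> = (\<integral>x. \<phi>' x *\<^sub>R f 0 \<partial>intv L) + (\<integral>x. \<phi>' x *\<^sub>R seg L g 0 x \<partial>intv L)"
    by (intro Bochner_Integration.integral_add continuous_integrable_intv continuous_intros cont seg_continuous g)
  also have "(\<integral>x. \<phi>' x *\<^sub>R f 0 \<partial>intv L) = 0"
    using zero continuous_integrable_intv[OF cont] by simp
  also have "(\<integral>x. \<phi>' x *\<^sub>R seg L g 0 x \<partial>intv L) = (\<integral>x. \<integral>t. F x t \<partial>intv L \<partial>intv L)"
    by (simp add: segF)
  also have "\<dots> = (\<integral>t. \<integral>x. F x t \<partial>intv L \<partial>intv L)"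
    by (rule P.Fubini_integral[OF F_int, symmetric])
  also have "\<dots> = (\<integral>t. - (\<phi> t *\<^sub>R g t) \<partial>intv L)"
  proof (intro Bochner_Integration.integral_cong refl)
    fix t assume "t \<in> space (intv L)"
    hence t: "0 < t" "t < L" by auto
    have "(\<integral>x. F x t \<partial>intv L) = (\<integral>x. (indicator {t<..L} x *\<^sub>R \<phi>' x) *\<^sub>R g t \<partial>intv L)"
    proof (rule integral_cong_AE)
      show "AE x in intv L. F x t = (indicat_real {t<..L} x *\<^sub>R \<phi>' x) *\<^sub>R g t"
        using AE_intv_neq[where c = t] AE_space
        by eventually_elim (use t in \<open>auto simp: F_def indicator_def\<close>)
    qed (unfold F_def, measurable)
    also have "\<dots> = seg L \<phi>' t L *\<^sub>R g t"
      unfolding seg_def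
      by (intro integral_scaleR_left integrable_indicator_scaleR continuous_integrable_intv cont) auto
    also have "\<dots> = - (\<phi> t *\<^sub>R g t)" using seg\<phi> t by simp
    finally show "(\<integral>x. F x t \<partial>intv L) = - (\<phi> t *\<^sub>R g t)" .
  qed
  finally show "(\<integral>x. deriv \<phi> x *\<^sub>R f x \<partial>intv L) = - (\<integral>x. \<phi> x *\<^sub>R g x \<partial>intv L)"
    by (simp add: deriv)
qed

text \<open>The difference of the two derivatives has integral zero over every half-open interval,
  hence over every Borel set, and so vanishes almost everywhere.\<close>

lemma primitive_of_unique:
  fixes f :: "real \<Rightarrow> 'b::{banach,second_countable_topology}"
  assumes g: "primitive_of L f g" and h: "primitive_of L f h" and L: "L > 0"
  shows "AE x in intv L. g x = h x"
proof -
  note int = primitive_of_integrable[OF g] primitive_of_integrable[OF h]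
  define e where "e x = indicat_real {0<..<L} x *\<^sub>R (g x - h x)" for x
  have e: "integrable lborel e"
  proof -
    have "integrable (intv L) (\<lambda>x. g x - h x)" using int by simp
    thus ?thesis unfolding integrable_intv[symmetric] set_integrable_def e_def .
  qed
  have se: "set_integrable lborel A e" if "A \<in> sets borel" for A
    using integrable_mult_indicator[OF _ e, of A] that by (simp add: set_integrable_def)
  have base: "(LINT x:{a<..b}|lborel. e x) = 0" for a b
  proof (cases "a \<le> b")
    case True
    \<comment> \<open>Clamping end points to \<open>[0,L]\<close> does not change the integral, as
      \<open>e\<close> vanishes outside; it reduces an arbitrary interval to a segment.\<close>
    define c where "c x = max 0 (min L x)" for x
    have c: "0 \<le> c a" "c a \<le> c b" "c b \<le> L" using True L by (auto simp: c_def)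
    have "(LINT x:{a<..b}|lborel. e x) = seg L (\<lambda>x. g x - h x) (c a) (c b)"
      unfolding seg_def set_lebesgue_integral_def e_def intv_def
      by (subst integral_restrict_space)
         (auto intro!: Bochner_Integration.integral_cong simp: indicator_def c_def)
    also have "\<dots> = seg L (\<lambda>x. 1 *\<^sub>R g x + (-1) *\<^sub>R h x) (c a) (c b)" by simp
    also have "\<dots> = seg L g (c a) (c b) - seg L h (c a) (c b)"
      by (subst seg_linear[OF int]) simp
    also have "\<dots> = 0"
      using primitive_ofD[OF g c] primitive_ofD[OF h c] by simp
    finally show ?thesis .
  qed (simp add: set_lebesgue_integral_def)
  have total: "(LINT x:UNIV|lborel. e x) = 0"
  proof -
    have "(LINT x:UNIV|lborel. e x) = (LINT x:{0<..L}|lborel. e x)"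
      unfolding set_lebesgue_integral_def e_def
      by (intro Bochner_Integration.integral_cong) (auto simp: indicator_def)
    thus ?thesis using base by simp
  qed
  have zero: "(LINT x:A|lborel. e x) = 0" if "A \<in> sets borel" for A
  proof -
    \<comment> \<open>A pi-lambda induction over the intersection-stable generator of half-open
      intervals; complements are handled by \<open>total\<close>.\<close>
    let ?G = "range (\<lambda>(a, b). {a<..b::real})"
    have A: "A \<in> sigma_sets UNIV ?G"
      using that by (simp add: borel_sigma_sets_Ioc)
    have sub: "?G \<subseteq> Pow UNIV" by simp
    have stable: "Int_stable ?G"
    proof (rule Int_stableI_image)
      fix i j :: "real \<times> real"
      show "\<exists>k\<in>UNIV. (case i of (a, b) \<Rightarrow> {a<..b}) \<inter> (case j of (a, b) \<Rightarrow> {a<..b}) = (case k of (a, b) \<Rightarrow> {a<..b})"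
        by (intro bexI[of _ "(max (fst i) (fst j), min (snd i) (snd j))"]) (auto split: prod.splits)
    qed
    from stable sub A show ?thesis
    proof (induction rule: sigma_sets_induct_disjoint)
      case (basic A)
      then show ?case using base by auto
    next
      case empty
      then show ?case by (simp add: set_lebesgue_integral_def)
    next
      case (compl A)
      hence A: "A \<in> sets borel" by (simp add: borel_sigma_sets_Ioc)
      have "(LINT x:(UNIV - A) \<union> A|lborel. e x) = (LINT x:UNIV - A|lborel. e x) + (LINT x:A|lborel. e x)"
        by (rule set_integral_Un) (use A se[of A] se[of "UNIV - A"] in auto)
      moreover have "(UNIV - A) \<union> A = UNIV" by auto
      ultimately show ?case using total compl by simp
    next
      case (union A)
      hence A: "A i \<in> sets borel" for i by (auto simp: borel_sigma_sets_Ioc)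
      have "(LINT x:(\<Union>i. A i)|lborel. e x) = (\<Sum>i. LINT x:A i|lborel. e x)"
      proof (rule lebesgue_integral_countable_add)
        show "set_integrable lborel (\<Union>i. A i) e" using A by (intro se) auto
      qed (use A union(1) in \<open>auto simp: disjoint_family_on_def\<close>)
      thus ?case using union by simp
    qed
  qed
  have "AE x in lborel. e x = 0"
    using e zero by (intro sigma_finite_measure.density_zero[OF lborel.sigma_finite_measure_axioms]) auto
  hence "AE x in lborel. x \<in> {0<..<L} \<longrightarrow> g x = h x"
    by eventually_elim (auto simp: e_def)
  thus ?thesis unfolding AE_intv .
qed

section \<open>Sobolev functions and weak convergence\<close>

lemma primitive_of_cong:
  assumes "primitive_of L f g" "\<And>x. x \<in> {0..L} \<Longrightarrow> f x = f' x" "0 \<le> L"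
  shows "primitive_of L f' g"
  unfolding primitive_of_def
proof (intro conjI ballI)
  show "integrable (intv L) g" using assms(1) by (rule primitive_of_integrable)
  fix x assume x: "x \<in> {0..L}"
  hence "f x = f 0 + seg L g 0 x" by (intro primitive_of_eq[OF assms(1)]) auto
  thus "f' x = f' 0 + seg L g 0 x" using assms(2)[OF x] assms(2)[of 0] assms(3) by simp
qed

lemma primitive_of_linear:
  assumes "primitive_of L f g" "primitive_of L f' g'"
  shows "primitive_of L (\<lambda>x. r *\<^sub>R f x + s *\<^sub>R f' x) (\<lambda>x. r *\<^sub>R g x + s *\<^sub>R g' x)"
  unfolding primitive_of_def
proof (intro conjI ballI)
  note int = primitive_of_integrable[OF assms(1)] primitive_of_integrable[OF assms(2)]
  show "integrable (intv L) (\<lambda>x. r *\<^sub>R g x + s *\<^sub>R g' x)" using int by simp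
  fix x assume x: "x \<in> {0..L}"
  hence x': "0 \<le> x" "x \<le> L" by auto
  note eq = primitive_of_eq[OF assms(1) x'] primitive_of_eq[OF assms(2) x']
  have "r *\<^sub>R f x + s *\<^sub>R f' x = r *\<^sub>R (f 0 + seg L g 0 x) + s *\<^sub>R (f' 0 + seg L g' 0 x)"
    by (rule arg_cong2[where f = "\<lambda>a b. r *\<^sub>R a + s *\<^sub>R b", OF eq])
  also have "\<dots> = r *\<^sub>R f 0 + s *\<^sub>R f' 0 + seg L (\<lambda>x. r *\<^sub>R g x + s *\<^sub>R g' x) 0 x"
    unfolding seg_linear[OF int] by (simp add: scaleR_add_right)
  finally show "r *\<^sub>R f x + s *\<^sub>R f' x = r *\<^sub>R f 0 + s *\<^sub>R f' 0 + seg L (\<lambda>x. r *\<^sub>R g x + s *\<^sub>R g' x) 0 x" .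
qed

text \<open>The set where \<open>h\<close> differs from zero inside the interval is open and a null
  set, hence empty; continuity takes care of the end points.\<close>

lemma continuous_AE_zero:
  fixes h :: "real \<Rightarrow> 'b::real_normed_vector"
  assumes h: "continuous_on {0..L} h" and ae: "AE x in intv L. h x = 0" and L: "L > 0" and x: "x \<in> {0..L}"
  shows "h x = 0"
proof (rule continuous_constant_on_closure[of "{0<..<L}"])
  show "continuous_on (closure {0<..<L}) h" "x \<in> closure {0<..<L}" using h x L by simp_all
  fix t assume t: "t \<in> {0<..<L}"
  let ?S = "{t \<in> {0<..<L}. h t \<noteq> 0}"
  have "?S = {0<..<L} \<inter> h -` (- {0})" by auto
  hence "open ?S"
    using continuous_open_preimage[of "{0<..<L}" h "- {0}"] continuous_on_subset[OF h, of "{0<..<L}"]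
    by (auto simp: greaterThanLessThan_subseteq_atLeastAtMost_iff)
  have "AE x in lborel. x \<notin> ?S"
    using ae unfolding AE_intv[symmetric] by eventually_elim auto
  moreover have "?S \<in> sets borel" using \<open>open ?S\<close> by (rule borel_open)
  ultimately have "?S \<in> null_sets lborel" by (subst AE_iff_null_sets) auto
  hence "negligible ?S" using negligible_iff_null_sets null_sets_completionI by blast
  hence "?S = {}" using open_not_negligible \<open>open ?S\<close> by blast
  thus "h t = 0" using t by blast
qed

lemma continuous_AE_eq:
  fixes h :: "real \<Rightarrow> 'b::real_normed_vector"
  assumes "continuous_on {0..L} h" "continuous_on {0..L} k" "AE x in intv L. h x = k x" "L > 0" "x \<in> {0..L}"
  shows "h x = k x"
  using continuous_AE_zero[of L "\<lambda>x. h x - k x" x] assms by (auto intro!: continuous_intros)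

lemma has_weak_deriv_D: "has_weak_deriv L f g \<Longrightarrow> has_weak_deriv L f (D L f)"
  unfolding D_def
  using someI_ex[of "\<lambda>g. has_weak_deriv L f g \<and> continuous_on {0..L} g"] someI[of "has_weak_deriv L f"]
  by (cases "\<exists>g. has_weak_deriv L f g \<and> continuous_on {0..L} g") auto

lemma D_continuous:
  assumes "has_weak_deriv L f g" "continuous_on {0..L} g" shows "continuous_on {0..L} (D L f)"
proof -
  have ex: "\<exists>g. has_weak_deriv L f g \<and> continuous_on {0..L} g" using assms by blast
  have "has_weak_deriv L f (SOME g. has_weak_deriv L f g \<and> continuous_on {0..L} g) \<and>
      continuous_on {0..L} (SOME g. has_weak_deriv L f g \<and> continuous_on {0..L} g)"
    by (rule someI_ex[OF ex])
  thus ?thesis unfolding D_def using ex by simp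
qed

lemma primitive_of_D:
  assumes "primitive_of L f g" "L > 0" shows "primitive_of L f (D L f)"
  by (rule weak_deriv_imp_primitive[OF has_weak_deriv_D[OF primitive_imp_weak_deriv[OF assms]]
        primitive_of_continuous[OF assms(1)] assms(2)])

lemma D_eq_AE:
  assumes "primitive_of L f g" "L > 0" shows "AE x in intv L. D L f x = g x"
  by (rule primitive_of_unique[OF primitive_of_D[OF assms] assms])

text \<open>The choice in \<open>D\<close> prefers a continuous representative, and two continuous
  functions that agree almost everywhere agree on all of \<open>[0,L]\<close>. This is what gives
  \<open>y'\<close> its values at the nodes.\<close>

lemma D_eq:
  assumes "primitive_of L f g" "continuous_on {0..L} g" "L > 0" "x \<in> {0..L}" shows "D L f x = g x"
  by (rule continuous_AE_eq[OF D_continuous[OF primitive_imp_weak_deriv] _ D_eq_AE]) (use assms in auto)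

lemma D_measurable: "primitive_of L f g \<Longrightarrow> L > 0 \<Longrightarrow> D L f \<in> borel_measurable (intv L)"
  using primitive_of_integrable[OF primitive_of_D] borel_measurable_integrable by blast

text \<open>Membership in \<open>V_space\<close> speaks of some weak derivatives \<open>p\<close>,
  \<open>q\<close>, \<open>r\<close>. Since \<open>p\<close> coincides with \<open>D L y\<close> on
  \<open>[0,L]\<close>, the derivative \<open>q\<close> of \<open>p\<close> also serves
  \<open>D L y\<close>, and the witnesses can be exchanged for \<open>D\<close> throughout.\<close>

lemma V_spaceD:
  assumes V: "(y, b) \<in> V_space L" and L: "L > 0"
  shows "primitive_of L y (D L y)" "primitive_of L (D L y) (D L (D L y))" "sq_int (intv L) (D L (D L y))"
    "primitive_of L b (D L b)" "sq_int (intv L) (D L b)"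
proof -
  obtain p q r where p: "continuous_on {0..L} y" "has_weak_deriv L y p" "continuous_on {0..L} p"
      "has_weak_deriv L p q" "sq_int (intv L) q"
    and r: "continuous_on {0..L} b" "has_weak_deriv L b r" "sq_int (intv L) r"
    using V unfolding V_space_def by (auto simp: numeral_2_eq_2 L2_fun_iff)
  note yp = weak_deriv_imp_primitive[OF p(2,1) L]
  note pq = weak_deriv_imp_primitive[OF p(4,3) L]
  note br = weak_deriv_imp_primitive[OF r(2,1) L]
  show "primitive_of L y (D L y)" using primitive_of_D[OF yp L] .
  have eq: "p x = D L y x" if "x \<in> {0..L}" for x using D_eq[OF yp p(3) L that] by simp
  have Dq: "primitive_of L (D L y) q" using primitive_of_cong[OF pq eq] L by simp
  show "primitive_of L (D L y) (D L (D L y))" using primitive_of_D[OF Dq L] .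
  show "sq_int (intv L) (D L (D L y))"
    by (rule sq_int_cong_AE[OF p(5)]) (use D_eq_AE[OF Dq L] D_measurable[OF Dq L] in auto)
  show "primitive_of L b (D L b)" using primitive_of_D[OF br L] .
  show "sq_int (intv L) (D L b)"
    by (rule sq_int_cong_AE[OF r(3)]) (use D_eq_AE[OF br L] D_measurable[OF br L] in auto)
qed

lemma D_sobolev2:
  assumes "primitive_of L y p" "primitive_of L p q" "L > 0"
  shows "\<And>x. x \<in> {0..L} \<Longrightarrow> D L y x = p x" "AE x in intv L. D L (D L y) x = q x"
    "D L (D L y) \<in> borel_measurable (intv L)"
proof -
  show eq: "D L y x = p x" if "x \<in> {0..L}" for x
    by (rule D_eq[OF assms(1) primitive_of_continuous[OF assms(2)] assms(3) that])
  have "primitive_of L (D L y) q" using primitive_of_cong[OF assms(2)] eq assms(3) by fastforce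
  thus "AE x in intv L. D L (D L y) x = q x" "D L (D L y) \<in> borel_measurable (intv L)"
    using D_eq_AE D_measurable assms(3) by blast+
qed

lemma V_spaceI:
  assumes "primitive_of L y p" "primitive_of L p q" "sq_int (intv L) q"
    "primitive_of L b r" "sq_int (intv L) r" "L > 0"
  shows "(y, b) \<in> V_space L"
proof -
  have "sobolev L 1 p" "sobolev L 1 b"
    using assms by (auto simp: L2_fun_iff intro: primitive_of_continuous primitive_imp_weak_deriv)
  thus ?thesis
    using assms by (auto simp: V_space_def numeral_2_eq_2 intro: primitive_of_continuous primitive_imp_weak_deriv)
qed

lemma V_lin_comb:
  assumes u: "(y, b) \<in> V_space L" and v: "(z, c) \<in> V_space L" and L: "L > 0"
  shows "lin_comb r (y, b) s (z, c) \<in> V_space L"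
    "\<And>x. x \<in> {0..L} \<Longrightarrow> D L (\<lambda>x. r *\<^sub>R y x + s *\<^sub>R z x) x = r *\<^sub>R D L y x + s *\<^sub>R D L z x"
    "AE x in intv L. D L (D L (\<lambda>x. r *\<^sub>R y x + s *\<^sub>R z x)) x = r *\<^sub>R D L (D L y) x + s *\<^sub>R D L (D L z) x"
    "AE x in intv L. D L (\<lambda>x. r *\<^sub>R b x + s *\<^sub>R c x) x = r *\<^sub>R D L b x + s *\<^sub>R D L c x"
proof -
  note U = V_spaceD[OF u L] and W = V_spaceD[OF v L]
  note y = primitive_of_linear[OF U(1) W(1), of r s]
  note y' = primitive_of_linear[OF U(2) W(2), of r s]
  note b = primitive_of_linear[OF U(4) W(4), of r s]
  show "lin_comb r (y, b) s (z, c) \<in> V_space L"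
    unfolding lin_comb.simps
    by (rule V_spaceI[OF y y' _ b _ L]) (intro sq_int_add sq_int_scaleR U W)+
  show "D L (\<lambda>x. r *\<^sub>R y x + s *\<^sub>R z x) x = r *\<^sub>R D L y x + s *\<^sub>R D L z x" if "x \<in> {0..L}" for x
    by (rule D_sobolev2(1)[OF y y' L that])
  show "AE x in intv L. D L (D L (\<lambda>x. r *\<^sub>R y x + s *\<^sub>R z x)) x = r *\<^sub>R D L (D L y) x + s *\<^sub>R D L (D L z) x"
    by (rule D_sobolev2(2)[OF y y' L])
  show "AE x in intv L. D L (\<lambda>x. r *\<^sub>R b x + s *\<^sub>R c x) x = r *\<^sub>R D L b x + s *\<^sub>R D L c x"
    by (rule D_eq_AE[OF b L])
qed

lemma sobolev_norm_1: "sobolev_norm L 1 f = sqrt ((l2n (intv L) f)\<^sup>2 + (l2n (intv L) (D L f))\<^sup>2)"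
  by (simp add: sobolev_norm_def L2_norm_eq)

lemma sobolev_norm_2:
  "sobolev_norm L 2 f = sqrt ((l2n (intv L) f)\<^sup>2 + (l2n (intv L) (D L f))\<^sup>2 + (l2n (intv L) (D L (D L f)))\<^sup>2)"
  by (simp add: sobolev_norm_def L2_norm_eq numeral_2_eq_2)

lemma V_norm_eq:
  "V_norm L (y, b) = sqrt ((l2n (intv L) y)\<^sup>2 + (l2n (intv L) (D L y))\<^sup>2 + (l2n (intv L) (D L (D L y)))\<^sup>2
    + ((l2n (intv L) b)\<^sup>2 + (l2n (intv L) (D L b))\<^sup>2))"
  by (simp add: sobolev_norm_1[unfolded One_nat_def] sobolev_norm_2)

lemma l2n_le_V_norm:
  "l2n (intv L) y \<le> V_norm L (y, b)" "l2n (intv L) (D L y) \<le> V_norm L (y, b)"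
  "l2n (intv L) (D L (D L y)) \<le> V_norm L (y, b)" "l2n (intv L) b \<le> V_norm L (y, b)"
  "l2n (intv L) (D L b) \<le> V_norm L (y, b)"
  unfolding V_norm_eq by (auto intro!: real_le_rsqrt simp: add_increasing add_increasing2)

lemma measure_intv: "0 \<le> L \<Longrightarrow> measure (intv L) {0<..<L} = L"
  by (simp add: measure_def emeasure_intv)

lemma l2n_const: "0 \<le> L \<Longrightarrow> l2n (intv L) (\<lambda>_. c) = sqrt L * norm c"
  by (simp add: l2n_def measure_intv real_sqrt_mult)

section \<open>Hoelder and supremum bounds\<close>

lemma seg_norm_le_l2n:
  fixes g :: "real \<Rightarrow> 'b::euclidean_space"
  assumes g: "sq_int (intv L) g" and ab: "0 \<le> a" "a \<le> b" "b \<le> L"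
  shows "norm (seg L g a b) \<le> sqrt (b - a) * l2n (intv L) g"
proof -
  have "(norm (seg L g a b))\<^sup>2 \<le> (b - a) * seg L (\<lambda>t. (norm (g t))\<^sup>2) a b"
    by (rule seg_Cauchy_Schwarz[OF assms])
  also have "\<dots> \<le> (b - a) * seg L (\<lambda>t. (norm (g t))\<^sup>2) 0 L"
    using ab by (intro mult_left_mono seg_subset_mono sq_intD g) auto
  also have "seg L (\<lambda>t. (norm (g t))\<^sup>2) 0 L = (l2n (intv L) g)\<^sup>2"
    using ab by (simp add: seg_full l2n_power2)
  finally have "norm (seg L g a b) \<le> sqrt ((b - a) * (l2n (intv L) g)\<^sup>2)" by (rule real_le_rsqrt)
  thus ?thesis by (simp add: real_sqrt_mult)
qed

lemma primitive_Hoelder: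
  fixes f :: "real \<Rightarrow> 'b::euclidean_space"
  assumes "primitive_of L f g" "sq_int (intv L) g" "a \<in> {0..L}" "b \<in> {0..L}"
  shows "norm (f b - f a) \<le> sqrt \<bar>b - a\<bar> * l2n (intv L) g"
proof (cases "a \<le> b")
  case True
  thus ?thesis using primitive_ofD[OF assms(1), of a b] seg_norm_le_l2n[OF assms(2), of a b] assms by simp
next
  case False
  thus ?thesis using primitive_ofD[OF assms(1), of b a] seg_norm_le_l2n[OF assms(2), of b a] assms
    by (simp add: norm_minus_commute)
qed

text \<open>The embedding constant that results from averaging
  \<open>norm (f x) \<le> norm (f t) + sqrt L * l2n (intv L) g\<close> over \<open>t\<close> and
  bounding the mean of \<open>norm (f t)\<close> by Cauchy-Schwarz.\<close>

definition sup_const :: "real \<Rightarrow> real" where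
  "sup_const L = (sqrt L + L * sqrt L) / L"

lemma primitive_sup_bound:
  fixes f :: "real \<Rightarrow> 'b::euclidean_space"
  assumes f: "primitive_of L f g" and g: "sq_int (intv L) g" and x: "x \<in> {0..L}" and L: "L > 0"
  shows "norm (f x) \<le> sup_const L * (l2n (intv L) f + l2n (intv L) g)"
proof -
  interpret finite_measure "intv L" by (rule finite_measure_intv)
  have fs: "sq_int (intv L) f" by (rule continuous_sq_int_intv[OF primitive_of_continuous[OF f]])
  have fi: "integrable (intv L) (\<lambda>t. norm (f t))" using sq_int_integrable[OF fs] by simp
  have "L * norm (f x) = (\<integral>t. norm (f x) \<partial>intv L)" using L by (simp add: measure_intv)
  also have "\<dots> \<le> (\<integral>t. norm (f t) + sqrt L * l2n (intv L) g \<partial>intv L)"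
  proof (intro integral_mono)
    fix t assume "t \<in> space (intv L)"
    hence t: "t \<in> {0..L}" by auto
    have "norm (f x - f t) \<le> sqrt \<bar>x - t\<bar> * l2n (intv L) g"
      by (rule primitive_Hoelder[OF f g t x])
    also have "\<dots> \<le> sqrt L * l2n (intv L) g"
      using x t by (intro mult_right_mono) auto
    finally show "norm (f x) \<le> norm (f t) + sqrt L * l2n (intv L) g"
      using norm_triangle_sub[of "f x" "f t"] by linarith
  qed (use fi in auto)
  also have "\<dots> = (\<integral>t. norm (f t) \<partial>intv L) + L * sqrt L * l2n (intv L) g"
    using fi L by (simp add: measure_intv)
  also have "(\<integral>t. norm (f t) \<partial>intv L) \<le> sqrt L * l2n (intv L) f"
    using Cauchy_Schwarz_l2n[OF fs sq_int_const[of "1::real"]] L by (simp add: l2n_const mult.commute)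
  also have "sqrt L * l2n (intv L) f + L * sqrt L * l2n (intv L) g
      \<le> (sqrt L + L * sqrt L) * (l2n (intv L) f + l2n (intv L) g)"
    using L by (simp add: algebra_simps)
  finally show ?thesis using L by (simp add: sup_const_def field_simps)
qed

lemma sup_const_nonneg: "L > 0 \<Longrightarrow> 0 \<le> sup_const L"
  by (simp add: sup_const_def)

text \<open>These bounds turn point evaluations into bounded functionals on \<open>V\<close>. The
  factor \<open>2\<close> stems from two \<open>L\<^sup>2\<close> norms, each of which is at most
  \<open>V_norm\<close>.\<close>

lemma V_sup_bounds:
  assumes u: "(y, b) \<in> V_space L" and L: "L > 0" and x: "x \<in> {0..L}"
  shows "norm (y x) \<le> 2 * sup_const L * V_norm L (y, b)" "norm (D L y x) \<le> 2 * sup_const L * V_norm L (y, b)"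
    "norm (b x) \<le> 2 * sup_const L * V_norm L (y, b)"
proof -
  note U = V_spaceD[OF u L]
  have mono: "sup_const L * (p + q) \<le> 2 * sup_const L * V" if "p \<le> V" "q \<le> V" for p q V
    using mult_left_mono[of "p + q" "2 * V" "sup_const L"] sup_const_nonneg[OF L] that by simp
  have yc: "sq_int (intv L) (D L y)" by (rule continuous_sq_int_intv[OF primitive_of_continuous[OF U(2)]])
  note nV = l2n_le_V_norm[where L=L and y=y and b=b]
  show "norm (y x) \<le> 2 * sup_const L * V_norm L (y, b)"
    using primitive_sup_bound[OF U(1) yc x L] mono[OF nV(1,2)] by linarith
  show "norm (D L y x) \<le> 2 * sup_const L * V_norm L (y, b)"
    using primitive_sup_bound[OF U(2,3) x L] mono[OF nV(2,3)] by linarith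
  show "norm (b x) \<le> 2 * sup_const L * V_norm L (y, b)"
    using primitive_sup_bound[OF U(4,5) x L] mono[OF nV(4,5)] by linarith
qed

section \<open>Weak convergence of point values and of derivatives\<close>

lemma weakly_convD:
  assumes w: "weakly_conv L U u" and L: "L > 0"
    and lin: "\<And>y b z c r s. (y, b) \<in> V_space L \<Longrightarrow> (z, c) \<in> V_space L \<Longrightarrow>
      \<Phi> (lin_comb r (y, b) s (z, c)) = r * \<Phi> (y, b) + s * \<Phi> (z, c)"
    and bd: "\<And>y b. (y, b) \<in> V_space L \<Longrightarrow> \<bar>\<Phi> (y, b)\<bar> \<le> C * V_norm L (y, b)"
  shows "(\<lambda>n. \<Phi> (U n)) \<longlonglongrightarrow> \<Phi> u"
proof -
  have "bounded_linear_on_V L \<Phi>"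
    unfolding bounded_linear_on_V_def
  proof (intro conjI ballI allI exI[of _ C])
    fix u v r s assume "u \<in> V_space L" "v \<in> V_space L"
    thus "\<Phi> (lin_comb r u s v) = r *\<^sub>R \<Phi> u + s *\<^sub>R \<Phi> v"
      using lin[of "fst u" "snd u" "fst v" "snd v" r s] by simp
  next
    fix u assume "u \<in> V_space L"
    thus "norm (\<Phi> u) \<le> C * V_norm L u" using bd[of "fst u" "snd u"] by simp
  qed
  thus ?thesis using w unfolding weakly_conv_def by blast
qed

lemma tendsto_vec3:
  fixes f :: "nat \<Rightarrow> real^3"
  assumes "\<And>e. (\<lambda>n. e \<bullet> f n) \<longlonglongrightarrow> e \<bullet> l" shows "f \<longlonglongrightarrow> l"
  unfolding tendsto_componentwise_iff[of f] using assms by (simp add: inner_commute)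

text \<open>Evaluation at \<open>x\<close> in a direction \<open>e\<close> is linear and bounded by
  \<open>V_sup_bounds\<close>, so weak convergence in \<open>V\<close> yields convergence of
  \<open>y\<close>, \<open>y'\<close> and \<open>b\<close> at each point.\<close>

lemma weakly_conv_pointwise:
  assumes w: "weakly_conv L U u" and L: "L > 0" and x: "x \<in> {0..L}"
  shows "(\<lambda>n. fst (U n) x) \<longlonglongrightarrow> fst u x" "(\<lambda>n. D L (fst (U n)) x) \<longlonglongrightarrow> D L (fst u) x"
    "(\<lambda>n. snd (U n) x) \<longlonglongrightarrow> snd u x"
proof -
  have *: "\<bar>e \<bullet> v\<bar> \<le> norm e * c * K" if "norm v \<le> c * K" for e v :: "real^3" and c K
    using Cauchy_Schwarz_ineq2[of e v] mult_left_mono[OF that, of "norm e"] by (simp add: mult.assoc)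
  show "(\<lambda>n. fst (U n) x) \<longlonglongrightarrow> fst u x"
  proof (rule tendsto_vec3)
    fix e :: "real^3"
    show "(\<lambda>n. e \<bullet> fst (U n) x) \<longlonglongrightarrow> e \<bullet> fst u x"
      by (rule weakly_convD[OF w L, where \<Phi> = "\<lambda>u. e \<bullet> fst u x" and C = "norm e * (2 * sup_const L)"])
         (use *[OF V_sup_bounds(1)[OF _ L x]] in \<open>simp_all add: inner_add_right\<close>)
  qed
  show "(\<lambda>n. D L (fst (U n)) x) \<longlonglongrightarrow> D L (fst u) x"
  proof (rule tendsto_vec3)
    fix e :: "real^3"
    show "(\<lambda>n. e \<bullet> D L (fst (U n)) x) \<longlonglongrightarrow> e \<bullet> D L (fst u) x"
      by (rule weakly_convD[OF w L, where \<Phi> = "\<lambda>u. e \<bullet> D L (fst u) x" and C = "norm e * (2 * sup_const L)"])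
         (use *[OF V_sup_bounds(2)[OF _ L x]] V_lin_comb(2)[OF _ _ L x] in \<open>simp_all add: inner_add_right\<close>)
  qed
  show "(\<lambda>n. snd (U n) x) \<longlonglongrightarrow> snd u x"
  proof (rule tendsto_vec3)
    fix e :: "real^3"
    show "(\<lambda>n. e \<bullet> snd (U n) x) \<longlonglongrightarrow> e \<bullet> snd u x"
      by (rule weakly_convD[OF w L, where \<Phi> = "\<lambda>u. e \<bullet> snd u x" and C = "norm e * (2 * sup_const L)"])
         (use *[OF V_sup_bounds(3)[OF _ L x]] in \<open>simp_all add: inner_add_right\<close>)
  qed
qed

text \<open>The highest derivatives of a linear combination are known only almost everywhere; under
  the integral this is enough for linearity.\<close>

lemma integral_inner_linear_AE:
  fixes \<xi> :: "'a \<Rightarrow> 'b::euclidean_space"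
  assumes "sq_int M \<xi>" "sq_int M f" "sq_int M g" "AE x in M. k x = r *\<^sub>R f x + s *\<^sub>R g x"
    "k \<in> borel_measurable M"
  shows "(\<integral>x. \<xi> x \<bullet> k x \<partial>M) = r * (\<integral>x. \<xi> x \<bullet> f x \<partial>M) + s * (\<integral>x. \<xi> x \<bullet> g x \<partial>M)"
proof -
  have "(\<integral>x. \<xi> x \<bullet> k x \<partial>M) = (\<integral>x. r * (\<xi> x \<bullet> f x) + s * (\<xi> x \<bullet> g x) \<partial>M)"
    by (rule integral_cong_AE)
       (use assms in \<open>auto simp: sq_int_def inner_add_right elim!: eventually_mono\<close>)
  also have "\<dots> = r * (\<integral>x. \<xi> x \<bullet> f x \<partial>M) + s * (\<integral>x. \<xi> x \<bullet> g x \<partial>M)"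
    using sq_int_inner_integrable[OF assms(1,2)] sq_int_inner_integrable[OF assms(1,3)] by simp
  finally show ?thesis .
qed

lemma weakly_conv_L2:
  assumes w: "weakly_conv L U u" and L: "L > 0" and \<xi>: "sq_int (intv L) \<xi>"
  shows "(\<lambda>n. \<integral>x. \<xi> x \<bullet> D L (D L (fst (U n))) x \<partial>intv L) \<longlonglongrightarrow> (\<integral>x. \<xi> x \<bullet> D L (D L (fst u)) x \<partial>intv L)"
    "(\<lambda>n. \<integral>x. \<xi> x \<bullet> D L (snd (U n)) x \<partial>intv L) \<longlonglongrightarrow> (\<integral>x. \<xi> x \<bullet> D L (snd u) x \<partial>intv L)"
proof -
  have *: "\<bar>\<integral>x. \<xi> x \<bullet> g x \<partial>intv L\<bar> \<le> l2n (intv L) \<xi> * V" if "sq_int (intv L) g" "l2n (intv L) g \<le> V" for g V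
    using integral_inner_le[OF \<xi> that(1)] mult_left_mono[OF that(2), of "l2n (intv L) \<xi>"] by simp
  have m: "D L (D L (fst v)) \<in> borel_measurable (intv L)" "D L (snd v) \<in> borel_measurable (intv L)"
    if "v \<in> V_space L" for v
    using V_spaceD(3,5)[of "fst v" "snd v" L] that L by (auto simp: sq_int_def)
  show "(\<lambda>n. \<integral>x. \<xi> x \<bullet> D L (D L (fst (U n))) x \<partial>intv L) \<longlonglongrightarrow> (\<integral>x. \<xi> x \<bullet> D L (D L (fst u)) x \<partial>intv L)"
  proof (rule weakly_convD[OF w L, where C = "l2n (intv L) \<xi>"])
    fix y b z c r s assume v: "(y, b) \<in> V_space L" "(z, c) \<in> V_space L"
    show "(\<integral>x. \<xi> x \<bullet> D L (D L (fst (lin_comb r (y, b) s (z, c)))) x \<partial>intv L) =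
       r * (\<integral>x. \<xi> x \<bullet> D L (D L (fst (y, b))) x \<partial>intv L) + s * (\<integral>x. \<xi> x \<bullet> D L (D L (fst (z, c))) x \<partial>intv L)"
      using V_spaceD(3)[OF v(1) L] V_spaceD(3)[OF v(2) L] V_lin_comb(3)[OF v L, of r s] m(1)[OF V_lin_comb(1)[OF v L, of r s]]
      by (intro integral_inner_linear_AE[OF \<xi>]) auto
  next
    fix y b assume v: "(y, b) \<in> V_space L"
    show "\<bar>\<integral>x. \<xi> x \<bullet> D L (D L (fst (y, b))) x \<partial>intv L\<bar> \<le> l2n (intv L) \<xi> * V_norm L (y, b)"
      using *[OF V_spaceD(3)[OF v L] l2n_le_V_norm(3)] by simp
  qed
  show "(\<lambda>n. \<integral>x. \<xi> x \<bullet> D L (snd (U n)) x \<partial>intv L) \<longlonglongrightarrow> (\<integral>x. \<xi> x \<bullet> D L (snd u) x \<partial>intv L)"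
  proof (rule weakly_convD[OF w L, where C = "l2n (intv L) \<xi>"])
    fix y b z c r s assume v: "(y, b) \<in> V_space L" "(z, c) \<in> V_space L"
    show "(\<integral>x. \<xi> x \<bullet> D L (snd (lin_comb r (y, b) s (z, c))) x \<partial>intv L) =
       r * (\<integral>x. \<xi> x \<bullet> D L (snd (y, b)) x \<partial>intv L) + s * (\<integral>x. \<xi> x \<bullet> D L (snd (z, c)) x \<partial>intv L)"
      using V_spaceD(5)[OF v(1) L] V_spaceD(5)[OF v(2) L] V_lin_comb(4)[OF v L, of r s] m(2)[OF V_lin_comb(1)[OF v L, of r s]]
      by (intro integral_inner_linear_AE[OF \<xi>]) auto
  next
    fix y b assume v: "(y, b) \<in> V_space L"
    show "\<bar>\<integral>x. \<xi> x \<bullet> D L (snd (y, b)) x \<partial>intv L\<bar> \<le> l2n (intv L) \<xi> * V_norm L (y, b)"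
      using *[OF V_spaceD(5)[OF v L] l2n_le_V_norm(5)] by simp
  qed
qed

section \<open>Elementwise averages\<close>

lemma l2n_tendsto_0:
  fixes f :: "nat \<Rightarrow> 'a \<Rightarrow> 'b::euclidean_space"
  assumes "\<And>n. f n \<in> borel_measurable M" "AE x in M. (\<lambda>n. f n x) \<longlonglongrightarrow> 0" "integrable M g"
    "\<And>n. AE x in M. (norm (f n x))\<^sup>2 \<le> g x"
  shows "(\<lambda>n. l2n M (f n)) \<longlonglongrightarrow> 0"
proof -
  have "(\<lambda>n. \<integral>x. (norm (f n x))\<^sup>2 \<partial>M) \<longlonglongrightarrow> (\<integral>x. (0::real) \<partial>M)"
  proof (rule integral_dominated_convergence[OF _ _ assms(3)])
    show "AE x in M. (\<lambda>n. (norm (f n x))\<^sup>2) \<longlonglongrightarrow> 0"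
      using assms(2)
    proof eventually_elim
      fix x assume "(\<lambda>n. f n x) \<longlonglongrightarrow> 0"
      from tendsto_power[OF tendsto_norm_zero[OF this], of 2] show "(\<lambda>n. (norm (f n x))\<^sup>2) \<longlonglongrightarrow> 0" by simp
    qed
  qed (use assms(1,4) in auto)
  hence "(\<lambda>n. sqrt (\<integral>x. (norm (f n x))\<^sup>2 \<partial>M)) \<longlonglongrightarrow> sqrt 0"
    by (intro tendsto_real_sqrt) simp
  thus ?thesis by (simp add: l2n_def)
qed

text \<open>Truncation reduces to bounded \<open>g\<close>. Continuous functions converging to
  \<open>g\<close> almost everywhere, truncated in the same way, then converge in
  \<open>L\<^sup>2\<close> by dominated convergence.\<close>

lemma continuous_dense_L2:
  fixes g :: "real \<Rightarrow> 'b::euclidean_space"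
  assumes g: "sq_int (intv L) g" and e: "e > 0"
  obtains \<phi> where "continuous_on UNIV \<phi>" "sq_int (intv L) \<phi>" "l2n (intv L) (\<lambda>x. g x - \<phi> x) < e"
proof -
  interpret finite_measure "intv L" by (rule finite_measure_intv)
  \<comment> \<open>Truncation by projection onto a ball: it is continuous, does not increase norms,
    and is the identity on the ball.\<close>
  define c where "c n = closest_point (cball (0::'b) (real n))" for n
  have c_cont: "continuous_on S (c n)" for n S unfolding c_def by (rule continuous_on_closest_point) auto
  have c_bound: "norm (c n v) \<le> real n" for n v
    using closest_point_in_set[of "cball (0::'b) (real n)" v] by (auto simp: c_def)
  have c_self: "c n v = v" if "norm v \<le> real n" for n v
    using that by (simp add: c_def closest_point_self)
  have c_le: "norm (c n v) \<le> norm v" for n v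
    using closest_point_lipschitz[of "cball (0::'b) (real n)" v 0] c_self[of 0 n] by (auto simp: c_def)
  have cm: "(\<lambda>x. c n (f x)) \<in> borel_measurable (intv L)" if "f \<in> borel_measurable (intv L)" for n f
    using measurable_compose[OF that borel_measurable_continuous_onI[OF c_cont]] .
  have gm: "g \<in> borel_measurable (intv L)" using g by (simp add: sq_int_def)
  have "(\<lambda>n. l2n (intv L) (\<lambda>x. g x - c n (g x))) \<longlonglongrightarrow> 0"
  proof (rule l2n_tendsto_0)
    show "(\<lambda>x. g x - c n (g x)) \<in> borel_measurable (intv L)" for n
      using gm cm[OF gm] by (rule borel_measurable_diff)
    show "AE x in intv L. (\<lambda>n. g x - c n (g x)) \<longlonglongrightarrow> 0"
    proof (intro AE_I2)
      fix x
      obtain m :: nat where m: "norm (g x) \<le> real m" using real_arch_simple by blast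
      have "g x - c n (g x) = 0" if "n \<ge> m" for n using c_self[of "g x" n] m that by simp
      thus "(\<lambda>n. g x - c n (g x)) \<longlonglongrightarrow> 0"
        by (intro tendsto_eventually) (auto simp: eventually_sequentially)
    qed
    show "integrable (intv L) (\<lambda>x. 4 * (norm (g x))\<^sup>2)" using g by (simp add: sq_int_def)
    show "AE x in intv L. (norm (g x - c n (g x)))\<^sup>2 \<le> 4 * (norm (g x))\<^sup>2" for n
    proof (intro AE_I2)
      fix x
      have "norm (g x - c n (g x)) \<le> 2 * norm (g x)"
        using norm_triangle_ineq4[of "g x" "c n (g x)"] c_le[of n "g x"] by simp
      hence "(norm (g x - c n (g x)))\<^sup>2 \<le> (2 * norm (g x))\<^sup>2" by (rule power_mono) simp
      thus "(norm (g x - c n (g x)))\<^sup>2 \<le> 4 * (norm (g x))\<^sup>2" by (simp add: power_mult_distrib)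
    qed
  qed
  from order_tendstoD(2)[OF this, of "e/2"] e obtain K where K: "l2n (intv L) (\<lambda>x. g x - c K (g x)) < e / 2"
    by (auto simp: eventually_sequentially)
  define g0 where "g0 x = indicat_real {0<..<L} x *\<^sub>R g x" for x
  have "g0 \<in> borel_measurable lebesgue"
    using gm unfolding measurable_intv set_borel_measurable_def g0_def by (rule measurable_completion)
  \<comment> \<open>This form of measurability supplies continuous functions that converge off a
    negligible set.\<close>
  hence "g0 measurable_on UNIV" by (intro lebesgue_measurable_imp_measurable_on) auto
  then obtain S G where S: "negligible S" and G: "\<And>n. continuous_on UNIV (G n)"
    "\<And>x. x \<notin> S \<Longrightarrow> (\<lambda>n. G n x) \<longlonglongrightarrow> g0 x"
    unfolding measurable_on_def by auto
  have cG: "continuous_on UNIV (\<lambda>x. c K (G n x))" for n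
    by (rule continuous_on_compose2[OF c_cont[of UNIV] G(1)]) simp
  have "AE x in lborel. x \<notin> S"
  proof -
    have "S \<in> null_sets lebesgue" using S by (simp add: negligible_iff_null_sets)
    hence "AE x in lebesgue. x \<notin> S" by (rule AE_not_in)
    thus ?thesis by (simp add: AE_completion_iff)
  qed
  hence ae: "AE x in intv L. x \<notin> S" unfolding AE_intv[symmetric] by eventually_elim auto
  have cGm: "(\<lambda>x. c K (G n x)) \<in> borel_measurable (intv L)" for n
    by (rule measurable_intv_borel[OF borel_measurable_continuous_onI[OF cG]])
  have "(\<lambda>n. l2n (intv L) (\<lambda>x. c K (g x) - c K (G n x))) \<longlonglongrightarrow> 0"
  proof (rule l2n_tendsto_0)
    show "(\<lambda>x. c K (g x) - c K (G n x)) \<in> borel_measurable (intv L)" for n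
      using cm[OF gm] cGm by (rule borel_measurable_diff)
    show "AE x in intv L. (\<lambda>n. c K (g x) - c K (G n x)) \<longlonglongrightarrow> 0"
      using ae AE_space
    proof eventually_elim
      fix x assume x: "x \<notin> S" "x \<in> space (intv L)"
      hence "(\<lambda>n. G n x) \<longlonglongrightarrow> g x" using G(2)[of x] by (auto simp: g0_def)
      moreover have "isCont (c K) (g x)" using c_cont[of UNIV K] by (simp add: continuous_on_eq_continuous_at)
      ultimately have "(\<lambda>n. c K (G n x)) \<longlonglongrightarrow> c K (g x)" by (rule isCont_tendsto_compose[rotated])
      from tendsto_diff[OF tendsto_const this, of "c K (g x)"]
      show "(\<lambda>n. c K (g x) - c K (G n x)) \<longlonglongrightarrow> 0" by simp
    qed
    show "integrable (intv L) (\<lambda>_. (2 * real K)\<^sup>2)" by simp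
    show "AE x in intv L. (norm (c K (g x) - c K (G n x)))\<^sup>2 \<le> (2 * real K)\<^sup>2" for n
    proof (intro AE_I2 power_mono)
      fix x show "norm (c K (g x) - c K (G n x)) \<le> 2 * real K"
        using norm_triangle_ineq4[of "c K (g x)" "c K (G n x)"] c_bound[of K "g x"] c_bound[of K "G n x"] by simp
    qed simp
  qed
  from order_tendstoD(2)[OF this, of "e/2"] e obtain n where n: "l2n (intv L) (\<lambda>x. c K (g x) - c K (G n x)) < e / 2"
    by (auto simp: eventually_sequentially)
  have s1: "sq_int (intv L) (\<lambda>x. c K (g x))" by (rule bounded_sq_int_intv[OF cm[OF gm], where B = "real K"]) (use c_bound in auto)
  have s2: "sq_int (intv L) (\<lambda>x. c K (G n x))" by (rule bounded_sq_int_intv[OF cGm, where B = "real K"]) (use c_bound in auto)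
  have "l2n (intv L) (\<lambda>x. (g x - c K (g x)) + (c K (g x) - c K (G n x))) < e"
    using l2n_triangle[OF sq_int_diff[OF g s1] sq_int_diff[OF s1 s2]] K n by simp
  hence "l2n (intv L) (\<lambda>x. g x - c K (G n x)) < e" by simp
  with cG s2 show ?thesis using that by blast
qed

section \<open>Meshes and elementwise means\<close>

locale mesh_on =
  fixes L :: real and N :: nat and X :: "nat \<Rightarrow> real"
  assumes L_pos: "L > 0" and mesh: "mesh L N X"
begin

abbreviation h :: real where "h \<equiv> mesh_size N X"

lemma X_0 [simp]: "X 0 = 0" and X_N [simp]: "X N = L" and X_Suc: "j < N \<Longrightarrow> X j < X (Suc j)"
  using mesh by (auto simp: mesh_def)

lemma N_pos: "N > 0"
  using L_pos X_0 X_N by (metis gr0I less_irrefl)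

lemma X_mono: "i \<le> j \<Longrightarrow> j \<le> N \<Longrightarrow> X i \<le> X j"
proof (induction j)
  case (Suc j)
  show ?case
  proof (cases "i = Suc j")
    case False
    with Suc X_Suc[of j] show ?thesis by force
  qed simp
qed simp

lemma X_in: "j \<le> N \<Longrightarrow> X j \<in> {0..L}"
  using X_mono[of 0 j] X_mono[of j N] by simp

lemma elem_eq:
  assumes "j < N" "X j < x" "x \<le> X (Suc j)" shows "elem X x = j"
  unfolding elem_def
proof (rule Least_equality)
  fix k assume "x \<le> X (Suc k)"
  show "j \<le> k"
  proof (rule ccontr)
    assume "\<not> j \<le> k"
    hence "X (Suc k) \<le> X j" using assms by (intro X_mono) auto
    with \<open>x \<le> X (Suc k)\<close> assms show False by simp
  qed
qed (use assms in simp)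

lemma elem_props:
  assumes "0 < x" "x \<le> L" shows "elem X x < N" "X (elem X x) < x" "x \<le> X (Suc (elem X x))"
proof -
  have ex: "x \<le> X (Suc (N - 1))" using N_pos assms by simp
  have "elem X x \<le> N - 1" unfolding elem_def by (rule Least_le) (rule ex)
  thus "elem X x < N" using N_pos by simp
  show "x \<le> X (Suc (elem X x))" unfolding elem_def by (rule LeastI[of "\<lambda>j. x \<le> X (Suc j)"]) (rule ex)
  show "X (elem X x) < x"
  proof (cases "elem X x")
    case 0
    thus ?thesis using assms by simp
  next
    case (Suc k)
    hence "k < elem X x" by simp
    hence "\<not> x \<le> X (Suc k)" unfolding elem_def by (rule not_less_Least)
    thus ?thesis using Suc by simp
  qed
qed

lemma len_le_h: "j < N \<Longrightarrow> X (Suc j) - X j \<le> h"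
  unfolding mesh_size_def by (intro Max_ge) auto

lemma h_pos: "h > 0"
  using len_le_h[OF N_pos] X_Suc[OF N_pos] by simp

text \<open>The index \<open>elem X x\<close> is a least element depending on \<open>x\<close>; as a
  finite sum of indicators the function becomes accessible to measurability arguments.\<close>

lemma elementwise_sum:
  fixes F :: "nat \<Rightarrow> real \<Rightarrow> 'b::real_vector"
  assumes "0 < x" "x \<le> L"
  shows "F (elem X x) x = (\<Sum>j<N. indicat_real {X j<..X (Suc j)} x *\<^sub>R F j x)"
proof -
  have "indicat_real {X j<..X (Suc j)} x = (if elem X x = j then 1 else 0)" if "j < N" for j
    using elem_eq[OF that, of x] elem_props[OF assms] by (auto simp: indicator_def)
  hence "(\<Sum>j<N. indicat_real {X j<..X (Suc j)} x *\<^sub>R F j x) = (\<Sum>j<N. if elem X x = j then F j x else 0)"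
    by (intro sum.cong) auto
  also have "\<dots> = F (elem X x) x" using elem_props[OF assms] by simp
  finally show ?thesis by simp
qed

lemma elementwise_measurable:
  fixes F :: "nat \<Rightarrow> real \<Rightarrow> 'b::{second_countable_topology,real_normed_vector}"
  assumes "\<And>j. j < N \<Longrightarrow> F j \<in> borel_measurable (intv L)"
  shows "(\<lambda>x. F (elem X x) x) \<in> borel_measurable (intv L)"
proof -
  have "(\<lambda>x. \<Sum>j<N. indicat_real {X j<..X (Suc j)} x *\<^sub>R F j x) \<in> borel_measurable (intv L)"
    using assms by (intro borel_measurable_sum borel_measurable_scaleR indicator_measurable_intv) auto
  thus ?thesis
  proof (rule measurable_cong[THEN iffD1, rotated])
    fix x assume "x \<in> space (intv L)"
    thus "(\<Sum>j<N. indicat_real {X j<..X (Suc j)} x *\<^sub>R F j x) = F (elem X x) x"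
      by (intro elementwise_sum[symmetric]) auto
  qed
qed

lemma elementwise_const_bounded:
  fixes \<kappa> :: "nat \<Rightarrow> 'b::real_normed_vector"
  obtains B where "\<And>x. x \<in> {0<..<L} \<Longrightarrow> norm (\<kappa> (elem X x)) \<le> B"
proof (rule that)
  fix x assume "x \<in> {0<..<L}"
  hence "elem X x < N" using elem_props by auto
  thus "norm (\<kappa> (elem X x)) \<le> (\<Sum>j<N. norm (\<kappa> j))"
    by (intro member_le_sum) auto
qed

lemma sq_int_elementwise_const:
  fixes \<kappa> :: "nat \<Rightarrow> 'b::euclidean_space"
  shows "sq_int (intv L) (\<lambda>x. \<kappa> (elem X x))"
proof -
  obtain B where B: "\<And>x. x \<in> {0<..<L} \<Longrightarrow> norm (\<kappa> (elem X x)) \<le> B"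
    using elementwise_const_bounded[of \<kappa>] by blast
  show ?thesis
    by (rule bounded_sq_int_intv[OF _ B]) (use elementwise_measurable[of "\<lambda>j _. \<kappa> j"] in auto)
qed

lemma seg_split:
  fixes f :: "real \<Rightarrow> 'b::{banach,second_countable_topology}"
  assumes f: "integrable (intv L) f"
  shows "k \<le> N \<Longrightarrow> seg L f 0 (X k) = (\<Sum>j<k. seg L f (X j) (X (Suc j)))"
proof (induction k)
  case (Suc k)
  have "seg L f 0 (X (Suc k)) = seg L f 0 (X k) + seg L f (X k) (X (Suc k))"
    by (rule seg_add[OF f, symmetric]) (use Suc X_mono[of k "Suc k"] X_in[of k] in auto)
  with Suc show ?case by simp
qed simp

lemma integral_split:
  assumes f: "integrable (intv L) f"
  shows "(\<integral>x. f x \<partial>intv L) = (\<Sum>j<N. seg L f (X j) (X (Suc j)))"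
  using seg_split[OF f, of N] seg_full[of L f] L_pos by simp

text \<open>The averaging operator \<open>avg\<close> in terms of \<open>seg\<close>. It is also
  applied to real densities such as \<open>(norm (v t))\<^sup>2\<close>, hence the general value
  type.\<close>

definition cav :: "(real \<Rightarrow> 'b::{banach,second_countable_topology}) \<Rightarrow> real \<Rightarrow> 'b" where
  "cav v x = (1 / (X (Suc (elem X x)) - X (elem X x))) *\<^sub>R seg L v (X (elem X x)) (X (Suc (elem X x)))"

lemma avg_eq_cav:
  assumes "v \<in> borel_measurable (intv L)" "x \<in> {0<..<L}" shows "avg X v x = cav v x"
proof -
  have "elem X x < N" using elem_props assms(2) by auto
  hence "seg L v (X (elem X x)) (X (Suc (elem X x))) = (LINT t:{X (elem X x)..X (Suc (elem X x))}|lborel. v t)"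
    using X_in[of "elem X x"] X_in[of "Suc (elem X x)"] X_Suc[of "elem X x"]
    by (intro seg_eq_lborel assms(1)) auto
  thus ?thesis by (simp add: avg_def cav_def Let_def)
qed

lemma cav_eq:
  assumes "j < N" "X j < x" "x \<le> X (Suc j)"
  shows "cav v x = (1 / (X (Suc j) - X j)) *\<^sub>R seg L v (X j) (X (Suc j))"
  by (simp add: cav_def elem_eq[OF assms])

lemma sq_int_cav: "sq_int (intv L) (cav (v :: real \<Rightarrow> 'b::euclidean_space))"
  using sq_int_elementwise_const[of "\<lambda>j. (1 / (X (Suc j) - X j)) *\<^sub>R seg L v (X j) (X (Suc j))"]
  by (simp add: cav_def[abs_def])

lemma integrable_cav: "integrable (intv L) (cav (v :: real \<Rightarrow> 'b::euclidean_space))"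
  by (rule finite_measure.sq_int_integrable[OF finite_measure_intv sq_int_cav])

lemma seg_element:
  fixes c :: "'b::{banach,second_countable_topology}"
  assumes "j < N" "\<And>x. X j < x \<Longrightarrow> x \<le> X (Suc j) \<Longrightarrow> f x = c"
  shows "seg L f (X j) (X (Suc j)) = (X (Suc j) - X j) *\<^sub>R c"
proof -
  have "seg L f (X j) (X (Suc j)) = seg L (\<lambda>_. c) (X j) (X (Suc j))"
    using assms(2) by (intro seg_cong) auto
  thus ?thesis using seg_const[of "X j" "X (Suc j)" L c] X_in[of j] X_in[of "Suc j"] X_Suc[OF assms(1)] assms(1)
    by simp
qed

lemma seg_cav:
  assumes "j < N" shows "seg L (cav v) (X j) (X (Suc j)) = seg L v (X j) (X (Suc j))"
proof -
  have "seg L (cav v) (X j) (X (Suc j)) =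
      (X (Suc j) - X j) *\<^sub>R ((1 / (X (Suc j) - X j)) *\<^sub>R seg L v (X j) (X (Suc j)))"
    by (intro seg_element assms cav_eq)
  thus ?thesis using X_Suc[OF assms] by simp
qed

lemma integral_cav:
  fixes v :: "real \<Rightarrow> 'b::euclidean_space"
  assumes "integrable (intv L) v" shows "(\<integral>x. cav v x \<partial>intv L) = (\<integral>x. v x \<partial>intv L)"
  unfolding integral_split[OF assms] integral_split[OF integrable_cav] by (intro sum.cong) (auto simp: seg_cav)

text \<open>Jensen's inequality for the square, obtained from Cauchy-Schwarz on the element that
  contains \<open>x\<close>.\<close>

lemma cav_norm_le:
  fixes v :: "real \<Rightarrow> 'b::euclidean_space"
  assumes v: "sq_int (intv L) v" and x: "x \<in> {0<..<L}"
  shows "(norm (cav v x))\<^sup>2 \<le> cav (\<lambda>t. (norm (v t))\<^sup>2) x"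
proof -
  let ?j = "elem X x"
  have j: "?j < N" using elem_props x by auto
  define l where "l = X (Suc ?j) - X ?j"
  have l: "l > 0" using X_Suc[OF j] by (simp add: l_def)
  have "(norm (seg L v (X ?j) (X (Suc ?j))))\<^sup>2 \<le> l * seg L (\<lambda>t. (norm (v t))\<^sup>2) (X ?j) (X (Suc ?j))"
    unfolding l_def using X_in[of ?j] X_in[of "Suc ?j"] X_Suc[OF j] j
    by (intro seg_Cauchy_Schwarz v) auto
  hence "(norm (seg L v (X ?j) (X (Suc ?j))))\<^sup>2 / l\<^sup>2 \<le> seg L (\<lambda>t. (norm (v t))\<^sup>2) (X ?j) (X (Suc ?j)) / l"
    using l by (simp add: field_simps power2_eq_square)
  thus ?thesis using l unfolding cav_def l_def[symmetric]
    by (simp add: power_divide power_mult_distrib)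
qed

lemma l2n_cav_le:
  fixes v :: "real \<Rightarrow> 'b::euclidean_space"
  assumes v: "sq_int (intv L) v" shows "l2n (intv L) (cav v) \<le> l2n (intv L) v"
proof -
  have "(l2n (intv L) (cav v))\<^sup>2 \<le> (\<integral>x. cav (\<lambda>t. (norm (v t))\<^sup>2) x \<partial>intv L)"
    unfolding l2n_power2
    by (intro integral_mono sq_intD sq_int_cav integrable_cav) (use cav_norm_le[OF v] in auto)
  also have "\<dots> = (l2n (intv L) v)\<^sup>2"
    unfolding l2n_power2 by (rule integral_cav[OF sq_intD[OF v]])
  finally show ?thesis by (rule power2_le_imp_le) simp
qed

lemma cav_linear:
  assumes "integrable (intv L) f" "integrable (intv L) g"
  shows "cav (\<lambda>t. r *\<^sub>R f t + s *\<^sub>R g t) x = r *\<^sub>R cav f x + s *\<^sub>R cav g x"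
  by (simp add: cav_def seg_linear[OF assms] scaleR_add_right mult.commute)

lemma cav_diff:
  assumes "integrable (intv L) f" "integrable (intv L) g"
  shows "cav (\<lambda>t. f t - g t) x = cav f x - cav g x"
  using cav_linear[OF assms, of 1 "-1" x] by simp

lemma cav_cong_AE:
  assumes "AE t in intv L. f t = g t" "f \<in> borel_measurable (intv L)" "g \<in> borel_measurable (intv L)"
  shows "cav f = cav g"
  by (simp add: cav_def[abs_def] seg_cong_AE[OF assms])

lemma seg_inner_const:
  fixes g :: "real \<Rightarrow> 'b::euclidean_space"
  assumes "integrable (intv L) g" shows "seg L (\<lambda>x. c \<bullet> g x) a b = c \<bullet> seg L g a b"
proof -
  have "seg L (\<lambda>x. c \<bullet> g x) a b = (\<integral>t. c \<bullet> (indicator {a<..b} t *\<^sub>R g t) \<partial>intv L)"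
    unfolding seg_def by (intro Bochner_Integration.integral_cong) auto
  also have "\<dots> = c \<bullet> seg L g a b"
    unfolding seg_def by (intro integral_inner_right integrable_indicator_scaleR assms) auto
  finally show ?thesis .
qed

text \<open>On an element \<open>cav v\<close> is constant, so only the mean of \<open>g\<close>
  there enters: averaging is the orthogonal projection onto elementwise constants.\<close>

lemma integral_cav_inner:
  fixes v g :: "real \<Rightarrow> 'b::euclidean_space"
  assumes g: "sq_int (intv L) g"
  shows "(\<integral>x. cav v x \<bullet> g x \<partial>intv L) = (\<integral>x. cav v x \<bullet> cav g x \<partial>intv L)"
  unfolding integral_split[OF sq_int_inner_integrable[OF sq_int_cav g]]
    integral_split[OF sq_int_inner_integrable[OF sq_int_cav sq_int_cav]]
proof (intro sum.cong refl)
  have gi: "integrable (intv L) g" by (rule finite_measure.sq_int_integrable[OF finite_measure_intv g])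
  fix j assume "j \<in> {..<N}"
  hence j: "j < N" by simp
  define c where "c = (1 / (X (Suc j) - X j)) *\<^sub>R seg L v (X j) (X (Suc j))"
  have "seg L (\<lambda>x. cav v x \<bullet> g x) (X j) (X (Suc j)) = seg L (\<lambda>x. c \<bullet> g x) (X j) (X (Suc j))"
    using cav_eq[OF j, of _ v] by (intro seg_cong) (auto simp: c_def)
  also have "\<dots> = c \<bullet> seg L (cav g) (X j) (X (Suc j))"
    using seg_inner_const[OF gi] seg_cav[OF j, of g] by simp
  also have "\<dots> = seg L (\<lambda>x. c \<bullet> cav g x) (X j) (X (Suc j))"
    by (rule seg_inner_const[OF integrable_cav, symmetric])
  also have "\<dots> = seg L (\<lambda>x. cav v x \<bullet> cav g x) (X j) (X (Suc j))"
    using cav_eq[OF j, of _ v] by (intro seg_cong) (auto simp: c_def)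
  finally show "seg L (\<lambda>x. cav v x \<bullet> g x) (X j) (X (Suc j)) = seg L (\<lambda>x. cav v x \<bullet> cav g x) (X j) (X (Suc j))" .
qed

text \<open>Allows the average to be moved from a weakly convergent sequence to a fixed function,
  whose averages converge strongly.\<close>

lemma integral_cav_symmetric:
  fixes v g :: "real \<Rightarrow> 'b::euclidean_space"
  assumes "sq_int (intv L) g" "sq_int (intv L) v"
  shows "(\<integral>x. cav v x \<bullet> g x \<partial>intv L) = (\<integral>x. v x \<bullet> cav g x \<partial>intv L)"
  using integral_cav_inner[OF assms(1), of v] integral_cav_inner[OF assms(2), of g] by (simp add: inner_commute)

lemma cav_continuous_error:
  fixes \<phi> :: "real \<Rightarrow> 'b::euclidean_space"
  assumes \<phi>: "continuous_on {0..L} \<phi>"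
    and d: "\<And>s t. s \<in> {0..L} \<Longrightarrow> t \<in> {0..L} \<Longrightarrow> dist s t \<le> h \<Longrightarrow> norm (\<phi> s - \<phi> t) \<le> e"
    and x: "x \<in> {0<..<L}" and e: "0 \<le> e"
  shows "norm (cav \<phi> x - \<phi> x) \<le> e"
proof -
  let ?j = "elem X x"
  have p: "?j < N" "X ?j < x" "x \<le> X (Suc ?j)" using elem_props x by auto
  define l where "l = X (Suc ?j) - X ?j"
  have l: "l > 0" "l \<le> h" using X_Suc[OF p(1)] len_le_h[OF p(1)] by (auto simp: l_def)
  have Xs: "X ?j \<in> {0..L}" "X (Suc ?j) \<in> {0..L}" using X_in p by auto
  note int = continuous_integrable_intv[OF \<phi>]
  have "seg L (\<lambda>t. \<phi> t - \<phi> x) (X ?j) (X (Suc ?j)) = seg L (\<lambda>t. 1 *\<^sub>R \<phi> t + (-1) *\<^sub>R \<phi> x) (X ?j) (X (Suc ?j))" by simp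
  also have "\<dots> = seg L \<phi> (X ?j) (X (Suc ?j)) - l *\<^sub>R \<phi> x"
    using Xs p by (subst seg_linear[OF int]) (simp_all add: seg_const l_def flip: scaleR_minus_left)
  finally have eq: "cav \<phi> x - \<phi> x = (1 / l) *\<^sub>R seg L (\<lambda>t. \<phi> t - \<phi> x) (X ?j) (X (Suc ?j))"
    using l by (simp add: cav_def l_def[symmetric] scaleR_diff_right)
  have "norm (seg L (\<lambda>t. \<phi> t - \<phi> x) (X ?j) (X (Suc ?j))) \<le> seg L (\<lambda>t. norm (\<phi> t - \<phi> x)) (X ?j) (X (Suc ?j))"
    using int by (intro seg_norm_le) simp
  also have "\<dots> \<le> seg L (\<lambda>t. e) (X ?j) (X (Suc ?j))"
  proof (rule seg_mono)
    fix t assume "0 < t" "t < L" "X ?j < t" "t \<le> X (Suc ?j)"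
    thus "norm (\<phi> t - \<phi> x) \<le> e" using p l x by (intro d) (auto simp: dist_real_def l_def)
  qed (use int in auto)
  also have "\<dots> = l * e" using Xs p by (simp add: seg_const l_def)
  finally show ?thesis unfolding eq using l by (simp add: field_simps)
qed

end

text \<open>Approximate \<open>g\<close> by a continuous \<open>\<phi>\<close>. The contraction
  property controls the average of \<open>g - \<phi>\<close> on every mesh, and uniform continuity
  controls \<open>\<phi>\<close> on fine ones.\<close>

lemma cav_tendsto:
  fixes g :: "real \<Rightarrow> 'b::euclidean_space"
  assumes m: "\<And>n. mesh_on L (N n) (X n)" and h: "(\<lambda>n. mesh_size (N n) (X n)) \<longlonglongrightarrow> 0"
    and g: "sq_int (intv L) g"
  shows "(\<lambda>n. l2n (intv L) (\<lambda>x. mesh_on.cav L (X n) g x - g x)) \<longlonglongrightarrow> 0"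
proof (rule LIMSEQ_I)
  fix r :: real assume r: "0 < r"
  have L: "L > 0" using m[of 0] by (simp add: mesh_on_def)
  \<comment> \<open>Three errors are added: two of size \<open>e\<close> and one of size
    \<open>sqrt L * e\<close>; the third unit in the denominator makes their sum strictly smaller
    than \<open>r\<close>.\<close>
  define e where "e = r / (3 + sqrt L)"
  have sL: "3 + sqrt L > 0" using L by (simp add: add_pos_nonneg)
  hence e0: "e > 0" using r by (simp add: e_def)
  have "e * (3 + sqrt L) = r" using sL by (simp add: e_def)
  with e0 have e: "e > 0" "2 * e + sqrt L * e < r" by (auto simp: algebra_simps)
  obtain \<phi> where \<phi>: "continuous_on UNIV \<phi>" "sq_int (intv L) \<phi>" "l2n (intv L) (\<lambda>x. g x - \<phi> x) < e"
    using continuous_dense_L2[OF g e(1)] by blast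
  have \<phi>c: "continuous_on {0..L} \<phi>" using \<phi>(1) by (rule continuous_on_subset) simp
  have "uniformly_continuous_on {0..L} \<phi>"
    by (rule compact_uniformly_continuous[OF \<phi>c]) simp
  then obtain d where d: "d > 0" "\<And>s t. s \<in> {0..L} \<Longrightarrow> t \<in> {0..L} \<Longrightarrow> dist s t < d \<Longrightarrow> dist (\<phi> s) (\<phi> t) < e"
    using e(1) unfolding uniformly_continuous_on_def by metis
  obtain n0 where n0: "\<And>n. n \<ge> n0 \<Longrightarrow> mesh_size (N n) (X n) < d"
    using order_tendstoD(2)[OF h d(1)] by (auto simp: eventually_sequentially)
  show "\<exists>no. \<forall>n\<ge>no. norm (l2n (intv L) (\<lambda>x. mesh_on.cav L (X n) g x - g x) - 0) < r"
  proof (intro exI allI impI)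
    fix n assume n: "n \<ge> n0"
    interpret mesh_on L "N n" "X n" by (rule m)
    interpret finite_measure "intv L" by (rule finite_measure_intv)
    note gi = sq_int_integrable[OF g] and \<phi>i = sq_int_integrable[OF \<phi>(2)]
    have d1: "sq_int (intv L) (\<lambda>x. cav (\<lambda>t. g t - \<phi> t) x)" by (rule sq_int_cav)
    have d2: "sq_int (intv L) (\<lambda>x. cav \<phi> x - \<phi> x)" by (intro sq_int_diff sq_int_cav \<phi>(2))
    have d3: "sq_int (intv L) (\<lambda>x. \<phi> x - g x)" by (intro sq_int_diff \<phi>(2) g)
    have eq: "cav g x - g x = cav (\<lambda>t. g t - \<phi> t) x + ((cav \<phi> x - \<phi> x) + (\<phi> x - g x))" for x
      by (simp add: cav_diff[OF gi \<phi>i])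
    have "l2n (intv L) (\<lambda>x. cav \<phi> x - \<phi> x) \<le> l2n (intv L) (\<lambda>_. e)"
    proof (rule l2n_mono[OF sq_int_const])
      fix x assume "x \<in> space (intv L)"
      hence "norm (cav \<phi> x - \<phi> x) \<le> e"
        using d(2) n0[OF n] e(1) by (intro cav_continuous_error[OF \<phi>c]) (force simp: dist_norm)+
      thus "norm (cav \<phi> x - \<phi> x) \<le> norm e" using e(1) by simp
    qed
    hence b2: "l2n (intv L) (\<lambda>x. cav \<phi> x - \<phi> x) \<le> sqrt L * e"
      using L e(1) by (simp add: l2n_const)
    have b1: "l2n (intv L) (\<lambda>x. cav (\<lambda>t. g t - \<phi> t) x) < e"
      using l2n_cav_le[OF sq_int_diff[OF g \<phi>(2)]] \<phi>(3) by simp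
    have b3: "l2n (intv L) (\<lambda>x. \<phi> x - g x) < e"
      using \<phi>(3) l2n_minus[of "intv L" g \<phi>] by simp
    have "l2n (intv L) (\<lambda>x. cav g x - g x) \<le> l2n (intv L) (\<lambda>x. cav (\<lambda>t. g t - \<phi> t) x)
        + (l2n (intv L) (\<lambda>x. cav \<phi> x - \<phi> x) + l2n (intv L) (\<lambda>x. \<phi> x - g x))"
      unfolding eq using l2n_triangle[OF d1 sq_int_add[OF d2 d3]] l2n_triangle[OF d2 d3] by linarith
    also have "\<dots> < r" using b1 b2 b3 e(2) by linarith
    finally show "norm (l2n (intv L) (\<lambda>x. cav g x - g x) - 0) < r" by simp
  qed
qed

section \<open>The energy density and the constraints\<close>

lemma psi_abs_alt:
  assumes "0 \<le> A" "0 \<le> B"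
  shows "psi abs A B = (if B \<le> A then A - B + 2 * B\<^sup>2 / A else B - A + 2 * B)"
proof (cases "B \<le> A")
  case True
  thus ?thesis using assms by (simp add: psi_def)
next
  case False
  hence "B \<noteq> 0" using assms by auto
  thus ?thesis using False by (simp add: psi_def power2_eq_square)
qed

text \<open>Explains the form of the discrete energy: with the exact modulus its bending integrand
  is \<open>Qbar\<close>. At \<open>\<alpha> = 0\<close> both sides use that division by zero gives
  zero.\<close>

lemma Qbar_eq_psi:
  assumes "0 \<le> \<alpha>" "0 \<le> \<beta>"
  shows "Qbar \<alpha> \<beta> = 1 / 2 * (\<alpha>\<^sup>2 + 5 * \<beta>\<^sup>2 + psi abs (\<alpha>\<^sup>2) (\<beta>\<^sup>2))"
proof (cases "\<beta> \<le> \<alpha>")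
  case True
  hence "\<beta>\<^sup>2 \<le> \<alpha>\<^sup>2" using assms by simp
  thus ?thesis using True assms
    by (cases "\<alpha> = 0") (simp_all add: psi_abs_alt Qbar_def field_simps power2_eq_square)
next
  case False
  hence "\<not> \<beta>\<^sup>2 \<le> \<alpha>\<^sup>2" using assms by simp
  thus ?thesis using False assms by (simp add: psi_abs_alt Qbar_def)
qed

lemma psi_nonneg:
  assumes "0 \<le> A" "0 \<le> B" "0 \<le> md (A - B)" shows "0 \<le> psi md A B"
  using assms by (simp add: psi_def)

lemma psi_abs_le:
  assumes "0 \<le> A" "0 \<le> B" shows "psi abs A B \<le> 5 * (A + B)"
proof -
  have "2 * B\<^sup>2 / A \<le> 2 * B" if "B \<le> A"
    using that assms by (cases "A = 0") (auto simp: field_simps power2_eq_square intro: mult_right_mono)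
  thus ?thesis using assms by (auto simp: psi_abs_alt)
qed

text \<open>The modulus enters \<open>psi\<close> once as a summand, at cost \<open>\<eta>\<close>,
  and once in a denominator, at cost \<open>4 * \<eta>\<close>, because both quotients
  \<open>B / (A + B + s)\<close> and \<open>B / (A + B + t)\<close> are at most one.\<close>

lemma psi_md_diff:
  assumes "0 \<le> A" "0 \<le> B" "0 \<le> md (A - B)" "\<bar>md (A - B) - \<bar>A - B\<bar>\<bar> \<le> \<eta>"
  shows "\<bar>psi md A B - psi abs A B\<bar> \<le> 5 * \<eta>"
proof (cases "A + B = 0")
  case True
  hence "A = 0" "B = 0" using assms by auto
  thus ?thesis using assms by (simp add: psi_def)
next
  case False
  define s t where "s = md (A - B)" and "t = \<bar>A - B\<bar>"
  have pos: "A + B > 0" "s \<ge> 0" "t \<ge> 0" "\<bar>s - t\<bar> \<le> \<eta>" using False assms by (auto simp: s_def t_def)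
  have "4 * B\<^sup>2 / (A + B + s) - 4 * B\<^sup>2 / (A + B + t) = 4 * (t - s) * ((B / (A + B + s)) * (B / (A + B + t)))"
    using pos by (simp add: field_simps power2_eq_square)
  also have "\<bar>\<dots>\<bar> = 4 * \<bar>s - t\<bar> * ((B / (A + B + s)) * (B / (A + B + t)))"
    using pos assms by (simp add: abs_mult abs_minus_commute del: right_diff_distrib_numeral)
  also have "\<dots> \<le> 4 * \<bar>s - t\<bar> * (1 * 1)"
    using pos assms by (intro mult_left_mono mult_mono) auto
  finally have "\<bar>4 * B\<^sup>2 / (A + B + s) - 4 * B\<^sup>2 / (A + B + t)\<bar> \<le> 4 * \<bar>s - t\<bar>" by simp
  moreover have "\<bar>a - b\<bar> \<le> 4 * \<bar>s - t\<bar> \<Longrightarrow> \<bar>(s + a) - (t + b)\<bar> \<le> 5 * \<eta>" for a b :: real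
    using pos(4) by (smt (verit))
  ultimately show ?thesis unfolding psi_def s_def[symmetric] t_def[symmetric] by blast
qed

text \<open>The summand \<open>\<bar>A - B\<bar>\<close> contributes the constant \<open>1\<close>.
  The fraction contributes \<open>\<bar>s - t\<bar> + 4 * \<bar>B - B'\<bar>\<close> with
  denominators \<open>s\<close> and \<open>t\<close>, and \<open>s - t\<close> is Lipschitz with
  constant \<open>2\<close>; hence \<open>7 = 1 + 2 + 4\<close>.\<close>

lemma psi_abs_Lipschitz:
  assumes nn: "0 \<le> A" "0 \<le> B" "0 \<le> A'" "0 \<le> B'"
  shows "\<bar>psi abs A B - psi abs A' B'\<bar> \<le> 7 * (\<bar>A - A'\<bar> + \<bar>B - B'\<bar>)"
proof -
  \<comment> \<open>The claim is symmetric in the two points, so the smaller denominator may come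
    first; then both \<open>2 * B\<close> and \<open>2 * B'\<close> are bounded by
    \<open>t\<close>.\<close>
  have main: "\<bar>psi abs A B - psi abs A' B'\<bar> \<le> 7 * (\<bar>A - A'\<bar> + \<bar>B - B'\<bar>)"
    if nn: "0 \<le> A" "0 \<le> B" "0 \<le> A'" "0 \<le> B'" and S: "A + B + \<bar>A - B\<bar> \<le> A' + B' + \<bar>A' - B'\<bar>"
    for A B A' B' :: real
  proof -
    define s t where "s = A + B + \<bar>A - B\<bar>" and "t = A' + B' + \<bar>A' - B'\<bar>"
    have B: "2 * B \<le> s" "2 * B' \<le> t" "s \<le> t" "0 \<le> s" using nn S by (auto simp: s_def t_def)
    have st: "\<bar>s - t\<bar> \<le> 2 * \<bar>A - A'\<bar> + 2 * \<bar>B - B'\<bar>" unfolding s_def t_def by (smt (verit))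
    have frac: "\<bar>4 * B\<^sup>2 / s - 4 * B'\<^sup>2 / t\<bar> \<le> \<bar>s - t\<bar> + 4 * \<bar>B - B'\<bar>"
    proof (cases "s = 0")
      case True
      hence "B = 0" using B nn by simp
      have "4 * B'\<^sup>2 / t \<le> 4 * B'"
        using B nn by (cases "t = 0") (auto simp: field_simps power2_eq_square intro!: mult_left_mono)
      thus ?thesis using True \<open>B = 0\<close> B nn by simp
    next
      case False
      hence s: "s > 0" "t > 0" using B by auto
      \<comment> \<open>First the denominator is changed at fixed \<open>B\<close>, then
        \<open>B\<close> at fixed denominator \<open>t\<close>.\<close>
      have e: "4 * B\<^sup>2 / s - 4 * B'\<^sup>2 / t = (2 * B / s) * (2 * B / t) * (t - s) + 4 * (B - B') * ((B + B') / t)"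
        using s by (simp add: field_simps power2_eq_square)
      have "\<bar>(2 * B / s) * (2 * B / t) * (t - s)\<bar> = (2 * B / s) * (2 * B / t) * \<bar>s - t\<bar>"
        using s nn by (simp add: abs_mult abs_minus_commute)
      also have "\<dots> \<le> 1 * 1 * \<bar>s - t\<bar>"
        using s nn B by (intro mult_right_mono mult_mono) auto
      finally have p1: "\<bar>(2 * B / s) * (2 * B / t) * (t - s)\<bar> \<le> \<bar>s - t\<bar>" by simp
      have "\<bar>4 * (B - B') * ((B + B') / t)\<bar> = 4 * \<bar>B - B'\<bar> * ((B + B') / t)"
        using s nn by (simp add: abs_mult del: right_diff_distrib_numeral)
      also have "\<dots> \<le> 4 * \<bar>B - B'\<bar> * 1"
        using s nn B by (intro mult_left_mono) auto
      finally show ?thesis unfolding e using p1 by linarith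
    qed
    have ab: "\<bar>\<bar>A - B\<bar> - \<bar>A' - B'\<bar>\<bar> \<le> \<bar>A - A'\<bar> + \<bar>B - B'\<bar>" by auto
    have arith: "\<bar>a + c - (b + d)\<bar> \<le> 7 * (x + z)"
      if "\<bar>a - b\<bar> \<le> x + z" "\<bar>c - d\<bar> \<le> w + 4 * z" "w \<le> 2 * x + 2 * z" "0 \<le> x" for a b c d x z w :: real
      using that by (smt (verit))
    show ?thesis unfolding psi_def s_def[symmetric] t_def[symmetric]
      by (rule arith[OF ab frac st abs_ge_zero])
  qed
  show ?thesis
  proof (cases "A + B + \<bar>A - B\<bar> \<le> A' + B' + \<bar>A' - B'\<bar>")
    case True
    thus ?thesis using main[of A B A' B'] nn by simp
  next
    case False
    thus ?thesis using main[of A' B' A B] nn by (simp add: abs_minus_commute)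
  qed
qed

text \<open>The square root of \<open>Qbar\<close> is the maximum of \<open>(1 - s\<^sup>2) \<alpha> + 2 s \<beta>\<close> over \<open>s \<in> [0,1]\<close>, attained at
  \<open>Qslope \<alpha> \<beta>\<close>; hence \<open>Qbar\<close> is convex, with the subgradient \<open>(Qgrad1, Qgrad2)\<close>.\<close>

definition Qslope :: "real \<Rightarrow> real \<Rightarrow> real" where
  "Qslope \<alpha> \<beta> = (if \<beta> \<le> \<alpha> then \<beta> / \<alpha> else 1)"

definition Qroot :: "real \<Rightarrow> real \<Rightarrow> real" where
  "Qroot \<alpha> \<beta> = (1 - (Qslope \<alpha> \<beta>)\<^sup>2) * \<alpha> + 2 * Qslope \<alpha> \<beta> * \<beta>"

lemma Qslope_bounds: "0 \<le> \<alpha> \<Longrightarrow> 0 \<le> \<beta> \<Longrightarrow> 0 \<le> Qslope \<alpha> \<beta> \<and> Qslope \<alpha> \<beta> \<le> 1"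
  by (auto simp: Qslope_def divide_le_eq_1)

lemma Qbar_Qroot:
  assumes "0 \<le> \<alpha>" "0 \<le> \<beta>" shows "Qbar \<alpha> \<beta> = (Qroot \<alpha> \<beta>)\<^sup>2" "0 \<le> Qroot \<alpha> \<beta>" "Qroot \<alpha> \<beta> \<le> \<alpha> + 2 * \<beta>"
proof -
  have "Qroot \<alpha> \<beta> = (if \<beta> \<le> \<alpha> then (\<alpha>\<^sup>2 + \<beta>\<^sup>2) / \<alpha> else 2 * \<beta>)"
    using assms by (cases "\<alpha> = 0") (auto simp: Qroot_def Qslope_def field_simps power2_eq_square)
  thus "Qbar \<alpha> \<beta> = (Qroot \<alpha> \<beta>)\<^sup>2"
    using assms by (auto simp: Qbar_def power_divide power_mult_distrib)
  have s: "0 \<le> Qslope \<alpha> \<beta>" "Qslope \<alpha> \<beta> \<le> 1" using Qslope_bounds[OF assms] by auto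
  hence s2: "0 \<le> 1 - (Qslope \<alpha> \<beta>)\<^sup>2" "1 - (Qslope \<alpha> \<beta>)\<^sup>2 \<le> 1" by (auto simp: power_le_one)
  show "0 \<le> Qroot \<alpha> \<beta>" using s s2 assms by (simp add: Qroot_def)
  have "(1 - (Qslope \<alpha> \<beta>)\<^sup>2) * \<alpha> \<le> 1 * \<alpha>" using s2 assms by (intro mult_right_mono) auto
  moreover have "2 * Qslope \<alpha> \<beta> * \<beta> \<le> 2 * 1 * \<beta>" using s assms by (intro mult_right_mono mult_left_mono) auto
  ultimately show "Qroot \<alpha> \<beta> \<le> \<alpha> + 2 * \<beta>" by (simp add: Qroot_def)
qed

lemma Qroot_max:
  assumes "0 \<le> \<alpha>" "0 \<le> \<beta>" "0 \<le> s" "s \<le> 1"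
  shows "(1 - s\<^sup>2) * \<alpha> + 2 * s * \<beta> \<le> Qroot \<alpha> \<beta>"
proof (cases "\<beta> \<le> \<alpha>")
  case True
  show ?thesis
  proof (cases "\<alpha> = 0")
    case True
    with \<open>\<beta> \<le> \<alpha>\<close> assms show ?thesis by (simp add: Qroot_def)
  next
    case False
    hence \<alpha>: "\<alpha> > 0" using assms by simp
    \<comment> \<open>Completing the square around the maximizer
      \<open>\<beta> / \<alpha>\<close>.\<close>
    have "0 \<le> \<alpha> * (s - \<beta> / \<alpha>)\<^sup>2" using \<alpha> by simp
    thus ?thesis using True \<alpha> by (simp add: Qroot_def Qslope_def field_simps power2_eq_square)
  qed
next
  case False
  \<comment> \<open>For \<open>\<beta> > \<alpha>\<close> the maximum sits at \<open>s = 1\<close>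
    with value \<open>2 * \<beta>\<close>; this product is the gap between that value and the
    expression at \<open>s\<close>.\<close>
  have "0 \<le> (1 - s) * (2 * \<beta> - (1 + s) * \<alpha>)"
  proof (rule mult_nonneg_nonneg)
    have "(1 + s) * \<alpha> \<le> 2 * \<alpha>" using assms by (intro mult_right_mono) auto
    thus "0 \<le> 2 * \<beta> - (1 + s) * \<alpha>" using False by simp
  qed (use assms in simp)
  thus ?thesis using False by (simp add: Qroot_def Qslope_def algebra_simps power2_eq_square)
qed

text \<open>The derivative of the square of \<open>Qroot\<close> with the maximizing slope held
  fixed, as in the envelope theorem. At a zero argument the division yields the zero vector, which
  is still a subgradient because the corresponding term is nonnegative.\<close>

definition Qgrad1 :: "real^3 \<Rightarrow> real^3 \<Rightarrow> real^3" where
  "Qgrad1 p q = (2 * Qroot (norm p) (norm q) * (1 - (Qslope (norm p) (norm q))\<^sup>2) / norm p) *\<^sub>R p"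

definition Qgrad2 :: "real^3 \<Rightarrow> real^3 \<Rightarrow> real^3" where
  "Qgrad2 p q = (4 * Qroot (norm p) (norm q) * Qslope (norm p) (norm q) / norm q) *\<^sub>R q"

text \<open>The slope \<open>s\<close> that is optimal at \<open>(p, q)\<close> is merely a
  competitor at \<open>(p', q')\<close>. Cauchy-Schwarz and \<open>Qroot_max\<close> bound the
  linearized expression there by \<open>G\<close>, while at \<open>(p, q)\<close> it equals
  \<open>g\<close>; \<open>2 * g * G \<le> g\<^sup>2 + G\<^sup>2\<close> passes from the roots to
  \<open>Qbar\<close>.\<close>

lemma Qbar_subgradient:
  "Qbar (norm p) (norm q) + Qgrad1 p q \<bullet> (p' - p) + Qgrad2 p q \<bullet> (q' - q) \<le> Qbar (norm p') (norm q')"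
proof -
  define s g G where "s = Qslope (norm p) (norm q)" and "g = Qroot (norm p) (norm q)"
    and "G = Qroot (norm p') (norm q')"
  have s: "0 \<le> s" "s \<le> 1" using Qslope_bounds[of "norm p" "norm q"] by (auto simp: s_def)
  have s2: "0 \<le> 1 - s\<^sup>2" using s by (simp add: power_le_one)
  have g: "0 \<le> g" "Qbar (norm p) (norm q) = g\<^sup>2" "g = (1 - s\<^sup>2) * norm p + 2 * s * norm q"
    using Qbar_Qroot[of "norm p" "norm q"] by (auto simp: g_def s_def Qroot_def)
  have G: "Qbar (norm p') (norm q') = G\<^sup>2" using Qbar_Qroot[of "norm p'" "norm q'"] by (auto simp: G_def)
  have proj: "v \<bullet> v' / norm v \<le> norm v'" for v v' :: "real^3"
    using norm_cauchy_schwarz[of v v'] by (cases "v = 0") (auto simp: field_simps)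
  have self: "v \<bullet> v / norm v = norm v" for v :: "real^3"
    by (simp add: power2_norm_eq_inner[symmetric] power2_eq_square)
  have "(1 - s\<^sup>2) * (p \<bullet> p' / norm p) + 2 * s * (q \<bullet> q' / norm q) \<le> (1 - s\<^sup>2) * norm p' + 2 * s * norm q'"
    using s s2 proj by (intro add_mono mult_left_mono) auto
  also have "\<dots> \<le> G" unfolding G_def using s by (intro Qroot_max) auto
  finally have "2 * g * ((1 - s\<^sup>2) * (p \<bullet> p' / norm p) + 2 * s * (q \<bullet> q' / norm q)) \<le> 2 * g * G"
    using g by (intro mult_left_mono) auto
  moreover have "2 * g * G \<le> g\<^sup>2 + G\<^sup>2"
    using zero_le_power2[of "g - G"] by (simp add: power2_diff)
  moreover have "Qgrad1 p q \<bullet> p' = 2 * g * ((1 - s\<^sup>2) * (p \<bullet> p' / norm p))"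
    "Qgrad2 p q \<bullet> q' = 2 * g * (2 * s * (q \<bullet> q' / norm q))"
    by (simp_all add: Qgrad1_def Qgrad2_def g_def s_def)
  moreover have "Qgrad1 p q \<bullet> p = 2 * g * ((1 - s\<^sup>2) * norm p)" "Qgrad2 p q \<bullet> q = 2 * g * (2 * s * norm q)"
    using self[of p] self[of q]
    by (simp_all add: Qgrad1_def Qgrad2_def g_def s_def times_divide_eq_right[symmetric] del: times_divide_eq_right)
  moreover have "2 * g * ((1 - s\<^sup>2) * norm p) + 2 * g * (2 * s * norm q) = 2 * g\<^sup>2"
  proof -
    have "2 * g * ((1 - s\<^sup>2) * norm p) + 2 * g * (2 * s * norm q) = 2 * g * ((1 - s\<^sup>2) * norm p + 2 * s * norm q)"
      by (simp add: distrib_left)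
    also have "(1 - s\<^sup>2) * norm p + 2 * s * norm q = g" by (rule g(3)[symmetric])
    finally show ?thesis by (simp add: power2_eq_square)
  qed
  ultimately show ?thesis unfolding g(2) G by (simp add: inner_diff_right distrib_left)
qed

text \<open>Linear growth makes the subgradient of a square integrable pair square integrable, hence
  a legitimate test function for weak convergence.\<close>

lemma Qgrad_norm:
  "norm (Qgrad1 p q) \<le> 4 * (norm p + norm q)" "norm (Qgrad2 p q) \<le> 8 * (norm p + norm q)"
proof -
  define s g where "s = Qslope (norm p) (norm q)" and "g = Qroot (norm p) (norm q)"
  have s: "0 \<le> s" "s \<le> 1" using Qslope_bounds[of "norm p" "norm q"] by (auto simp: s_def)
  have s2: "0 \<le> 1 - s\<^sup>2" "1 - s\<^sup>2 \<le> 1" using s by (auto simp: power_le_one)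
  have g: "0 \<le> g" "g \<le> norm p + 2 * norm q"
    using Qbar_Qroot[of "norm p" "norm q"] by (auto simp: g_def)
  have "norm (Qgrad1 p q) \<le> 2 * g * (1 - s\<^sup>2)"
    using g s2 by (cases "p = 0") (auto simp: Qgrad1_def g_def[symmetric] s_def[symmetric] abs_mult)
  also have "\<dots> \<le> 2 * g * 1" using g s2 by (intro mult_left_mono) auto
  also have "\<dots> \<le> 2 * (norm p + 2 * norm q)" using g by simp
  also have "\<dots> \<le> 4 * (norm p + norm q)" by simp
  finally show "norm (Qgrad1 p q) \<le> 4 * (norm p + norm q)" .
  have "norm (Qgrad2 p q) \<le> 4 * g * s"
    using g s by (cases "q = 0") (auto simp: Qgrad2_def g_def[symmetric] s_def[symmetric] abs_mult)
  also have "\<dots> \<le> 4 * g * 1" using g s by (intro mult_left_mono) auto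
  also have "\<dots> \<le> 4 * (norm p + 2 * norm q)" using g by simp
  also have "\<dots> \<le> 8 * (norm p + norm q)" by simp
  finally show "norm (Qgrad2 p q) \<le> 8 * (norm p + norm q)" .
qed

lemma Qgrad_measurable:
  assumes [measurable]: "p \<in> borel_measurable M" "q \<in> borel_measurable M"
  shows "(\<lambda>x. Qgrad1 (p x) (q x)) \<in> borel_measurable M" "(\<lambda>x. Qgrad2 (p x) (q x)) \<in> borel_measurable M"
proof -
  have s [measurable]: "(\<lambda>x. Qslope (norm (p x)) (norm (q x))) \<in> borel_measurable M"
    unfolding Qslope_def by measurable
  have g [measurable]: "(\<lambda>x. Qroot (norm (p x)) (norm (q x))) \<in> borel_measurable M"
    unfolding Qroot_def by measurable
  show "(\<lambda>x. Qgrad1 (p x) (q x)) \<in> borel_measurable M" "(\<lambda>x. Qgrad2 (p x) (q x)) \<in> borel_measurable M"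
    unfolding Qgrad1_def Qgrad2_def by measurable
qed

lemma sq_int_Qgrad:
  assumes p: "sq_int M p" and q: "sq_int M q"
  shows "sq_int M (\<lambda>x. Qgrad1 (p x) (q x))" "sq_int M (\<lambda>x. Qgrad2 (p x) (q x))"
proof -
  have m: "p \<in> borel_measurable M" "q \<in> borel_measurable M" using p q by (auto simp: sq_int_def)
  have "sq_int M (\<lambda>x. 8 *\<^sub>R (norm (p x) + norm (q x)))"
    by (intro sq_int_scaleR sq_int_add sq_int_norm p q)
  hence i: "integrable M (\<lambda>x. (norm (8 *\<^sub>R (norm (p x) + norm (q x))))\<^sup>2)" by (rule sq_intD)
  show "sq_int M (\<lambda>x. Qgrad1 (p x) (q x))"
    by (rule sq_int_bound[OF Qgrad_measurable(1)[OF m] i], intro AE_I2 power_mono order_trans[OF Qgrad_norm(1)]) auto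
  show "sq_int M (\<lambda>x. Qgrad2 (p x) (q x))"
    by (rule sq_int_bound[OF Qgrad_measurable(2)[OF m] i], intro AE_I2 power_mono order_trans[OF Qgrad_norm(2)]) auto
qed

lemma integrable_Qbar:
  assumes p: "sq_int M p" and q: "sq_int M q"
  shows "integrable M (\<lambda>x. Qbar (norm (p x)) (norm (q x)))"
proof -
  have m [measurable]: "p \<in> borel_measurable M" "q \<in> borel_measurable M" using p q by (auto simp: sq_int_def)
  have g [measurable]: "(\<lambda>x. Qroot (norm (p x)) (norm (q x))) \<in> borel_measurable M"
    unfolding Qroot_def Qslope_def by measurable
  have s: "sq_int M (\<lambda>x. norm (p x) + 2 *\<^sub>R norm (q x))"
    by (intro sq_int_scaleR sq_int_add sq_int_norm p q)
  have "sq_int M (\<lambda>x. Qroot (norm (p x)) (norm (q x)))"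
    by (rule sq_int_bound[OF g sq_intD[OF s]], intro AE_I2 power_mono)
       (use Qbar_Qroot(2,3)[of "norm (p _)" "norm (q _)"] in auto)
  from sq_intD[OF this] show ?thesis using Qbar_Qroot(1) by simp
qed

text \<open>The determinant is the squared length of the cross product, which Lagrange's identity
  makes \<open>1\<close> for orthonormal \<open>u\<close> and \<open>v\<close>; the orientation is
  therefore automatic.\<close>

lemma rotation_matrix_cross3:
  "rotation_matrix (column_matrix u v (cross3 u v)) \<longleftrightarrow> norm u = 1 \<and> norm v = 1 \<and> u \<bullet> v = 0"
proof -
  let ?w = "cross3 u v"
  have cols: "column 1 (column_matrix u v ?w) = u" "column 2 (column_matrix u v ?w) = v"
    "column 3 (column_matrix u v ?w) = ?w"
    by (simp_all add: column_def column_matrix_def transpose_def vec_eq_iff)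
  have orth: "orthogonal_matrix (column_matrix u v ?w) \<longleftrightarrow>
      norm u = 1 \<and> norm v = 1 \<and> norm ?w = 1 \<and> u \<bullet> v = 0"
    unfolding orthogonal_matrix_orthonormal_columns
    by (auto simp: forall_3 cols orthogonal_def inner_commute dot_cross_self)
  have nc: "(norm ?w)\<^sup>2 = (norm u)\<^sup>2 * (norm v)\<^sup>2 - (u \<bullet> v)\<^sup>2"
    using norm_cross[of u v] .
  have nw: "norm ?w = 1" if "norm u = 1" "norm v = 1" "u \<bullet> v = 0"
    using nc that by (simp add: power2_eq_1_iff) (metis norm_ge_zero not_one_le_zero neg_0_le_iff_le)
  have det: "det (column_matrix u v ?w) = (norm ?w)\<^sup>2"
  proof -
    have "det (column_matrix u v ?w) = det (vector [u, v, ?w] :: real^3^3)"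
      by (simp add: column_matrix_def det_transpose)
    also have "\<dots> = u \<bullet> cross3 v ?w" by (simp add: dot_cross_det)
    also have "\<dots> = ?w \<bullet> ?w" using cross_triple[of u v ?w] by (simp add: inner_commute)
    finally show ?thesis by (simp add: power2_norm_eq_inner)
  qed
  show ?thesis unfolding rotation_matrix_def orth det using nw by auto
qed

text \<open>Both \<open>y'\<close> and \<open>b\<close> are continuous, so the constraint holds at
  every point of \<open>[0,L]\<close>, in particular at the nodes, where discrete admissibility asks
  for it.\<close>

lemma A_frame_iff:
  assumes L: "L > 0"
  shows "(y, b) \<in> A_frame L Lbc lbc \<longleftrightarrow> (y, b) \<in> V_space L \<and>
    (\<forall>x\<in>{0..L}. norm (D L y x) = 1 \<and> norm (b x) = 1 \<and> D L y x \<bullet> b x = 0) \<and> Lbc (y, b) = lbc"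
proof (cases "(y, b) \<in> V_space L")
  case True
  note U = V_spaceD[OF True L]
  have c: "continuous_on {0..L} (D L y)" "continuous_on {0..L} b"
    using primitive_of_continuous U by auto
  have "(AE x in lborel. x \<in> {0<..<L} \<longrightarrow>
        rotation_matrix (column_matrix (D L y x) (b x) (cross3 (D L y x) (b x)))) \<longleftrightarrow>
      (\<forall>x\<in>{0..L}. norm (D L y x) = 1 \<and> norm (b x) = 1 \<and> D L y x \<bullet> b x = 0)" (is "?A \<longleftrightarrow> ?B")
  proof
    assume ?A
    hence ae: "AE x in intv L. norm (D L y x) = 1 \<and> norm (b x) = 1 \<and> D L y x \<bullet> b x = 0"
      unfolding AE_intv[symmetric] rotation_matrix_cross3 .
    show ?B
    proof (intro ballI conjI)
      fix x assume x: "x \<in> {0..L}"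
      show "norm (D L y x) = 1"
        by (rule continuous_AE_eq[where L = L and h = "\<lambda>x. norm (D L y x)" and k = "\<lambda>_. 1"])
           (use ae L x c in \<open>auto intro!: continuous_intros\<close>)
      show "norm (b x) = 1"
        by (rule continuous_AE_eq[where L = L and h = "\<lambda>x. norm (b x)" and k = "\<lambda>_. 1"])
           (use ae L x c in \<open>auto intro!: continuous_intros\<close>)
      show "D L y x \<bullet> b x = 0"
        by (rule continuous_AE_eq[where L = L and h = "\<lambda>x. D L y x \<bullet> b x" and k = "\<lambda>_. 0"])
           (use ae L x c in \<open>auto intro!: continuous_intros\<close>)
    qed
  next
    assume ?B
    thus ?A unfolding rotation_matrix_cross3 by (intro AE_I2) auto
  qed
  thus ?thesis using True by (auto simp: A_frame_def)
qed (simp add: A_frame_def)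

lemma C1_primitive:
  fixes f :: "real \<Rightarrow> 'b::euclidean_space"
  assumes d: "\<And>x. x \<in> {0..L} \<Longrightarrow> (f has_vector_derivative f' x) (at x within {0..L})"
    and c: "continuous_on {0..L} f'"
  shows "primitive_of L f f'"
  unfolding primitive_of_def
proof (intro conjI ballI)
  show "integrable (intv L) f'" by (rule continuous_integrable_intv[OF c])
  fix x assume x: "x \<in> {0..L}"
  have "seg L f' 0 x = (LINT t:{0..x}|lborel. f' t)"
    by (rule seg_eq_lborel[OF continuous_measurable_intv[OF c]]) (use x in auto)
  also have "\<dots> = f x - f 0"
    unfolding set_lebesgue_integral_def
  proof (rule integral_FTC_Icc)
    fix t assume "0 \<le> t" "t \<le> x"
    thus "(f has_vector_derivative f' t) (at t within {0..x})"
      using x by (intro has_vector_derivative_within_subset[OF d]) auto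
  qed (use x in \<open>auto intro: continuous_on_subset[OF c]\<close>)
  finally show "f x = f 0 + seg L f' 0 x" by simp
qed

lemma l2n_scaleR_vector: "l2n M (\<lambda>x. \<phi> x *\<^sub>R v) = l2n M (\<phi> :: _ \<Rightarrow> real) * norm v"
  by (simp add: l2n_def power_mult_distrib real_sqrt_mult)

text \<open>Transfers smallness of boundary data to the norms of the polynomials that interpolate
  them.\<close>

lemma l2n_cubic_tendsto_0:
  fixes a c P Q :: "nat \<Rightarrow> real^3"
  assumes lim: "a \<longlonglongrightarrow> 0" "c \<longlonglongrightarrow> 0" "P \<longlonglongrightarrow> 0" "Q \<longlonglongrightarrow> 0"
  shows "(\<lambda>n. l2n (intv L) (\<lambda>x. a n + x *\<^sub>R c n + x\<^sup>2 *\<^sub>R P n + x^3 *\<^sub>R Q n)) \<longlonglongrightarrow> 0"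
proof (rule tendsto_sandwich[OF _ _ tendsto_const])
  let ?m = "\<lambda>k. l2n (intv L) (\<lambda>x::real. x ^ k)"
  have s: "sq_int (intv L) (\<lambda>x. x ^ k *\<^sub>R v)" for k and v :: "real^3"
    by (intro continuous_sq_int_intv continuous_intros)
  have "l2n (intv L) (\<lambda>x. x^0 *\<^sub>R a n + x^1 *\<^sub>R c n + x^2 *\<^sub>R P n + x^3 *\<^sub>R Q n) \<le>
      ?m 0 * norm (a n) + ?m 1 * norm (c n) + ?m 2 * norm (P n) + ?m 3 * norm (Q n)" for n
    unfolding l2n_scaleR_vector[symmetric]
    by (intro order_trans[OF l2n_triangle] add_mono order_refl sq_int_add s)
  thus "\<forall>\<^sub>F n in sequentially. l2n (intv L) (\<lambda>x. a n + x *\<^sub>R c n + x\<^sup>2 *\<^sub>R P n + x^3 *\<^sub>R Q n) \<le>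
      ?m 0 * norm (a n) + ?m 1 * norm (c n) + ?m 2 * norm (P n) + ?m 3 * norm (Q n)"
    by simp
  show "(\<lambda>n. ?m 0 * norm (a n) + ?m 1 * norm (c n) + ?m 2 * norm (P n) + ?m 3 * norm (Q n)) \<longlonglongrightarrow> 0"
    using lim by (auto intro!: tendsto_eq_intros)
qed auto

text \<open>The boundary values of \<open>U n\<close> minus those of \<open>u\<close> tend to zero.
  Polynomials with exactly these boundary values have small norm in \<open>V\<close>, so boundedness
  of \<open>Lbc\<close> makes its value on them small, and locality identifies it with
  \<open>lbc - Lbc u\<close>.\<close>

lemma boundary_operator_weak_limit:
  assumes w: "weakly_conv L U u" and L: "L > 0" and bo: "boundary_operator L Lbc"
    and eq: "\<And>n. Lbc (U n) = lbc"
  shows "Lbc u = lbc"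
proof -
  obtain y b where u: "u = (y, b)" by (cases u)
  have uV: "(y, b) \<in> V_space L" and UV: "\<And>n. (fst (U n), snd (U n)) \<in> V_space L"
    using w by (auto simp: weakly_conv_def u)
  obtain C where lin: "\<And>u v r s. u \<in> V_space L \<Longrightarrow> v \<in> V_space L \<Longrightarrow> Lbc (lin_comb r u s v) = r *\<^sub>R Lbc u + s *\<^sub>R Lbc v"
    and C: "\<And>u. u \<in> V_space L \<Longrightarrow> norm (Lbc u) \<le> C * V_norm L u"
    and bv: "\<And>u v. u \<in> V_space L \<Longrightarrow> v \<in> V_space L \<Longrightarrow> boundary_values L u = boundary_values L v \<Longrightarrow> Lbc u = Lbc v"
    using bo unfolding boundary_operator_def bounded_linear_on_V_def by blast
  define a0 a1 c0 c1 e0 e1 where "a0 n = fst (U n) 0 - y 0" and "a1 n = fst (U n) L - y L"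
    and "c0 n = D L (fst (U n)) 0 - D L y 0" and "c1 n = D L (fst (U n)) L - D L y L"
    and "e0 n = snd (U n) 0 - b 0" and "e1 n = snd (U n) L - b L" for n
  have "0 \<in> {0..L}" "L \<in> {0..L}" using L by auto
  from weakly_conv_pointwise[OF w L this(1)] weakly_conv_pointwise[OF w L this(2)]
  have lim: "a0 \<longlonglongrightarrow> 0" "a1 \<longlonglongrightarrow> 0" "c0 \<longlonglongrightarrow> 0" "c1 \<longlonglongrightarrow> 0" "e0 \<longlonglongrightarrow> 0" "e1 \<longlonglongrightarrow> 0"
    by (simp_all add: a0_def[abs_def] a1_def[abs_def] c0_def[abs_def] c1_def[abs_def] e0_def[abs_def]
        e1_def[abs_def] u LIM_zero_iff)
  define r0 r1 where "r0 n = a1 n - a0 n - L *\<^sub>R c0 n" and "r1 n = c1 n - c0 n" for n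
  \<comment> \<open>Solutions of the Hermite conditions at \<open>L\<close>, namely
    \<open>L\<^sup>2 P + L^3 Q = r0\<close> and \<open>2 L P + 3 L\<^sup>2 Q = r1\<close>, where
    \<open>r0\<close> and \<open>r1\<close> are the data left over by the affine part.
    \<open>G\<close> is the slope of the linear function for \<open>b\<close>.\<close>
  define P Q G where "P n = (3 / L\<^sup>2) *\<^sub>R r0 n - (1 / L) *\<^sub>R r1 n" and "Q n = (1 / L\<^sup>2) *\<^sub>R r1 n - (2 / L^3) *\<^sub>R r0 n"
    and "G n = (1 / L) *\<^sub>R (e1 n - e0 n)" for n
  have limP: "P \<longlonglongrightarrow> 0" "Q \<longlonglongrightarrow> 0" "G \<longlonglongrightarrow> 0"
    unfolding P_def[abs_def] Q_def[abs_def] G_def[abs_def] r0_def r1_def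
    using lim by (auto intro!: tendsto_eq_intros)
  \<comment> \<open>The zero summands give all four functions the cubic shape of
    \<open>l2n_cubic_tendsto_0\<close>.\<close>
  define z z' z'' k where "z n x = a0 n + x *\<^sub>R c0 n + x\<^sup>2 *\<^sub>R P n + x^3 *\<^sub>R Q n"
    and "z' n x = c0 n + x *\<^sub>R (2 *\<^sub>R P n) + x\<^sup>2 *\<^sub>R (3 *\<^sub>R Q n) + x^3 *\<^sub>R 0"
    and "z'' n x = 2 *\<^sub>R P n + x *\<^sub>R (6 *\<^sub>R Q n) + x\<^sup>2 *\<^sub>R 0 + x^3 *\<^sub>R 0"
    and "k n x = e0 n + x *\<^sub>R G n + x\<^sup>2 *\<^sub>R 0 + x^3 *\<^sub>R 0" for n and x :: real
  have prim: "primitive_of L (z n) (z' n)" "primitive_of L (z' n) (z'' n)" "primitive_of L (k n) (\<lambda>_. G n)" for n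
  proof -
    show "primitive_of L (z n) (z' n)"
      unfolding z_def[abs_def] z'_def[abs_def]
      by (rule C1_primitive) (auto intro!: derivative_eq_intros continuous_intros simp: mult.commute)
    show "primitive_of L (z' n) (z'' n)"
      unfolding z'_def[abs_def] z''_def[abs_def]
      by (rule C1_primitive) (auto intro!: derivative_eq_intros continuous_intros simp: mult.commute)
    show "primitive_of L (k n) (\<lambda>_. G n)"
      unfolding k_def[abs_def]
      by (rule C1_primitive) (auto intro!: derivative_eq_intros continuous_intros)
  qed
  have sq: "sq_int (intv L) (z'' n)" "sq_int (intv L) (\<lambda>_. G n)" for n
    unfolding z''_def[abs_def] by (intro continuous_sq_int_intv continuous_intros)+
  have WV: "(z n, k n) \<in> V_space L" for n
    by (rule V_spaceI[OF prim(1) prim(2) sq(1) prim(3) sq(2) L])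
  have Dz: "D L (z n) x = z' n x" if "x \<in> {0..L}" for n x
    by (rule D_sobolev2(1)[OF prim(1) prim(2) L that])
  have Dzs: "l2n (intv L) (z' n) = l2n (intv L) (D L (z n))" "l2n (intv L) (z'' n) = l2n (intv L) (D L (D L (z n)))"
    "l2n (intv L) (\<lambda>_. G n) = l2n (intv L) (D L (k n))" for n
  proof -
    have m: "D L (z n) \<in> borel_measurable (intv L)" "z' n \<in> borel_measurable (intv L)"
      using D_measurable[OF prim(1) L] continuous_measurable_intv[OF primitive_of_continuous[OF prim(2)]] by auto
    show "l2n (intv L) (z' n) = l2n (intv L) (D L (z n))"
      using Dz[of _ n] m by (intro l2n_cong_AE AE_I2) auto
    show "l2n (intv L) (z'' n) = l2n (intv L) (D L (D L (z n)))"
      using D_sobolev2(2,3)[OF prim(1)[of n] prim(2)[of n] L] sq(1)[of n]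
      by (intro l2n_cong_AE) (auto simp: sq_int_def)
    show "l2n (intv L) (\<lambda>_. G n) = l2n (intv L) (D L (k n))"
      using D_eq_AE[OF prim(3)[of n] L] D_measurable[OF prim(3)[of n] L]
      by (intro l2n_cong_AE) auto
  qed
  have P2: "(\<lambda>n. 2 *\<^sub>R P n) \<longlonglongrightarrow> 0" "(\<lambda>n. 6 *\<^sub>R Q n) \<longlonglongrightarrow> 0" "(\<lambda>n. 3 *\<^sub>R Q n) \<longlonglongrightarrow> 0"
    using limP by (auto intro!: tendsto_eq_intros)
  have G0: "(\<lambda>n. l2n (intv L) (\<lambda>_. G n)) \<longlonglongrightarrow> 0"
    using l2n_cubic_tendsto_0[OF limP(3) tendsto_const tendsto_const tendsto_const, of L] by simp
  have "(\<lambda>n. V_norm L (z n, k n)) \<longlonglongrightarrow> sqrt (0\<^sup>2 + 0\<^sup>2 + 0\<^sup>2 + (0\<^sup>2 + 0\<^sup>2))"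
    unfolding V_norm_eq Dzs[symmetric]
    unfolding z_def[abs_def] z'_def[abs_def] z''_def[abs_def] k_def[abs_def]
    by (intro tendsto_intros l2n_cubic_tendsto_0 lim limP P2 G0)
  from tendsto_mult[OF tendsto_const this, of C]
  have V0: "(\<lambda>n. C * V_norm L (z n, k n)) \<longlonglongrightarrow> 0" by (simp del: V_norm.simps)
  have bd: "norm (lbc - Lbc u) \<le> C * V_norm L (z n, k n)" for n
  proof -
    let ?d = "lin_comb 1 (fst (U n), snd (U n)) (-1) (y, b)"
    note LC = V_lin_comb[OF UV[of n] uV L, where r = 1 and s = "-1"]
    have z: "z n 0 = a0 n" "z' n 0 = c0 n" "k n 0 = e0 n"
      by (simp_all add: z_def z'_def k_def)
    have zL: "z n L = a1 n" "z' n L = c1 n" "k n L = e1 n"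
    proof -
      have "L\<^sup>2 *\<^sub>R P n + L^3 *\<^sub>R Q n = r0 n" "L *\<^sub>R (2 *\<^sub>R P n) + L\<^sup>2 *\<^sub>R (3 *\<^sub>R Q n) = r1 n"
        unfolding P_def Q_def vec_eq_iff
        using L by (simp_all add: field_simps power2_eq_square power3_eq_cube)
      thus "z n L = a1 n" "z' n L = c1 n"
        by (simp_all add: z_def z'_def r0_def r1_def add.assoc) 
      show "k n L = e1 n" using L by (simp add: k_def G_def)
    qed
    \<comment> \<open>\<open>?d\<close> is the difference of the two pairs. It converges only
      weakly, but \<open>Lbc\<close> cannot distinguish it from the polynomial lifting, which
      converges strongly.\<close>
    have "boundary_values L (z n, k n) = boundary_values L ?d"
      unfolding lin_comb.simps boundary_values.simps
      using z zL LC(2)[of 0] LC(2)[of L] Dz[of 0 n] Dz[of L n] L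
      by (simp add: a0_def a1_def c0_def c1_def e0_def e1_def)
    hence "Lbc (z n, k n) = Lbc ?d" by (rule bv[OF WV LC(1)])
    also have "\<dots> = lbc - Lbc u" using lin[OF UV[of n] uV, of 1 "-1"] eq[of n] u by simp
    finally show ?thesis using C[OF WV[of n]] by simp
  qed
  have "norm (lbc - Lbc u) \<le> 0"
    by (rule LIMSEQ_le_const[OF V0]) (use bd in auto)
  thus ?thesis by simp
qed

section \<open>The discrete energy\<close>

lemma psi_measurable:
  assumes md: "continuous_on UNIV md" and a: "a \<in> borel_measurable M" and c: "c \<in> borel_measurable M"
  shows "(\<lambda>x. psi md (a x) (c x)) \<in> borel_measurable M"
proof -
  note [measurable] = a c borel_measurable_continuous_onI[OF md]
  show ?thesis unfolding psi_def by measurable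
qed

lemma integrable_psi:
  fixes a :: "'a \<Rightarrow> 'b::euclidean_space" and c :: "'a \<Rightarrow> 'c::euclidean_space"
  assumes M: "finite_measure M" and md: "continuous_on UNIV md" "\<And>x. 0 \<le> md x" "\<And>x. \<bar>md x - \<bar>x\<bar>\<bar> \<le> \<eta>"
    and a: "sq_int M a" and c: "sq_int M c"
  shows "integrable M (\<lambda>x. psi md ((norm (a x))\<^sup>2) ((norm (c x))\<^sup>2))"
proof (rule Bochner_Integration.integrable_bound)
  have "integrable M (\<lambda>x. \<eta>)" using finite_measure.integrable_const[OF M] by blast
  thus "integrable M (\<lambda>x. 5 * ((norm (a x))\<^sup>2 + (norm (c x))\<^sup>2) + 5 * \<eta>)"
    using sq_intD[OF a] sq_intD[OF c] by (intro Bochner_Integration.integrable_add integrable_mult_right) auto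
  have m: "(\<lambda>x. (norm (a x))\<^sup>2) \<in> borel_measurable M" "(\<lambda>x. (norm (c x))\<^sup>2) \<in> borel_measurable M"
    using sq_intD[OF a] sq_intD[OF c] by auto
  show "(\<lambda>x. psi md ((norm (a x))\<^sup>2) ((norm (c x))\<^sup>2)) \<in> borel_measurable M"
    by (rule psi_measurable[OF md(1) m])
  show "AE x in M. norm (psi md ((norm (a x))\<^sup>2) ((norm (c x))\<^sup>2)) \<le>
      norm (5 * ((norm (a x))\<^sup>2 + (norm (c x))\<^sup>2) + 5 * \<eta>)"
  proof (intro AE_I2)
    fix x
    define A B where "A = (norm (a x))\<^sup>2" and "B = (norm (c x))\<^sup>2"
    have AB: "0 \<le> A" "0 \<le> B" by (auto simp: A_def B_def)
    have "\<bar>psi md A B - psi abs A B\<bar> \<le> 5 * \<eta>" by (rule psi_md_diff) (use AB md in auto)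
    moreover have "0 \<le> psi md A B" by (rule psi_nonneg) (use AB md in auto)
    ultimately have "\<bar>psi md A B\<bar> \<le> 5 * (A + B) + 5 * \<eta>" using psi_abs_le[OF AB] by linarith
    thus "norm (psi md ((norm (a x))\<^sup>2) ((norm (c x))\<^sup>2)) \<le> norm (5 * ((norm (a x))\<^sup>2 + (norm (c x))\<^sup>2) + 5 * \<eta>)"
      unfolding A_def[symmetric] B_def[symmetric] by simp
  qed
qed

context mesh_on
begin

lemma sq_int_midavg: "sq_int (intv L) (midavg X r)"
  using sq_int_elementwise_const[of "\<lambda>j. (1 / 2) *\<^sub>R (r (X j) + r (X (Suc j)))"]
  by (simp add: midavg_def[abs_def] Let_def)

lemma midavg_norm_le:
  assumes "\<And>j. j \<le> N \<Longrightarrow> norm (r (X j)) \<le> B" "x \<in> {0<..<L}" shows "norm (midavg X r x) \<le> B"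
proof -
  have "elem X x < N" using elem_props assms(2) by auto
  hence "norm (r (X (elem X x)) + r (X (Suc (elem X x)))) \<le> B + B"
    by (intro norm_triangle_le add_mono assms(1)) auto
  thus ?thesis by (simp add: midavg_def Let_def)
qed

lemma sq_int_midavg_inner:
  assumes q: "sq_int (intv L) q" shows "sq_int (intv L) (\<lambda>x. midavg X r x \<bullet> q x)"
proof -
  obtain B where B: "\<And>x. x \<in> {0<..<L} \<Longrightarrow> norm (midavg X r x) \<le> B"
    using elementwise_const_bounded[of "\<lambda>j. (1 / 2) *\<^sub>R (r (X j) + r (X (Suc j)))"]
    by (auto simp: midavg_def[abs_def] Let_def)
  show ?thesis
  proof (rule sq_int_bound)
    show "(\<lambda>x. midavg X r x \<bullet> q x) \<in> borel_measurable (intv L)"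
      using sq_int_midavg q by (intro borel_measurable_inner) (auto simp: sq_int_def)
    show "integrable (intv L) (\<lambda>x. B\<^sup>2 * (norm (q x))\<^sup>2)" using sq_intD[OF q] by simp
    show "AE x in intv L. (norm (midavg X r x \<bullet> q x))\<^sup>2 \<le> B\<^sup>2 * (norm (q x))\<^sup>2"
    proof (intro AE_I2)
      fix x assume x: "x \<in> space (intv L)"
      have "\<bar>midavg X r x \<bullet> q x\<bar> \<le> norm (midavg X r x) * norm (q x)" by (rule Cauchy_Schwarz_ineq2)
      also have "\<dots> \<le> B * norm (q x)" using B x by (intro mult_right_mono) auto
      finally have "(norm (midavg X r x \<bullet> q x))\<^sup>2 \<le> (B * norm (q x))\<^sup>2" by (intro power_mono) auto
      thus "(norm (midavg X r x \<bullet> q x))\<^sup>2 \<le> B\<^sup>2 * (norm (q x))\<^sup>2" by (simp add: power_mult_distrib)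
    qed
  qed
qed

lemma nodal_interp_convex:
  assumes "x \<in> {0<..<L}"
  obtains t where "0 \<le> t" "t \<le> 1"
    "nodal_interp X r x = (1 - t) * r (X (elem X x)) + t * r (X (Suc (elem X x)))"
proof -
  let ?j = "elem X x"
  have p: "?j < N" "X ?j < x" "x \<le> X (Suc ?j)" using elem_props assms by auto
  show ?thesis
  proof (rule that[of "(x - X ?j) / (X (Suc ?j) - X ?j)"])
    show "nodal_interp X r x = (1 - (x - X ?j) / (X (Suc ?j) - X ?j)) * r (X ?j)
        + (x - X ?j) / (X (Suc ?j) - X ?j) * r (X (Suc ?j))"
    proof -
      have "a + t * (b - a) = (1 - t) * a + t * b" for a b t :: real by (simp add: algebra_simps)
      thus ?thesis by (simp only: nodal_interp_def Let_def)
    qed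
  qed (use p in auto)
qed

lemma nodal_interp_measurable: "nodal_interp X r \<in> borel_measurable (intv L)"
proof -
  define F where "F j x = r (X j) + (x - X j) / (X (Suc j) - X j) * (r (X (Suc j)) - r (X j))" for j x
  have "F j \<in> borel_measurable borel" for j
    unfolding F_def[abs_def]
    by (intro borel_measurable_add borel_measurable_times borel_measurable_divide borel_measurable_diff
        borel_measurable_const borel_measurable_continuous_onI[OF continuous_on_id])
  hence "F j \<in> borel_measurable (intv L)" for j
    by (rule measurable_intv_borel)
  hence "(\<lambda>x. F (elem X x) x) \<in> borel_measurable (intv L)"
    by (rule elementwise_measurable)
  thus ?thesis by (simp add: nodal_interp_def[abs_def] Let_def F_def)
qed

lemma nodal_interp_bounds:
  assumes "\<And>j. j \<le> N \<Longrightarrow> 0 \<le> r (X j) \<and> r (X j) \<le> B" "x \<in> {0<..<L}"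
  shows "0 \<le> nodal_interp X r x" "nodal_interp X r x \<le> B"
proof -
  let ?j = "elem X x"
  have j: "?j < N" using elem_props assms(2) by auto
  obtain t where t: "0 \<le> t" "t \<le> 1" "nodal_interp X r x = (1 - t) * r (X ?j) + t * r (X (Suc ?j))"
    using nodal_interp_convex[OF assms(2)] by blast
  have r: "0 \<le> r (X ?j)" "0 \<le> r (X (Suc ?j))" "r (X ?j) \<le> B" "r (X (Suc ?j)) \<le> B"
    using assms(1) j by auto
  show "0 \<le> nodal_interp X r x" unfolding t(3) using t r by simp
  have "(1 - t) * r (X ?j) + t * r (X (Suc ?j)) \<le> (1 - t) * B + t * B"
    using t r by (intro add_mono mult_left_mono) auto
  thus "nodal_interp X r x \<le> B" unfolding t(3) by (simp add: algebra_simps)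
qed

lemma E_quad_eq:
  assumes V: "(y, b) \<in> V_space L"
  shows "E_quad L Lbc lbc md e1 e2 N X (y, b) = (if (y, b) \<in> discrete_admissible L Lbc lbc N X
    then ereal (1 / 2 * (\<integral>x. (norm (D L (D L y) x))\<^sup>2 + 5 * (norm (D L b x))\<^sup>2
            + psi md ((norm (cav (D L (D L y)) x))\<^sup>2) ((norm (D L b x))\<^sup>2) \<partial>intv L)
        + 1 / (2 * e1) * (\<integral>x. nodal_interp X (\<lambda>t. (D L y t \<bullet> b t)\<^sup>2) x \<partial>intv L)
        + 1 / (2 * e2) * (\<integral>x. (midavg X (D L y) x \<bullet> D L b x)\<^sup>2 \<partial>intv L)) else \<infinity>)"
proof -
  have "D L (D L y) \<in> borel_measurable (intv L)" using V_spaceD(3)[OF V L_pos] by (simp add: sq_int_def)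
  from avg_eq_cav[OF this] have "(\<integral>x. (norm (D L (D L y) x))\<^sup>2 + 5 * (norm (D L b x))\<^sup>2
            + psi md ((norm (avg X (D L (D L y)) x))\<^sup>2) ((norm (D L b x))\<^sup>2) \<partial>intv L) =
     (\<integral>x. (norm (D L (D L y) x))\<^sup>2 + 5 * (norm (D L b x))\<^sup>2
            + psi md ((norm (cav (D L (D L y)) x))\<^sup>2) ((norm (D L b x))\<^sup>2) \<partial>intv L)"
    by (intro Bochner_Integration.integral_cong) auto
  thus ?thesis by (simp add: integral_intv)
qed

lemma midavg_tendsto_aux:
  assumes "x \<in> {0<..<L}"
  shows "X (elem X x) \<in> {0..L}" "X (Suc (elem X x)) \<in> {0..L}"
    "\<bar>X (elem X x) - x\<bar> \<le> h" "\<bar>X (Suc (elem X x)) - x\<bar> \<le> h" "elem X x < N"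
proof -
  have p: "elem X x < N" "X (elem X x) < x" "x \<le> X (Suc (elem X x))" using elem_props assms by auto
  thus "X (elem X x) \<in> {0..L}" "X (Suc (elem X x)) \<in> {0..L}" using X_in by auto
  show "\<bar>X (elem X x) - x\<bar> \<le> h" "\<bar>X (Suc (elem X x)) - x\<bar> \<le> h" "elem X x < N"
    using len_le_h[OF p(1)] p by auto
qed

end

text \<open>A common bound on the derivatives makes the sequence equi-Hoelder, so evaluation may be
  moved from \<open>x\<close> to a node at distance at most \<open>h n\<close> with error
  \<open>sqrt (h n) * K\<close>.\<close>

lemma primitive_node_tendsto:
  fixes f :: "nat \<Rightarrow> real \<Rightarrow> 'b::euclidean_space"
  assumes f: "\<And>n. primitive_of L (f n) (g n)" "\<And>n. sq_int (intv L) (g n)" "\<And>n. l2n (intv L) (g n) \<le> K"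
    and t: "\<And>n. t n \<in> {0..L}" "\<And>n. \<bar>t n - x\<bar> \<le> h n" "h \<longlonglongrightarrow> 0" and x: "x \<in> {0..L}"
    and lim: "(\<lambda>n. f n x) \<longlonglongrightarrow> l"
  shows "(\<lambda>n. f n (t n)) \<longlonglongrightarrow> l"
proof -
  have K: "K \<ge> 0" using f(3)[of 0] l2n_nonneg order_trans by blast
  have "(\<lambda>n. f n (t n) - f n x) \<longlonglongrightarrow> 0"
  proof (rule Lim_null_comparison)
    show "\<forall>\<^sub>F n in sequentially. norm (f n (t n) - f n x) \<le> sqrt (h n) * K"
    proof (intro always_eventually allI)
      fix n
      have "norm (f n (t n) - f n x) \<le> sqrt \<bar>t n - x\<bar> * l2n (intv L) (g n)"
        by (rule primitive_Hoelder[OF f(1,2) x t(1)])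
      also have "\<dots> \<le> sqrt (h n) * K"
        using t(2)[of n] f(3)[of n] order_trans[OF abs_ge_zero t(2)[of n]] by (intro mult_mono) auto
      finally show "norm (f n (t n) - f n x) \<le> sqrt (h n) * K" .
    qed
    show "(\<lambda>n. sqrt (h n) * K) \<longlonglongrightarrow> 0"
      using tendsto_mult[OF tendsto_real_sqrt[OF t(3)] tendsto_const[of K]] by simp
  qed
  from tendsto_add[OF this lim] show ?thesis by simp
qed

text \<open>The behaviour of \<open>\<epsilon>2\<close> is left open on purpose, since it tends to
  zero in one regime and is constant in the other.\<close>

locale discretization =
  fixes L :: real
    and Lbc :: "frame \<Rightarrow> 'w::real_normed_vector" and lbc :: 'w
    and m :: "real \<Rightarrow> real \<Rightarrow> real" and c0 c1 c2 cuni :: real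
    and N :: "nat \<Rightarrow> nat" and X :: "nat \<Rightarrow> nat \<Rightarrow> real"
    and \<delta> \<epsilon>1 \<epsilon>2 :: "nat \<Rightarrow> real"
  assumes L: "L > 0" and bc: "boundary_operator L Lbc" and modulus: "regularized_modulus c0 c1 c2 cuni m"
    and mesh: "\<And>n. mesh L (N n) (X n)" and h_lim: "(\<lambda>n. mesh_size (N n) (X n)) \<longlonglongrightarrow> 0"
    and \<delta>_pos: "\<And>n. \<delta> n > 0" and \<epsilon>1_pos: "\<And>n. \<epsilon>1 n > 0" and \<epsilon>2_pos: "\<And>n. \<epsilon>2 n > 0"
    and \<delta>_lim: "\<delta> \<longlonglongrightarrow> 0" and \<epsilon>1_lim: "\<epsilon>1 \<longlonglongrightarrow> 0"
begin

abbreviation Eh :: "nat \<Rightarrow> frame \<Rightarrow> ereal" where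
  "Eh n \<equiv> E_quad L Lbc lbc (m (\<delta> n)) (\<epsilon>1 n) (\<epsilon>2 n) (N n) (X n)"

abbreviation Ah :: "nat \<Rightarrow> frame set" where
  "Ah n \<equiv> discrete_admissible L Lbc lbc (N n) (X n)"

lemma mesh_on: "mesh_on L (N n) (X n)"
  using L mesh by unfold_locales

text \<open>Lets results for uniformly bounded energies be applied along a subsequence that nearly
  realizes a lower limit.\<close>

lemma discretization_subseq:
  assumes r: "strict_mono r"
  shows "discretization L Lbc m c0 c1 c2 cuni (N \<circ> r) (X \<circ> r) (\<delta> \<circ> r) (\<epsilon>1 \<circ> r) (\<epsilon>2 \<circ> r)"
  using L bc modulus mesh \<delta>_pos \<epsilon>1_pos \<epsilon>2_pos LIMSEQ_subseq_LIMSEQ[OF h_lim r]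
    LIMSEQ_subseq_LIMSEQ[OF \<delta>_lim r] LIMSEQ_subseq_LIMSEQ[OF \<epsilon>1_lim r]
  by unfold_locales (auto simp: o_def)

lemma modulus_props:
  shows "continuous_on UNIV (m (\<delta> n))" "0 \<le> m (\<delta> n) x" "\<bar>m (\<delta> n) x - \<bar>x\<bar>\<bar> \<le> cuni * \<delta> n"
proof -
  have *: "Ck_on UNIV 2 (m (\<delta> n))" "0 \<le> m (\<delta> n) x" "\<bar>m (\<delta> n) x - \<bar>x\<bar>\<bar> \<le> cuni * \<delta> n"
    using modulus \<delta>_pos[of n] by (auto simp: regularized_modulus_def)
  show "continuous_on UNIV (m (\<delta> n))"
    using Ck_on_SucD[OF Ck_on_SucD[OF *(1)[unfolded numeral_2_eq_2]]] by (simp only: Ck_on_0)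
  show "0 \<le> m (\<delta> n) x" "\<bar>m (\<delta> n) x - \<bar>x\<bar>\<bar> \<le> cuni * \<delta> n" using * by auto
qed

lemma integrable_psi_modulus:
  fixes a c :: "real \<Rightarrow> 'b::euclidean_space"
  assumes "sq_int (intv L) a" "sq_int (intv L) c"
  shows "integrable (intv L) (\<lambda>x. psi (m (\<delta> n)) ((norm (a x))\<^sup>2) ((norm (c x))\<^sup>2))"
  by (rule integrable_psi[OF finite_measure_intv modulus_props assms])

lemma psi_modulus_diff:
  assumes "0 \<le> A" "0 \<le> B"
  shows "\<bar>psi (m (\<delta> n)) A B - psi abs A B\<bar> \<le> 5 * (cuni * \<delta> n)" "0 \<le> psi (m (\<delta> n)) A B"
  using assms by (auto intro!: psi_md_diff psi_nonneg modulus_props)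

text \<open>Nonnegativity of \<open>psi\<close> gives the coercivity estimates. In the last bound,
  \<open>5 / 2 * L * (cuni * \<delta> n)\<close> is half the pointwise modulus error of
  \<open>psi_md_diff\<close>, integrated over the interval.\<close>

lemma bending_energy_lower_bound:
  fixes n :: nat and p q :: "real \<Rightarrow> real^3"
  assumes p: "sq_int (intv L) p" and q: "sq_int (intv L) q"
  defines "I \<equiv> 1 / 2 * (\<integral>x. (norm (p x))\<^sup>2 + 5 * (norm (q x))\<^sup>2
      + psi (m (\<delta> n)) ((norm (mesh_on.cav L (X n) p x))\<^sup>2) ((norm (q x))\<^sup>2) \<partial>intv L)"
  shows "(l2n (intv L) p)\<^sup>2 \<le> 2 * I" "(l2n (intv L) q)\<^sup>2 \<le> 2 * I"
    "(\<integral>x. Qbar (norm (mesh_on.cav L (X n) p x)) (norm (q x)) \<partial>intv L) \<le> I + 5 / 2 * L * (cuni * \<delta> n)"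
proof -
  interpret mesh_on L "N n" "X n" by (rule mesh_on)
  define \<psi> where "\<psi> x = psi (m (\<delta> n)) ((norm (cav p x))\<^sup>2) ((norm (q x))\<^sup>2)" for x
  have \<psi>: "integrable (intv L) \<psi>"
    unfolding \<psi>_def by (rule integrable_psi_modulus[OF sq_int_cav q])
  have \<psi>_nn: "0 \<le> \<psi> x" for x unfolding \<psi>_def by (rule psi_modulus_diff) auto
  have split: "2 * I = (l2n (intv L) p)\<^sup>2 + 5 * (l2n (intv L) q)\<^sup>2 + (\<integral>x. \<psi> x \<partial>intv L)"
    unfolding I_def l2n_power2 \<psi>_def[symmetric] using sq_intD[OF p] sq_intD[OF q] \<psi> by simp
  moreover have "0 \<le> (\<integral>x. \<psi> x \<partial>intv L)" using \<psi>_nn by simp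
  ultimately show "(l2n (intv L) p)\<^sup>2 \<le> 2 * I" "(l2n (intv L) q)\<^sup>2 \<le> 2 * I"
    using zero_le_power2[of "l2n (intv L) p"] zero_le_power2[of "l2n (intv L) q"] by linarith+
  define \<psi>0 where "\<psi>0 x = psi abs ((norm (cav p x))\<^sup>2) ((norm (q x))\<^sup>2)" for x
  have \<psi>0: "integrable (intv L) \<psi>0"
    unfolding \<psi>0_def by (rule integrable_psi[OF finite_measure_intv _ _ _ sq_int_cav q, where \<eta> = 0])
       (auto intro!: continuous_intros)
  have "(\<integral>x. \<psi>0 x \<partial>intv L) \<le> (\<integral>x. \<psi> x + 5 * (cuni * \<delta> n) \<partial>intv L)"
  proof (rule integral_mono[OF \<psi>0])
    show "integrable (intv L) (\<lambda>x. \<psi> x + 5 * (cuni * \<delta> n))" using \<psi> by simp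
    show "\<psi>0 x \<le> \<psi> x + 5 * (cuni * \<delta> n)" for x
      using psi_modulus_diff(1)[of "(norm (cav p x))\<^sup>2" "(norm (q x))\<^sup>2" n] unfolding \<psi>_def \<psi>0_def by simp
  qed
  also have "\<dots> = (\<integral>x. \<psi> x \<partial>intv L) + L * (5 * (cuni * \<delta> n))"
    using \<psi> L by (simp add: measure_intv)
  finally have d: "(\<integral>x. \<psi>0 x \<partial>intv L) \<le> (\<integral>x. \<psi> x \<partial>intv L) + L * (5 * (cuni * \<delta> n))" .
  have "2 * (\<integral>x. Qbar (norm (cav p x)) (norm (q x)) \<partial>intv L) =
      (\<integral>x. (norm (cav p x))\<^sup>2 + 5 * (norm (q x))\<^sup>2 + \<psi>0 x \<partial>intv L)"
    unfolding \<psi>0_def by (subst Qbar_eq_psi) simp_all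
  also have "\<dots> = (l2n (intv L) (cav p))\<^sup>2 + 5 * (l2n (intv L) q)\<^sup>2 + (\<integral>x. \<psi>0 x \<partial>intv L)"
    unfolding l2n_power2 using sq_intD[OF sq_int_cav[of p]] sq_intD[OF q] \<psi>0 by simp
  also have "\<dots> \<le> (l2n (intv L) p)\<^sup>2 + 5 * (l2n (intv L) q)\<^sup>2 + ((\<integral>x. \<psi> x \<partial>intv L) + L * (5 * (cuni * \<delta> n)))"
    using d l2n_cav_le[OF p] by (intro add_mono power_mono) auto
  also have "\<dots> = 2 * I + L * (5 * (cuni * \<delta> n))" using split by simp
  finally show "(\<integral>x. Qbar (norm (cav p x)) (norm (q x)) \<partial>intv L) \<le> I + 5 / 2 * L * (cuni * \<delta> n)" by simp
qed

end

section \<open>The lower bound\<close>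

context discretization
begin

text \<open>Stated for a uniform energy bound \<open>C\<close> instead of a lower limit; passage to
  subsequences supplies the general case. Both regimes of \<open>\<epsilon>2\<close> share the
  limits of the bending part and of the product in the second penalty.\<close>

proposition liminf_bound:
  assumes w: "weakly_conv L U u" and E: "\<And>n. Eh n (U n) \<le> ereal C"
  shows "u \<in> A_frame L Lbc lbc"
    "\<epsilon>2 \<longlonglongrightarrow> 0 \<Longrightarrow> u \<in> admissible L Lbc lbc \<and> E_constr L Lbc lbc u \<le> ereal C"
    "(\<And>n. \<epsilon>2 n = e2) \<Longrightarrow> E_pen L Lbc lbc e2 u \<le> ereal C"
proof -
  interpret fin: finite_measure "intv L" by (rule finite_measure_intv)
  obtain y b where u: "u = (y, b)" by (cases u)
  have uV: "(y, b) \<in> V_space L" and UV: "\<And>n. (fst (U n), snd (U n)) \<in> V_space L"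
    using w by (auto simp: weakly_conv_def u)
  note yb = V_spaceD[OF uV L] and YB = V_spaceD[OF UV L]
  define Y where "Y n = D L (fst (U n))" for n
  define p where "p n = D L (D L (fst (U n)))" for n
  define bn where "bn n = snd (U n)" for n
  define q where "q n = D L (snd (U n))" for n
  note defs = Y_def p_def bn_def q_def
  note YBd = YB(2,3,4,5)[folded defs]
  note pw = weakly_conv_pointwise(2,3)[OF w L, folded defs, unfolded u fst_conv snd_conv]
  note wk = weakly_conv_L2[OF w L, folded defs, unfolded u fst_conv snd_conv]
  have adm: "U n \<in> Ah n" for n
  proof (rule ccontr)
    assume "U n \<notin> Ah n"
    hence "Eh n (U n) = \<infinity>" by (cases "U n") simp
    with E[of n] show False by simp
  qed
  have nodes: "norm (Y n (X n j)) = 1" "norm (bn n (X n j)) = 1" if "j \<le> N n" for n j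
    using adm[of n] that unfolding discrete_admissible_def Y_def bn_def by (auto split: prod.splits)
  have bcU: "Lbc (U n) = lbc" for n
    using adm[of n] unfolding discrete_admissible_def by auto
  define cav where "cav n v = mesh_on.cav L (X n) v" for n and v :: "real \<Rightarrow> real^3"
  have sq_cav: "sq_int (intv L) (cav n v)" for n v
    unfolding cav_def by (rule mesh_on.sq_int_cav[OF mesh_on])
  define Q where "Q n = 1 / 2 * (\<integral>x. (norm (p n x))\<^sup>2 + 5 * (norm (q n x))\<^sup>2
      + psi (m (\<delta> n)) ((norm (cav n (p n) x))\<^sup>2) ((norm (q n x))\<^sup>2) \<partial>intv L)" for n
  define I where "I n = (\<integral>x. nodal_interp (X n) (\<lambda>t. (Y n t \<bullet> bn n t)\<^sup>2) x \<partial>intv L)" for n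
  define M where "M n = midavg (X n) (Y n)" for n
  define P where "P n = (\<integral>x. (M n x \<bullet> q n x)\<^sup>2 \<partial>intv L)" for n
  have Qb: "(l2n (intv L) (p n))\<^sup>2 \<le> 2 * Q n" "(l2n (intv L) (q n))\<^sup>2 \<le> 2 * Q n"
    "(\<integral>x. Qbar (norm (cav n (p n) x)) (norm (q n x)) \<partial>intv L) \<le> Q n + 5 / 2 * L * (cuni * \<delta> n)" for n
    unfolding Q_def cav_def using bending_energy_lower_bound[OF YBd(2)[of n] YBd(4)[of n]] by blast+
  have Q_nn: "0 \<le> Q n" for n using Qb(1)[of n] zero_le_power2[of "l2n (intv L) (p n)"] by linarith
  have dot_le: "(Y n (X n j) \<bullet> bn n (X n j))\<^sup>2 \<le> 1" if "j \<le> N n" for n j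
  proof -
    have "\<bar>Y n (X n j) \<bullet> bn n (X n j)\<bar> \<le> 1"
      using Cauchy_Schwarz_ineq2[of "Y n (X n j)" "bn n (X n j)"] nodes[OF that] by simp
    thus ?thesis by (simp add: abs_square_le_1)
  qed
  have interp: "0 \<le> nodal_interp (X n) (\<lambda>t. (Y n t \<bullet> bn n t)\<^sup>2) x"
    "nodal_interp (X n) (\<lambda>t. (Y n t \<bullet> bn n t)\<^sup>2) x \<le> 1" if "x \<in> {0<..<L}" for n x
    using mesh_on.nodal_interp_bounds[OF mesh_on[of n], of "\<lambda>t. (Y n t \<bullet> bn n t)\<^sup>2" 1 x] dot_le that by auto
  have I_nn: "0 \<le> I n" for n
    unfolding I_def by (intro integral_nonneg_AE AE_I2) (use interp in auto)
  have P_nn: "0 \<le> P n" for n unfolding P_def by simp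
  have energy: "Q n + 1 / (2 * \<epsilon>1 n) * I n + 1 / (2 * \<epsilon>2 n) * P n \<le> C" for n
    using E[of n] adm[of n] mesh_on.E_quad_eq[OF mesh_on[of n] UV[of n], of Lbc lbc "m (\<delta> n)" "\<epsilon>1 n" "\<epsilon>2 n"]
    unfolding Q_def I_def P_def M_def defs cav_def by simp
  have pen_nn: "0 \<le> 1 / (2 * \<epsilon>1 n) * I n" "0 \<le> 1 / (2 * \<epsilon>2 n) * P n" for n
    using I_nn[of n] P_nn[of n] \<epsilon>1_pos[of n] \<epsilon>2_pos[of n] by auto
  have QC: "Q n \<le> C" for n using energy[of n] pen_nn[of n] by linarith
  define K where "K = sqrt (2 * C)"
  have K: "l2n (intv L) (p n) \<le> K" "l2n (intv L) (q n) \<le> K" for n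
    unfolding K_def using Qb(1,2)[of n] QC[of n] by (auto intro!: real_le_rsqrt)

  \<comment> \<open>The energy bound makes \<open>y'\<close> and \<open>b\<close> equi-Hoelder, so
    their values at the two nodes next to \<open>x\<close> have the same limits as those at
    \<open>x\<close>; the nodal unit lengths are inherited.\<close>
  have node_lim: "(\<lambda>n. Y n (X n (elem (X n) x))) \<longlonglongrightarrow> D L y x" "(\<lambda>n. Y n (X n (Suc (elem (X n) x)))) \<longlonglongrightarrow> D L y x"
    "(\<lambda>n. bn n (X n (elem (X n) x))) \<longlonglongrightarrow> b x" "(\<lambda>n. bn n (X n (Suc (elem (X n) x)))) \<longlonglongrightarrow> b x"
    if x: "x \<in> {0<..<L}" for x
  proof -
    have x': "x \<in> {0..L}" using x by auto
    note aux = mesh_on.midavg_tendsto_aux[OF mesh_on x]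
    show "(\<lambda>n. Y n (X n (elem (X n) x))) \<longlonglongrightarrow> D L y x"
      by (rule primitive_node_tendsto[OF YBd(1,2) K(1) aux(1,3) h_lim x' pw(1)[OF x']])
    show "(\<lambda>n. Y n (X n (Suc (elem (X n) x)))) \<longlonglongrightarrow> D L y x"
      by (rule primitive_node_tendsto[OF YBd(1,2) K(1) aux(2,4) h_lim x' pw(1)[OF x']])
    show "(\<lambda>n. bn n (X n (elem (X n) x))) \<longlonglongrightarrow> b x"
      by (rule primitive_node_tendsto[OF YBd(3,4) K(2) aux(1,3) h_lim x' pw(2)[OF x']])
    show "(\<lambda>n. bn n (X n (Suc (elem (X n) x)))) \<longlonglongrightarrow> b x"
      by (rule primitive_node_tendsto[OF YBd(3,4) K(2) aux(2,4) h_lim x' pw(2)[OF x']])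
  qed
  have elem_le: "elem (X n) x \<le> N n" "Suc (elem (X n) x) \<le> N n" if "x \<in> {0<..<L}" for n x
    using mesh_on.midavg_tendsto_aux(5)[OF mesh_on[of n] that] by auto
  have unit: "norm (D L y x) = 1" "norm (b x) = 1" if x: "x \<in> {0<..<L}" for x
    using tendsto_norm[OF node_lim(1)[OF x]] tendsto_norm[OF node_lim(3)[OF x]] nodes elem_le(1)[OF x]
    by (auto simp: LIMSEQ_const_iff)

  \<comment> \<open>The interpolant at \<open>x\<close> is a convex combination of two nodal values
    with the same limit, whatever the weights do; the unit lengths bound it by
    \<open>1\<close>.\<close>
  have I_lim: "I \<longlonglongrightarrow> (\<integral>x. (D L y x \<bullet> b x)\<^sup>2 \<partial>intv L)"
    unfolding I_def[abs_def]
  proof (rule integral_dominated_convergence)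
    show "(\<lambda>x. (D L y x \<bullet> b x)\<^sup>2) \<in> borel_measurable (intv L)"
      by (intro continuous_measurable_intv continuous_intros primitive_of_continuous[OF yb(2)] primitive_of_continuous[OF yb(4)])
    show "nodal_interp (X n) (\<lambda>t. (Y n t \<bullet> bn n t)\<^sup>2) \<in> borel_measurable (intv L)" for n
      by (rule mesh_on.nodal_interp_measurable[OF mesh_on])
    show "integrable (intv L) (\<lambda>_. 1::real)" by simp
    show "AE x in intv L. norm (nodal_interp (X n) (\<lambda>t. (Y n t \<bullet> bn n t)\<^sup>2) x) \<le> 1" for n
      using interp by (intro AE_I2) auto
    show "AE x in intv L. (\<lambda>n. nodal_interp (X n) (\<lambda>t. (Y n t \<bullet> bn n t)\<^sup>2) x) \<longlonglongrightarrow> (D L y x \<bullet> b x)\<^sup>2"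
    proof (intro AE_I2)
      fix x assume "x \<in> space (intv L)"
      hence x: "x \<in> {0<..<L}" by simp
      define A B where "A n = (Y n (X n (elem (X n) x)) \<bullet> bn n (X n (elem (X n) x)))\<^sup>2"
        and "B n = (Y n (X n (Suc (elem (X n) x))) \<bullet> bn n (X n (Suc (elem (X n) x))))\<^sup>2" for n
      have AB: "A \<longlonglongrightarrow> (D L y x \<bullet> b x)\<^sup>2" "B \<longlonglongrightarrow> (D L y x \<bullet> b x)\<^sup>2"
        unfolding A_def[abs_def] B_def[abs_def]
        by (rule tendsto_power[OF tendsto_inner[OF node_lim(1)[OF x] node_lim(3)[OF x]]],
            rule tendsto_power[OF tendsto_inner[OF node_lim(2)[OF x] node_lim(4)[OF x]]])
      have "\<exists>t. 0 \<le> t \<and> t \<le> 1 \<and> nodal_interp (X n) (\<lambda>t. (Y n t \<bullet> bn n t)\<^sup>2) x = (1 - t) * A n + t * B n" for n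
        by (rule mesh_on.nodal_interp_convex[OF mesh_on[of n] x, of "\<lambda>t. (Y n t \<bullet> bn n t)\<^sup>2"],
            rule exI, intro conjI) (assumption, assumption, simp add: A_def B_def)
      then obtain t where t: "\<And>n. 0 \<le> t n" "\<And>n. t n \<le> 1"
        "\<And>n. nodal_interp (X n) (\<lambda>t. (Y n t \<bullet> bn n t)\<^sup>2) x = (1 - t n) * A n + t n * B n" by metis
      have "(\<lambda>n. A n + t n * (B n - A n)) \<longlonglongrightarrow> (D L y x \<bullet> b x)\<^sup>2 + 0"
      proof (intro tendsto_add AB)
        show "(\<lambda>n. t n * (B n - A n)) \<longlonglongrightarrow> 0"
        proof (rule Lim_null_comparison)
          show "\<forall>\<^sub>F n in sequentially. norm (t n * (B n - A n)) \<le> \<bar>B n - A n\<bar>"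
            using t by (intro always_eventually allI) (simp add: abs_mult mult_left_le_one_le)
          show "(\<lambda>n. \<bar>B n - A n\<bar>) \<longlonglongrightarrow> 0"
            using tendsto_rabs[OF tendsto_diff[OF AB(2) AB(1)]] by simp
        qed
      qed
      thus "(\<lambda>n. nodal_interp (X n) (\<lambda>t. (Y n t \<bullet> bn n t)\<^sup>2) x) \<longlonglongrightarrow> (D L y x \<bullet> b x)\<^sup>2"
        unfolding t(3) by (simp add: algebra_simps)
    qed
  qed
  have I_0: "I \<longlonglongrightarrow> 0"
  proof (rule tendsto_sandwich)
    show "\<forall>\<^sub>F n in sequentially. 0 \<le> I n" using I_nn by simp
    show "\<forall>\<^sub>F n in sequentially. I n \<le> 2 * \<epsilon>1 n * C"
    proof (intro always_eventually allI)
      fix n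
      have "1 / (2 * \<epsilon>1 n) * I n \<le> C" using energy[of n] pen_nn(2)[of n] Q_nn[of n] by linarith
      thus "I n \<le> 2 * \<epsilon>1 n * C" using \<epsilon>1_pos[of n] by (simp add: field_simps)
    qed
    show "(\<lambda>n. 2 * \<epsilon>1 n * C) \<longlonglongrightarrow> 0" using \<epsilon>1_lim by (auto intro!: tendsto_eq_intros)
  qed simp
  have "(\<integral>x. (D L y x \<bullet> b x)\<^sup>2 \<partial>intv L) = 0" by (rule LIMSEQ_unique[OF I_lim I_0])
  moreover have "integrable (intv L) (\<lambda>x. (D L y x \<bullet> b x)\<^sup>2)"
    by (intro continuous_integrable_intv continuous_intros primitive_of_continuous[OF yb(2)] primitive_of_continuous[OF yb(4)])
  ultimately have orth: "AE x in intv L. D L y x \<bullet> b x = 0"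
    by (subst (asm) integral_nonneg_eq_0_iff_AE) auto
  show frame: "u \<in> A_frame L Lbc lbc"
    unfolding A_frame_def u mem_Collect_eq prod.case AE_intv rotation_matrix_cross3
  proof (intro conjI uV)
    show "AE x in intv L. norm (D L y x) = 1 \<and> norm (b x) = 1 \<and> D L y x \<bullet> b x = 0"
      using orth AE_space by eventually_elim (use unit in auto)
    show "Lbc (y, b) = lbc"
      using boundary_operator_weak_limit[OF w L bc bcU] u by simp
  qed

  define pp qq where "pp = D L (D L y)" and "qq = D L b"
  note ppq = yb(3,5)[folded pp_def qq_def]
  \<comment> \<open>The subgradient at the limit pair. Being independent of \<open>n\<close>, it
    bounds the discrete energies from below by expressions linear in the discrete
    derivatives.\<close>
  define \<xi> \<eta> where "\<xi> x = Qgrad1 (pp x) (qq x)" and "\<eta> x = Qgrad2 (pp x) (qq x)" for x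
  have sq\<xi>: "sq_int (intv L) \<xi>" "sq_int (intv L) \<eta>"
    unfolding \<xi>_def[abs_def] \<eta>_def[abs_def] by (rule sq_int_Qgrad[OF ppq])+
  define J where "J = (\<integral>x. Qbar (norm (pp x)) (norm (qq x)) \<partial>intv L)"
  \<comment> \<open>All that separates the limit energy \<open>J\<close> from the discrete bending
    energy: the modulus error and the two linear discrepancies.\<close>
  define R where "R n = 5 / 2 * L * (cuni * \<delta> n)
      + ((\<integral>x. \<xi> x \<bullet> pp x \<partial>intv L) - (\<integral>x. \<xi> x \<bullet> cav n (p n) x \<partial>intv L))
      + ((\<integral>x. \<eta> x \<bullet> qq x \<partial>intv L) - (\<integral>x. \<eta> x \<bullet> q n x \<partial>intv L))" for n
  have JQ: "J \<le> Q n + R n" for n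
  proof -
    note i = sq_int_inner_integrable[OF sq\<xi>(1) ppq(1)] sq_int_inner_integrable[OF sq\<xi>(1) sq_cav[of n "p n"]]
      sq_int_inner_integrable[OF sq\<xi>(2) ppq(2)] sq_int_inner_integrable[OF sq\<xi>(2) YBd(4)[of n]]
      integrable_Qbar[OF ppq]
    have "J + ((\<integral>x. \<xi> x \<bullet> cav n (p n) x \<partial>intv L) - (\<integral>x. \<xi> x \<bullet> pp x \<partial>intv L))
        + ((\<integral>x. \<eta> x \<bullet> q n x \<partial>intv L) - (\<integral>x. \<eta> x \<bullet> qq x \<partial>intv L))
      = (\<integral>x. Qbar (norm (pp x)) (norm (qq x)) + (\<xi> x \<bullet> cav n (p n) x - \<xi> x \<bullet> pp x)
          + (\<eta> x \<bullet> q n x - \<eta> x \<bullet> qq x) \<partial>intv L)"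
      unfolding J_def using i by simp
    also have "\<dots> \<le> (\<integral>x. Qbar (norm (cav n (p n) x)) (norm (q n x)) \<partial>intv L)"
    proof (rule integral_mono)
      show "integrable (intv L) (\<lambda>x. Qbar (norm (pp x)) (norm (qq x)) + (\<xi> x \<bullet> cav n (p n) x - \<xi> x \<bullet> pp x)
          + (\<eta> x \<bullet> q n x - \<eta> x \<bullet> qq x))" using i by simp
      show "integrable (intv L) (\<lambda>x. Qbar (norm (cav n (p n) x)) (norm (q n x)))"
        by (rule integrable_Qbar[OF sq_cav YBd(4)])
      fix x
      show "Qbar (norm (pp x)) (norm (qq x)) + (\<xi> x \<bullet> cav n (p n) x - \<xi> x \<bullet> pp x)
          + (\<eta> x \<bullet> q n x - \<eta> x \<bullet> qq x) \<le> Qbar (norm (cav n (p n) x)) (norm (q n x))"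
        using Qbar_subgradient[of "pp x" "qq x" "cav n (p n) x" "q n x"]
        by (simp add: \<xi>_def \<eta>_def inner_diff_right)
    qed
    also have "\<dots> \<le> Q n + 5 / 2 * L * (cuni * \<delta> n)" by (rule Qb(3))
    finally show ?thesis unfolding R_def by linarith
  qed
  \<comment> \<open>Averages moved to \<open>\<xi>\<close> converge strongly and pair with the
    bounded sequence \<open>p n\<close>; what is left is the weak convergence of \<open>p n\<close>
    tested with \<open>\<xi>\<close>.\<close>
  have cav_lim: "(\<lambda>n. \<integral>x. \<xi> x \<bullet> cav n (p n) x \<partial>intv L) \<longlonglongrightarrow> (\<integral>x. \<xi> x \<bullet> pp x \<partial>intv L)"
  proof -
    have eq: "(\<integral>x. \<xi> x \<bullet> cav n (p n) x \<partial>intv L) =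
        (\<integral>x. (cav n \<xi> x - \<xi> x) \<bullet> p n x \<partial>intv L) + (\<integral>x. \<xi> x \<bullet> p n x \<partial>intv L)" for n
    proof -
      have "(\<integral>x. \<xi> x \<bullet> cav n (p n) x \<partial>intv L) = (\<integral>x. cav n \<xi> x \<bullet> p n x \<partial>intv L)"
        unfolding cav_def by (rule mesh_on.integral_cav_symmetric[OF mesh_on YBd(2) sq\<xi>(1), symmetric])
      thus ?thesis
        using sq_int_inner_integrable[OF sq_cav[of n \<xi>] YBd(2)[of n]] sq_int_inner_integrable[OF sq\<xi>(1) YBd(2)[of n]]
        by (simp add: inner_diff_left)
    qed
    have "(\<lambda>n. \<integral>x. (cav n \<xi> x - \<xi> x) \<bullet> p n x \<partial>intv L) \<longlonglongrightarrow> 0"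
    proof (rule Lim_null_comparison)
      show "\<forall>\<^sub>F n in sequentially. norm (\<integral>x. (cav n \<xi> x - \<xi> x) \<bullet> p n x \<partial>intv L)
          \<le> l2n (intv L) (\<lambda>x. cav n \<xi> x - \<xi> x) * K"
      proof (intro always_eventually allI)
        fix n
        have "\<bar>\<integral>x. (cav n \<xi> x - \<xi> x) \<bullet> p n x \<partial>intv L\<bar> \<le> l2n (intv L) (\<lambda>x. cav n \<xi> x - \<xi> x) * l2n (intv L) (p n)"
          by (intro integral_inner_le sq_int_diff sq_cav sq\<xi> YBd)
        also have "\<dots> \<le> l2n (intv L) (\<lambda>x. cav n \<xi> x - \<xi> x) * K"
          by (intro mult_left_mono K) simp
        finally show "norm (\<integral>x. (cav n \<xi> x - \<xi> x) \<bullet> p n x \<partial>intv L)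
          \<le> l2n (intv L) (\<lambda>x. cav n \<xi> x - \<xi> x) * K" by simp
      qed
      show "(\<lambda>n. l2n (intv L) (\<lambda>x. cav n \<xi> x - \<xi> x) * K) \<longlonglongrightarrow> 0"
        using tendsto_mult[OF cav_tendsto[OF mesh_on h_lim sq\<xi>(1)] tendsto_const[of K]] by (simp add: cav_def)
    qed
    from tendsto_add[OF this wk(1)[OF sq\<xi>(1), folded pp_def]] show ?thesis by (simp add: eq)
  qed
  have R_lim: "R \<longlonglongrightarrow> 0"
  proof -
    have "R \<longlonglongrightarrow> 5 / 2 * L * (cuni * 0)
        + ((\<integral>x. \<xi> x \<bullet> pp x \<partial>intv L) - (\<integral>x. \<xi> x \<bullet> pp x \<partial>intv L))
        + ((\<integral>x. \<eta> x \<bullet> qq x \<partial>intv L) - (\<integral>x. \<eta> x \<bullet> qq x \<partial>intv L))"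
      unfolding R_def[abs_def] by (intro tendsto_intros \<delta>_lim cav_lim wk(2)[OF sq\<xi>(2), folded qq_def])
    thus ?thesis by simp
  qed

  \<comment> \<open>The limit of the product in the second penalty, used as the test function for
    that product.\<close>
  define w' where "w' x = D L y x \<bullet> qq x" for x
  define W where "W = (\<integral>x. (w' x)\<^sup>2 \<partial>intv L)"
  obtain B where B: "B > 0" "\<And>x. x \<in> {0..L} \<Longrightarrow> norm (D L y x) \<le> B"
    using continuous_bounded_Icc[OF primitive_of_continuous[OF yb(2)]] by blast
  have Dy_meas: "D L y \<in> borel_measurable (intv L)"
    by (rule continuous_measurable_intv[OF primitive_of_continuous[OF yb(2)]])
  have sqw: "sq_int (intv L) w'"
  proof (rule sq_int_bound)
    show "w' \<in> borel_measurable (intv L)"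
      unfolding w'_def[abs_def] using Dy_meas ppq by (intro borel_measurable_inner) (auto simp: sq_int_def)
    show "integrable (intv L) (\<lambda>x. B\<^sup>2 * (norm (qq x))\<^sup>2)" using sq_intD[OF ppq(2)] by simp
    show "AE x in intv L. (norm (w' x))\<^sup>2 \<le> B\<^sup>2 * (norm (qq x))\<^sup>2"
    proof (intro AE_I2)
      fix x assume x: "x \<in> space (intv L)"
      have "\<bar>w' x\<bar> \<le> norm (D L y x) * norm (qq x)" unfolding w'_def by (rule Cauchy_Schwarz_ineq2)
      also have "\<dots> \<le> B * norm (qq x)" using B x by (intro mult_right_mono) auto
      finally have "(norm (w' x))\<^sup>2 \<le> (B * norm (qq x))\<^sup>2" by (intro power_mono) auto
      thus "(norm (w' x))\<^sup>2 \<le> B\<^sup>2 * (norm (qq x))\<^sup>2" by (simp add: power_mult_distrib)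
    qed
  qed
  have Mm: "M n \<in> borel_measurable (intv L)" for n
    using mesh_on.sq_int_midavg[OF mesh_on[of n], of "Y n"] by (simp add: M_def sq_int_def)
  have M_le: "norm (M n x) \<le> 1" if "x \<in> {0<..<L}" for n x
    unfolding M_def by (rule mesh_on.midavg_norm_le[OF mesh_on _ that]) (use nodes in auto)
  have M_lim: "(\<lambda>n. M n x) \<longlonglongrightarrow> D L y x" if x: "x \<in> {0<..<L}" for x
  proof -
    have "(\<lambda>n. (1/2) *\<^sub>R (Y n (X n (elem (X n) x)) + Y n (X n (Suc (elem (X n) x))))) \<longlonglongrightarrow> (1/2) *\<^sub>R (D L y x + D L y x)"
      by (rule tendsto_scaleR[OF tendsto_const tendsto_add[OF node_lim(1)[OF x] node_lim(2)[OF x]]])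
    thus ?thesis by (simp add: M_def midavg_def Let_def flip: scaleR_2)
  qed
  have fM: "sq_int (intv L) (\<lambda>x. M n x \<bullet> q n x)" for n
    unfolding M_def by (rule mesh_on.sq_int_midavg_inner[OF mesh_on YBd(4)])
  have wDy: "sq_int (intv L) (\<lambda>x. w' x *\<^sub>R D L y x)" and wM: "sq_int (intv L) (\<lambda>x. w' x *\<^sub>R (M n x - D L y x))" for n
  proof -
    have wm: "w' \<in> borel_measurable (intv L)" using sqw by (simp add: sq_int_def)
    show "sq_int (intv L) (\<lambda>x. w' x *\<^sub>R D L y x)"
    proof (rule sq_int_bound)
      show "integrable (intv L) (\<lambda>x. B\<^sup>2 * (norm (w' x))\<^sup>2)" using sq_intD[OF sqw] by simp
      show "AE x in intv L. (norm (w' x *\<^sub>R D L y x))\<^sup>2 \<le> B\<^sup>2 * (norm (w' x))\<^sup>2"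
        using B by (intro AE_I2) (auto simp: power_mult_distrib mult.commute[of "B\<^sup>2"] intro!: mult_left_mono power_mono)
    qed (use wm Dy_meas in simp)
    show "sq_int (intv L) (\<lambda>x. w' x *\<^sub>R (M n x - D L y x))"
    proof (rule sq_int_bound)
      show "integrable (intv L) (\<lambda>x. (1 + B)\<^sup>2 * (norm (w' x))\<^sup>2)" using sq_intD[OF sqw] by simp
      have "norm (M n x - D L y x) \<le> 1 + B" if "x \<in> {0<..<L}" for x
        using norm_triangle_ineq4[of "M n x" "D L y x"] M_le[OF that, of n] B(2)[of x] that by auto
      thus "AE x in intv L. (norm (w' x *\<^sub>R (M n x - D L y x)))\<^sup>2 \<le> (1 + B)\<^sup>2 * (norm (w' x))\<^sup>2"
        by (intro AE_I2) (auto simp: power_mult_distrib mult.commute[of "(1 + B)\<^sup>2"] intro!: mult_left_mono power_mono)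
    qed (use wm Dy_meas Mm[of n] in simp)
  qed
  define S where "S n = (\<integral>x. w' x * (M n x \<bullet> q n x) \<partial>intv L)" for n
  \<comment> \<open>Splitting off the midpoint error leaves a fixed test function times the weakly
    convergent \<open>q n\<close>. The error itself is null in \<open>L\<^sup>2\<close> by dominated
    convergence, as \<open>M n\<close> is bounded by \<open>1\<close> and converges
    pointwise.\<close>
  have S_lim: "S \<longlonglongrightarrow> W"
  proof -
    have eq: "S n = (\<integral>x. (w' x *\<^sub>R (M n x - D L y x)) \<bullet> q n x \<partial>intv L) + (\<integral>x. (w' x *\<^sub>R D L y x) \<bullet> q n x \<partial>intv L)" for n
    proof -
      have "S n = (\<integral>x. (w' x *\<^sub>R (M n x - D L y x)) \<bullet> q n x + (w' x *\<^sub>R D L y x) \<bullet> q n x \<partial>intv L)"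
        unfolding S_def by (simp add: inner_diff_left algebra_simps)
      also have "\<dots> = (\<integral>x. (w' x *\<^sub>R (M n x - D L y x)) \<bullet> q n x \<partial>intv L) + (\<integral>x. (w' x *\<^sub>R D L y x) \<bullet> q n x \<partial>intv L)"
        by (intro Bochner_Integration.integral_add sq_int_inner_integrable wM wDy YBd)
      finally show ?thesis .
    qed
    have l0: "(\<lambda>n. l2n (intv L) (\<lambda>x. w' x *\<^sub>R (M n x - D L y x))) \<longlonglongrightarrow> 0"
    proof (rule l2n_tendsto_0)
      show "(\<lambda>x. w' x *\<^sub>R (M n x - D L y x)) \<in> borel_measurable (intv L)" for n
        using wM[of n] by (simp add: sq_int_def)
      show "AE x in intv L. (\<lambda>n. w' x *\<^sub>R (M n x - D L y x)) \<longlonglongrightarrow> 0"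
      proof (intro AE_I2)
        fix x assume "x \<in> space (intv L)"
        hence "(\<lambda>n. M n x - D L y x) \<longlonglongrightarrow> 0" using M_lim[of x] LIM_zero by auto
        from tendsto_scaleR[OF tendsto_const this, of "w' x"]
        show "(\<lambda>n. w' x *\<^sub>R (M n x - D L y x)) \<longlonglongrightarrow> 0" by simp
      qed
      show "integrable (intv L) (\<lambda>x. (1 + B)\<^sup>2 * (norm (w' x))\<^sup>2)" using sq_intD[OF sqw] by simp
      have "norm (M n x - D L y x) \<le> 1 + B" if "x \<in> {0<..<L}" for n x
        using norm_triangle_ineq4[of "M n x" "D L y x"] M_le[OF that, of n] B(2)[of x] that by auto
      thus "AE x in intv L. (norm (w' x *\<^sub>R (M n x - D L y x)))\<^sup>2 \<le> (1 + B)\<^sup>2 * (norm (w' x))\<^sup>2" for n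
        by (intro AE_I2) (auto simp: power_mult_distrib mult.commute[of "(1 + B)\<^sup>2"] intro!: mult_left_mono power_mono)
    qed
    have "(\<lambda>n. \<integral>x. (w' x *\<^sub>R (M n x - D L y x)) \<bullet> q n x \<partial>intv L) \<longlonglongrightarrow> 0"
    proof (rule Lim_null_comparison)
      show "\<forall>\<^sub>F n in sequentially. norm (\<integral>x. (w' x *\<^sub>R (M n x - D L y x)) \<bullet> q n x \<partial>intv L)
          \<le> l2n (intv L) (\<lambda>x. w' x *\<^sub>R (M n x - D L y x)) * K"
      proof (intro always_eventually allI)
        fix n
        have "\<bar>\<integral>x. (w' x *\<^sub>R (M n x - D L y x)) \<bullet> q n x \<partial>intv L\<bar>
            \<le> l2n (intv L) (\<lambda>x. w' x *\<^sub>R (M n x - D L y x)) * l2n (intv L) (q n)"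
          by (rule integral_inner_le[OF wM YBd(4)])
        also have "\<dots> \<le> l2n (intv L) (\<lambda>x. w' x *\<^sub>R (M n x - D L y x)) * K"
          by (intro mult_left_mono K) simp
        finally show "norm (\<integral>x. (w' x *\<^sub>R (M n x - D L y x)) \<bullet> q n x \<partial>intv L)
          \<le> l2n (intv L) (\<lambda>x. w' x *\<^sub>R (M n x - D L y x)) * K" by simp
      qed
      show "(\<lambda>n. l2n (intv L) (\<lambda>x. w' x *\<^sub>R (M n x - D L y x)) * K) \<longlonglongrightarrow> 0"
        using tendsto_mult[OF l0 tendsto_const[of K]] by simp
    qed
    from tendsto_add[OF this wk(2)[OF wDy, folded qq_def]]
    show ?thesis unfolding eq W_def w'_def by (simp add: power2_eq_square)
  qed
  \<comment> \<open>Weak lower semicontinuity of the square, from expanding the squared difference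
    of \<open>w'\<close> and the discrete product.\<close>
  have PW: "W \<le> P n + 2 * (W - S n)" for n
  proof -
    have i: "integrable (intv L) (\<lambda>x. w' x * (M n x \<bullet> q n x))"
      using sq_int_inner_integrable[OF sqw fM[of n]] by simp
    have i2: "integrable (intv L) (\<lambda>x. (w' x)\<^sup>2)" "integrable (intv L) (\<lambda>x. (M n x \<bullet> q n x)\<^sup>2)"
      using sq_intD[OF sqw] sq_intD[OF fM[of n]] by simp_all
    have "2 * S n - W = (\<integral>x. 2 * (w' x * (M n x \<bullet> q n x)) - (w' x)\<^sup>2 \<partial>intv L)"
      unfolding S_def W_def using i i2 by simp
    also have "\<dots> \<le> P n" unfolding P_def
    proof (rule integral_mono)
      fix x
      show "2 * (w' x * (M n x \<bullet> q n x)) - (w' x)\<^sup>2 \<le> (M n x \<bullet> q n x)\<^sup>2"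
        using zero_le_power2[of "w' x - M n x \<bullet> q n x"] by (simp add: power2_diff)
    qed (use i i2 in auto)
    finally show ?thesis by (simp add: algebra_simps)
  qed
  have S0: "(\<lambda>n. 2 * (W - S n)) \<longlonglongrightarrow> 0"
    using tendsto_mult[OF tendsto_const[of 2] tendsto_diff[OF tendsto_const[of W] S_lim]] by simp
  have J_eq: "(LINT x:{0<..<L}|lborel. Qbar (norm (D L (D L y) x)) (norm (D L b x))) = J"
    unfolding integral_intv J_def pp_def qq_def ..
  have W_eq: "(LINT x:{0<..<L}|lborel. (D L y x \<bullet> D L b x)\<^sup>2) = W"
    unfolding integral_intv W_def w'_def qq_def ..

  {
    assume e2: "\<epsilon>2 \<longlonglongrightarrow> 0"
    have "J \<le> C"
    proof (rule LIMSEQ_le_const)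
      show "(\<lambda>n. C + R n) \<longlonglongrightarrow> C" using tendsto_add[OF tendsto_const[of C] R_lim] by simp
      show "\<exists>N. \<forall>n\<ge>N. J \<le> C + R n" using JQ QC by (meson add_le_cancel_right order_trans)
    qed
    \<comment> \<open>The penalty forces \<open>P n \<le> 2 * \<epsilon>2 n * C\<close>, which
      vanishes in the limit, and \<open>W\<close> with it.\<close>
    have "W \<le> 0"
    proof (rule LIMSEQ_le_const)
      show "(\<lambda>n. 2 * \<epsilon>2 n * C + 2 * (W - S n)) \<longlonglongrightarrow> 0"
        using tendsto_add[OF tendsto_mult[OF tendsto_mult[OF tendsto_const[of 2] e2] tendsto_const[of C]] S0] by simp
      show "\<exists>N. \<forall>n\<ge>N. W \<le> 2 * \<epsilon>2 n * C + 2 * (W - S n)"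
      proof (intro exI allI impI)
        fix n
        have "1 / (2 * \<epsilon>2 n) * P n \<le> C" using energy[of n] pen_nn(1)[of n] Q_nn[of n] by linarith
        hence "P n \<le> 2 * \<epsilon>2 n * C" using \<epsilon>2_pos[of n] by (simp add: field_simps)
        thus "W \<le> 2 * \<epsilon>2 n * C + 2 * (W - S n)" using PW[of n] by linarith
      qed
    qed
    moreover have "0 \<le> W" unfolding W_def by simp
    ultimately have "W = 0" by simp
    hence "AE x in intv L. w' x = 0"
      unfolding W_def using sq_intD[OF sqw] by (subst (asm) integral_nonneg_eq_0_iff_AE) auto
    hence "AE x in lborel. x \<in> {0<..<L} \<longrightarrow> D L y x \<bullet> D L b x = 0"
      unfolding AE_intv w'_def qq_def .
    hence "(y, b) \<in> admissible L Lbc lbc" using frame unfolding admissible_def u by simp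
    thus "u \<in> admissible L Lbc lbc \<and> E_constr L Lbc lbc u \<le> ereal C"
      using \<open>J \<le> C\<close> unfolding u E_constr.simps J_eq by simp
  next
    assume e2: "\<And>n. \<epsilon>2 n = e2"
    hence e2_pos: "e2 > 0" using \<epsilon>2_pos[of 0] by simp
    \<comment> \<open>With constant \<open>\<epsilon>2\<close> the penalty survives, and its lower
      bound \<open>W\<close> is kept beside \<open>J\<close> in the same inequality.\<close>
    have "J + 1 / (2 * e2) * W \<le> C"
    proof (rule LIMSEQ_le_const)
      show "(\<lambda>n. C + R n + 1 / (2 * e2) * (2 * (W - S n))) \<longlonglongrightarrow> C"
        using tendsto_add[OF tendsto_add[OF tendsto_const[of C] R_lim] tendsto_mult[OF tendsto_const[of "1 / (2 * e2)"] S0]]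
        by simp
      show "\<exists>N. \<forall>n\<ge>N. J + 1 / (2 * e2) * W \<le> C + R n + 1 / (2 * e2) * (2 * (W - S n))"
      proof (intro exI allI impI)
        fix n
        have "1 / (2 * e2) * W \<le> 1 / (2 * e2) * (P n + 2 * (W - S n))"
          using PW[of n] e2_pos by (intro mult_left_mono) auto
        hence "1 / (2 * e2) * W \<le> 1 / (2 * e2) * P n + 1 / (2 * e2) * (2 * (W - S n))"
          by (simp only: distrib_left)
        moreover have "Q n + 1 / (2 * e2) * P n \<le> C"
          using energy[of n] pen_nn(1)[of n] e2[of n] by simp
        ultimately show "J + 1 / (2 * e2) * W \<le> C + R n + 1 / (2 * e2) * (2 * (W - S n))"
          using JQ[of n] by linarith
      qed
    qed
    thus "E_pen L Lbc lbc e2 u \<le> ereal C"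
      using frame unfolding u E_pen.simps J_eq W_eq by simp
  }
qed

end

section \<open>Nodal interpolation\<close>

lemma primitive_of_seg:
  assumes "integrable (intv L) g" shows "primitive_of L (\<lambda>x. a + seg L g 0 x) g"
  using assms by (simp add: primitive_of_def)

lemma continuous_primitive_derivative:
  fixes f :: "real \<Rightarrow> 'b::euclidean_space"
  assumes p: "primitive_of L f g" and g: "continuous_on {0..L} g" and x: "x \<in> {0..L}"
  shows "(f has_vector_derivative g x) (at x within {0..L})"
proof -
  have eq: "f t = f 0 + integral {0..t} g" if t: "t \<in> {0..L}" for t
  proof -
    have c: "continuous_on {0..t} g" using t by (intro continuous_on_subset[OF g]) auto
    have "seg L g 0 t = (LINT s:{0..t}|lborel. g s)"
      by (rule seg_eq_lborel[OF continuous_measurable_intv[OF g]]) (use t in auto)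
    also have "\<dots> = integral {0..t} g"
      by (rule set_borel_integral_eq_integral(2)[OF borel_integrable_atLeastAtMost'[OF c]])
    finally show ?thesis using primitive_of_eq[OF p, of t] t by (metis atLeastAtMost_iff)
  qed
  have "((\<lambda>t. f 0 + integral {0..t} g) has_vector_derivative 0 + g x) (at x within {0..L})"
    by (intro has_vector_derivative_add has_vector_derivative_const integral_has_vector_derivative[OF g x])
  hence "((\<lambda>t. f 0 + integral {0..t} g) has_vector_derivative g x) (at x within {0..L})" by simp
  thus ?thesis using eq by (rule has_vector_derivative_transform[OF x, rotated]) 
qed

lemma has_vector_derivative_component:
  fixes f :: "real \<Rightarrow> real^3"
  assumes "(f has_vector_derivative f') F" shows "((\<lambda>x. f x $ i) has_vector_derivative f' $ i) F"
  using bounded_linear.has_vector_derivative[OF bounded_linear_vec_nth assms] .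

lemma has_vector_derivative_scaleR_vector:
  fixes c :: "'b::real_normed_vector"
  assumes "(f has_real_derivative f') (at x within S)"
  shows "((\<lambda>x. f x *\<^sub>R c) has_vector_derivative f' *\<^sub>R c) (at x within S)"
  using has_vector_derivative_scaleR[OF assms has_vector_derivative_const[of c]] by simp

context mesh_on
begin

lemma elementwise_sq_int:
  fixes F :: "nat \<Rightarrow> real \<Rightarrow> 'b::euclidean_space"
  assumes F: "\<And>j. j < N \<Longrightarrow> sq_int (intv L) (F j)"
  shows "sq_int (intv L) (\<lambda>x. F (elem X x) x)"
proof (rule sq_int_bound)
  show "(\<lambda>x. F (elem X x) x) \<in> borel_measurable (intv L)"
    by (rule elementwise_measurable) (use F in \<open>auto simp: sq_int_def\<close>)
  show "integrable (intv L) (\<lambda>x. \<Sum>j<N. (norm (F j x))\<^sup>2)"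
    using F by (intro Bochner_Integration.integrable_sum) (auto simp: sq_int_def)
  show "AE x in intv L. (norm (F (elem X x) x))\<^sup>2 \<le> (\<Sum>j<N. (norm (F j x))\<^sup>2)"
  proof (intro AE_I2)
    fix x assume "x \<in> space (intv L)"
    hence "elem X x < N" using elem_props by auto
    thus "(norm (F (elem X x) x))\<^sup>2 \<le> (\<Sum>j<N. (norm (F j x))\<^sup>2)"
      using member_le_sum[of "elem X x" "{..<N}" "\<lambda>j. (norm (F j x))\<^sup>2"] by auto
  qed
qed

text \<open>Gluing: if local antiderivatives of the pieces match prescribed values at shared nodes,
  the global primitive coincides with each of them on its element. It serves \<open>y'\<close>,
  \<open>y\<close> and \<open>b\<close> alike.\<close>

lemma elementwise_primitive:
  fixes F G :: "nat \<Rightarrow> real \<Rightarrow> 'b::euclidean_space"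
  assumes f: "integrable (intv L) f"
    and fF: "\<And>j x. j < N \<Longrightarrow> X j < x \<Longrightarrow> x \<le> X (Suc j) \<Longrightarrow> f x = F j x"
    and G: "\<And>j. j < N \<Longrightarrow> primitive_of L (G j) (F j)"
    and nodes: "\<And>j. j < N \<Longrightarrow> G j (X j) = v j" "\<And>j. j < N \<Longrightarrow> G j (X (Suc j)) = v (Suc j)"
  shows "k \<le> N \<Longrightarrow> v 0 + seg L f 0 (X k) = v k"
    "j < N \<Longrightarrow> X j \<le> x \<Longrightarrow> x \<le> X (Suc j) \<Longrightarrow> v 0 + seg L f 0 x = G j x"
proof -
  have part: "seg L f (X j) x = G j x - v j" if j: "j < N" "X j \<le> x" "x \<le> X (Suc j)" for j x
  proof -
    have "0 \<le> X j" "x \<le> L" using X_in[of j] X_in[of "Suc j"] j by auto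
    hence "G j x - G j (X j) = seg L (F j) (X j) x" using j by (intro primitive_ofD[OF G]) auto
    also have "seg L (F j) (X j) x = seg L f (X j) x" using fF[OF j(1)] j by (intro seg_cong) auto
    finally show ?thesis using nodes(1)[OF j(1)] by simp
  qed
  have nodal: "v 0 + seg L f 0 (X k) = v k" if "k \<le> N" for k
    using that
  proof (induction k)
    case (Suc k)
    hence k: "k < N" by simp
    have "seg L f 0 (X (Suc k)) = seg L f 0 (X k) + seg L f (X k) (X (Suc k))"
      using X_in[of k] k X_Suc[OF k] by (intro seg_add[OF f, symmetric]) auto
    also have "seg L f (X k) (X (Suc k)) = v (Suc k) - v k"
      using part[OF k, of "X (Suc k)"] nodes(2)[OF k] X_Suc[OF k] by simp
    finally show ?case using Suc.IH k by (simp add: add.assoc[symmetric])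
  qed simp
  show "k \<le> N \<Longrightarrow> v 0 + seg L f 0 (X k) = v k" by (rule nodal)
  assume j: "j < N" "X j \<le> x" "x \<le> X (Suc j)"
  have "seg L f 0 x = seg L f 0 (X j) + seg L f (X j) x"
    using X_in[of j] j by (intro seg_add[OF f, symmetric]) auto
  thus "v 0 + seg L f 0 x = G j x" using nodal[of j] part[OF j] j by (simp add: add.assoc[symmetric])
qed

end

text \<open>Cubic Hermite interpolation of \<open>y\<close> and linear interpolation of \<open>b\<close>. On an element, the second
  derivative of the Hermite interpolant is the mean of \<open>y''\<close> plus a linear function with mean zero, whose
  size is given by \<open>hdev\<close>, the mean of the difference between \<open>y'\<close> and its linear interpolant.\<close>

locale interpolation = mesh_on +
  fixes y p r b q :: "real \<Rightarrow> real^3"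
  assumes yp: "primitive_of L y p" and pr: "primitive_of L p r" and r: "sq_int (intv L) r"
    and bq: "primitive_of L b q" and q: "sq_int (intv L) q"
begin

definition len :: "nat \<Rightarrow> real" where "len j = X (Suc j) - X j"

definition tau :: "nat \<Rightarrow> real \<Rightarrow> real" where "tau j x = (x - X j) / len j"

definition hdev :: "nat \<Rightarrow> real^3" where
  "hdev j = (1 / len j) *\<^sub>R (y (X (Suc j)) - y (X j)) - (1 / 2) *\<^sub>R (p (X j) + p (X (Suc j)))"

text \<open>\<open>F\<close>, \<open>G\<close> and \<open>K\<close> are the second derivative, the
  derivative and the value of the Hermite cubic in the local coordinate \<open>tau\<close>. The
  bubble \<open>6 * (tau - tau\<^sup>2)\<close> vanishes at both ends and has mean one, so adding
  \<open>hdev\<close> times it keeps the nodal slopes and corrects the increment of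
  \<open>y\<close>.\<close>

definition F where
  "F j x = (1 / len j) *\<^sub>R (p (X (Suc j)) - p (X j)) + (6 / len j * (1 - 2 * tau j x)) *\<^sub>R hdev j"

definition G where
  "G j x = p (X j) + tau j x *\<^sub>R (p (X (Suc j)) - p (X j)) + (6 * (tau j x - (tau j x)\<^sup>2)) *\<^sub>R hdev j"

definition K where
  "K j x = y (X j) + len j *\<^sub>R (tau j x *\<^sub>R p (X j) + ((tau j x)\<^sup>2 / 2) *\<^sub>R (p (X (Suc j)) - p (X j))
    + (3 * (tau j x)\<^sup>2 - 2 * (tau j x)^3) *\<^sub>R hdev j)"

lemma len_pos: "j < N \<Longrightarrow> len j > 0"
  using X_Suc by (simp add: len_def)

lemma tau_deriv: "j < N \<Longrightarrow> (tau j has_real_derivative 1 / len j) (at x within S)"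
  unfolding tau_def[abs_def] using len_pos[of j] by (auto intro!: derivative_eq_intros)

lemma tau_continuous: "continuous_on S (tau j)"
  unfolding tau_def[abs_def] divide_inverse by (intro continuous_intros)

lemma F_continuous: "continuous_on S (F j)"
  unfolding F_def[abs_def] by (intro continuous_intros tau_continuous)

lemma G_continuous: "continuous_on S (G j)"
  unfolding G_def[abs_def] by (intro continuous_intros tau_continuous)

lemma G_primitive: assumes j: "j < N" shows "primitive_of L (G j) (F j)"
proof (rule C1_primitive[OF _ F_continuous])
  fix x
  have l: "len j > 0" by (rule len_pos[OF j])
  have 1: "((\<lambda>x. 6 * (tau j x - (tau j x)\<^sup>2)) has_real_derivative 6 / len j * (1 - 2 * tau j x)) (at x within {0..L})"
    using l by (auto intro!: derivative_eq_intros tau_deriv[OF j] simp: field_simps)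
  have "((\<lambda>x. p (X j) + tau j x *\<^sub>R (p (X (Suc j)) - p (X j)) + (6 * (tau j x - (tau j x)\<^sup>2)) *\<^sub>R hdev j)
      has_vector_derivative 0 + (1 / len j) *\<^sub>R (p (X (Suc j)) - p (X j)) + (6 / len j * (1 - 2 * tau j x)) *\<^sub>R hdev j)
      (at x within {0..L})"
    by (intro has_vector_derivative_add has_vector_derivative_const has_vector_derivative_scaleR_vector
        tau_deriv[OF j] 1)
  thus "(G j has_vector_derivative F j x) (at x within {0..L})"
    unfolding G_def[abs_def] F_def by simp
qed

lemma K_primitive: assumes j: "j < N" shows "primitive_of L (K j) (G j)"
proof (rule C1_primitive[OF _ G_continuous])
  fix x
  have l: "len j > 0" by (rule len_pos[OF j])
  have 1: "((\<lambda>x. (tau j x)\<^sup>2 / 2) has_real_derivative tau j x / len j) (at x within {0..L})"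
    using l by (auto intro!: derivative_eq_intros tau_deriv[OF j] simp: field_simps)
  have 2: "((\<lambda>x. 3 * (tau j x)\<^sup>2 - 2 * (tau j x)^3) has_real_derivative 6 * (tau j x - (tau j x)\<^sup>2) / len j) (at x within {0..L})"
    using l by (auto intro!: derivative_eq_intros tau_deriv[OF j] simp: field_simps)
  have "((\<lambda>x. tau j x *\<^sub>R p (X j) + ((tau j x)\<^sup>2 / 2) *\<^sub>R (p (X (Suc j)) - p (X j)) + (3 * (tau j x)\<^sup>2 - 2 * (tau j x)^3) *\<^sub>R hdev j)
      has_vector_derivative (1 / len j) *\<^sub>R p (X j) + (tau j x / len j) *\<^sub>R (p (X (Suc j)) - p (X j))
        + (6 * (tau j x - (tau j x)\<^sup>2) / len j) *\<^sub>R hdev j) (at x within {0..L})" (is "((\<lambda>x. ?f x) has_vector_derivative ?f') _")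
    by (intro has_vector_derivative_add has_vector_derivative_scaleR_vector tau_deriv[OF j] 1 2)
  from has_vector_derivative_add[OF has_vector_derivative_const
      bounded_linear.has_vector_derivative[OF bounded_linear_scaleR_right this]]
  have "((\<lambda>x. y (X j) + len j *\<^sub>R ?f x) has_vector_derivative 0 + len j *\<^sub>R ?f') (at x within {0..L})" .
  thus "(K j has_vector_derivative G j x) (at x within {0..L})"
    unfolding K_def[abs_def] G_def using l by (simp add: scaleR_add_right)
qed

lemma tau_nodes: "j < N \<Longrightarrow> tau j (X j) = 0" "j < N \<Longrightarrow> tau j (X (Suc j)) = 1"
  using len_pos[of j] by (auto simp: tau_def len_def)

lemma G_nodes: "j < N \<Longrightarrow> G j (X j) = p (X j)" "j < N \<Longrightarrow> G j (X (Suc j)) = p (X (Suc j))"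
  by (simp_all add: G_def tau_nodes)

lemma K_nodes: "j < N \<Longrightarrow> K j (X j) = y (X j)" "j < N \<Longrightarrow> K j (X (Suc j)) = y (X (Suc j))"
proof -
  assume j: "j < N"
  show "K j (X j) = y (X j)" using j by (simp add: K_def tau_nodes)
  have "K j (X (Suc j)) = y (X j) + len j *\<^sub>R (p (X j) + (1 / 2) *\<^sub>R (p (X (Suc j)) - p (X j)) + hdev j)"
    using j by (simp add: K_def tau_nodes)
  also have "p (X j) + (1 / 2) *\<^sub>R (p (X (Suc j)) - p (X j)) + hdev j = (1 / len j) *\<^sub>R (y (X (Suc j)) - y (X j))"
    by (simp add: hdev_def vec_eq_iff field_simps)
  finally show "K j (X (Suc j)) = y (X (Suc j))" using len_pos[OF j] by simp
qed

text \<open>Integration upward from the highest derivative makes the primitive relations and the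
  regularity hold by construction; the nodal values follow by gluing.\<close>

definition rh where "rh x = F (elem X x) x"
definition ph where "ph x = p 0 + seg L rh 0 x"
definition yh where "yh x = y 0 + seg L ph 0 x"
definition bh where "bh x = b 0 + seg L (cav q) 0 x"

lemma sq_int_rh: "sq_int (intv L) rh"
  unfolding rh_def[abs_def] by (rule elementwise_sq_int[of F]) (rule continuous_sq_int_intv[OF F_continuous])

lemma integrable_rh: "integrable (intv L) rh"
  by (rule finite_measure.sq_int_integrable[OF finite_measure_intv sq_int_rh])

lemma ph_rh: "primitive_of L ph rh"
  unfolding ph_def[abs_def] by (rule primitive_of_seg[OF integrable_rh])

lemma ph_continuous: "continuous_on {0..L} ph"
  by (rule primitive_of_continuous[OF ph_rh])

lemma yh_ph: "primitive_of L yh ph"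
  unfolding yh_def[abs_def] by (rule primitive_of_seg[OF continuous_integrable_intv[OF ph_continuous]])

lemma bh_cav: "primitive_of L bh (cav q)"
  unfolding bh_def[abs_def] by (rule primitive_of_seg[OF integrable_cav])

lemma rh_F: "j < N \<Longrightarrow> X j < x \<Longrightarrow> x \<le> X (Suc j) \<Longrightarrow> rh x = F j x"
  by (simp add: rh_def elem_eq)

lemmas ph_interp = elementwise_primitive[of rh F G "\<lambda>j. p (X j)", OF integrable_rh rh_F G_primitive G_nodes,
  unfolded X_0, folded ph_def]

lemma ph_nodes: "k \<le> N \<Longrightarrow> ph (X k) = p (X k)"
  using ph_interp(1)[of k] by simp

lemma ph_G: "j < N \<Longrightarrow> X j \<le> x \<Longrightarrow> x \<le> X (Suc j) \<Longrightarrow> ph x = G j x"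
  using ph_interp(2)[of j x] by simp

lemmas yh_interp = elementwise_primitive[of ph G K "\<lambda>j. y (X j)",
  OF continuous_integrable_intv[OF ph_continuous] ph_G[OF _ less_imp_le] K_primitive K_nodes,
  unfolded X_0, folded yh_def]

lemma yh_nodes: "k \<le> N \<Longrightarrow> yh (X k) = y (X k)"
  using yh_interp(1)[of k] by simp

lemma yh_K: "j < N \<Longrightarrow> X j \<le> x \<Longrightarrow> x \<le> X (Suc j) \<Longrightarrow> yh x = K j x"
  using yh_interp(2)[of j x] by simp

lemma seg_element_primitive:
  fixes f g :: "real \<Rightarrow> real^3"
  assumes "primitive_of L f g" "j < N" shows "seg L g (X j) (X (Suc j)) = f (X (Suc j)) - f (X j)"
  using primitive_ofD[OF assms(1), of "X j" "X (Suc j)"] X_in[of j] X_in[of "Suc j"] X_Suc[OF assms(2)] assms(2)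
  by simp

definition Bl where "Bl j x = b (X j) + (x - X j) *\<^sub>R ((1 / len j) *\<^sub>R (b (X (Suc j)) - b (X j)))"

lemma bh_interp:
  shows "k \<le> N \<Longrightarrow> bh (X k) = b (X k)" "j < N \<Longrightarrow> X j \<le> x \<Longrightarrow> x \<le> X (Suc j) \<Longrightarrow> bh x = Bl j x"
proof -
  have 1: "cav q x = (1 / len j) *\<^sub>R (b (X (Suc j)) - b (X j))" if "j < N" "X j < x" "x \<le> X (Suc j)" for j x
    using cav_eq[OF that, of q] seg_element_primitive[OF bq that(1)] by (simp add: len_def)
  have 2: "primitive_of L (Bl j) (\<lambda>x. (1 / len j) *\<^sub>R (b (X (Suc j)) - b (X j)))" if "j < N" for j
    unfolding Bl_def[abs_def]
    by (rule C1_primitive) (use len_pos[OF that] in \<open>auto intro!: derivative_eq_intros continuous_intros\<close>)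
  have 3: "Bl j (X j) = b (X j)" "Bl j (X (Suc j)) = b (X (Suc j))" if "j < N" for j
    using len_pos[OF that] by (auto simp: Bl_def len_def)
  note e = elementwise_primitive[of "cav q" "\<lambda>j x. (1 / len j) *\<^sub>R (b (X (Suc j)) - b (X j))" Bl "\<lambda>j. b (X j)",
      OF integrable_cav 1 2 3, unfolded X_0, folded bh_def]
  show "k \<le> N \<Longrightarrow> bh (X k) = b (X k)" by (rule e(1)) assumption+
  show "j < N \<Longrightarrow> X j \<le> x \<Longrightarrow> x \<le> X (Suc j) \<Longrightarrow> bh x = Bl j x" by (rule e(2)) assumption+
qed

lemma V_yhbh: "(yh, bh) \<in> V_space L"
  by (rule V_spaceI[OF yh_ph ph_rh sq_int_rh bh_cav sq_int_cav L_pos])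

lemma D_yh: "x \<in> {0..L} \<Longrightarrow> D L yh x = ph x"
  by (rule D_sobolev2(1)[OF yh_ph ph_rh L_pos])

lemma V_h_yhbh: "(yh, bh) \<in> V_h L N X"
  unfolding V_h_def mem_Collect_eq prod.case
proof (intro allI conjI)
  fix i
  show "spline L N X 3 1 (\<lambda>x. yh x $ i)"
    unfolding spline_def
  proof (intro conjI allI impI)
    show "Ck_on {0..L} 1 (\<lambda>x. yh x $ i)"
      unfolding Ck_on_def
    proof (intro exI[of _ "\<lambda>k. if k = 0 then (\<lambda>x. yh x $ i) else (\<lambda>x. ph x $ i)"] conjI allI impI ballI)
      fix k :: nat and x assume k: "k < 1" and x: "x \<in> {0..L}"
      have "((\<lambda>x. yh x $ i) has_vector_derivative ph x $ i) (at x within {0..L})"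
        by (rule has_vector_derivative_component[OF continuous_primitive_derivative[OF yh_ph ph_continuous x]])
      thus "((if k = 0 then (\<lambda>x. yh x $ i) else (\<lambda>x. ph x $ i)) has_vector_derivative
          (if Suc k = 0 then (\<lambda>x. yh x $ i) else (\<lambda>x. ph x $ i)) x) (at x within {0..L})" using k by simp
    next
      fix k :: nat
      show "continuous_on {0..L} (if k = 0 then (\<lambda>x. yh x $ i) else (\<lambda>x. ph x $ i))"
        using ph_continuous primitive_of_continuous[OF yh_ph] by (auto intro!: continuous_intros)
    qed simp
    fix j assume j: "j < N"
    \<comment> \<open>The local coordinate \<open>tau j\<close> as a polynomial of degree one;
      \<open>Q\<close> is then the component \<open>i\<close> of the cubic
      \<open>K j\<close>.\<close>
    define t where "t = [:- X j / len j, 1 / len j:]"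
    have t: "poly t x = tau j x" for x by (simp add: t_def tau_def diff_divide_distrib)
    define Q where "Q = [:y (X j) $ i:] + smult (len j) (smult (p (X j) $ i) t
        + smult ((p (X (Suc j)) - p (X j)) $ i / 2) (t ^ 2) + smult (hdev j $ i) (smult 3 (t^2) - smult 2 (t^3)))"
    have dt: "degree t \<le> 1" by (simp add: t_def)
    have dtk: "degree (t ^ k) \<le> 3" if "k \<le> 3" for k
      using order_trans[OF degree_power_le[of t k]] dt that by (metis mult.commute mult_le_mono nat_mult_1_right order_trans)
    show "\<exists>q. degree q \<le> 3 \<and> (\<forall>x\<in>{X j..X (Suc j)}. yh x $ i = poly q x)"
    proof (intro exI[of _ Q] conjI ballI)
      show "degree Q \<le> 3"
        unfolding Q_def using dt dtk[of 2] dtk[of 3]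
        by (intro degree_add_le degree_diff_le order_trans[OF degree_smult_le]) auto
      fix x assume "x \<in> {X j..X (Suc j)}"
      hence "yh x $ i = K j x $ i" using yh_K[OF j] by auto
      also have "\<dots> = poly Q x"
        by (simp add: K_def Q_def t field_simps)
      finally show "yh x $ i = poly Q x" .
    qed
  qed
  show "spline L N X 1 0 (\<lambda>x. bh x $ i)"
    unfolding spline_def Ck_on_0
  proof (intro conjI allI impI)
    show "continuous_on {0..L} (\<lambda>x. bh x $ i)"
      by (intro continuous_intros primitive_of_continuous[OF bh_cav])
    fix j assume j: "j < N"
    define c where "c = ((1 / len j) *\<^sub>R (b (X (Suc j)) - b (X j))) $ i"
    show "\<exists>q. degree q \<le> 1 \<and> (\<forall>x\<in>{X j..X (Suc j)}. bh x $ i = poly q x)"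
    proof (intro exI[of _ "[:b (X j) $ i - X j * c, c:]"] conjI ballI)
      fix x assume "x \<in> {X j..X (Suc j)}"
      hence "bh x $ i = Bl j x $ i" using bh_interp(2)[OF j] by auto
      also have "\<dots> = b (X j) $ i + (x - X j) * c" by (simp add: Bl_def c_def)
      finally show "bh x $ i = poly [:b (X j) $ i - X j * c, c:] x" by (simp add: algebra_simps)
    qed simp
  qed
qed

lemma boundary_values_yhbh:
  assumes "\<And>x. x \<in> {0..L} \<Longrightarrow> D L y x = p x"
  shows "boundary_values L (yh, bh) = boundary_values L (y, b)"
  using yh_nodes[of 0] yh_nodes[of N] ph_nodes[of 0] ph_nodes[of N] bh_interp(1)[of 0] bh_interp(1)[of N]
    D_yh[of 0] D_yh[of L] assms[of 0] assms[of L] L_pos by simp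

text \<open>The mean of a second derivative over an element depends only on the slopes at its nodes,
  which interpolation preserves. The averaged argument of \<open>psi\<close> is therefore that of
  the interpolated function.\<close>

lemma cav_rh:
  assumes "x \<in> {0<..<L}" shows "cav rh x = cav r x"
proof -
  have j: "elem X x < N" using elem_props assms by auto
  show ?thesis
    unfolding cav_def seg_element_primitive[OF ph_rh j] seg_element_primitive[OF pr j]
    using ph_nodes[of "elem X x"] ph_nodes[of "Suc (elem X x)"] j by simp
qed

text \<open>\<open>p\<close> minus its linear interpolant \<open>I\<close> is the integral of
  \<open>r - cav r\<close> from the left node, hence at most \<open>sqrt (len j * \<rho>)\<close> on
  the element; \<open>hdev j\<close> is the mean of this difference.\<close>

lemma hdev_bound:
  assumes j: "j < N"
  shows "(norm (hdev j))\<^sup>2 \<le> len j * seg L (\<lambda>t. (norm (r t - cav r t))\<^sup>2) (X j) (X (Suc j))"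
proof -
  define \<rho> where "\<rho> = seg L (\<lambda>t. (norm (r t - cav r t))\<^sup>2) (X j) (X (Suc j))"
  have l: "len j > 0" by (rule len_pos[OF j])
  have Xj: "0 \<le> X j" "X (Suc j) \<le> L" "X j < X (Suc j)" using X_in[of j] X_in[of "Suc j"] j X_Suc by auto
  note ri = finite_measure.sq_int_integrable[OF finite_measure_intv r]
  have rc: "sq_int (intv L) (\<lambda>t. r t - cav r t)" by (rule sq_int_diff[OF r sq_int_cav])
  have \<rho>_nn: "0 \<le> \<rho>" unfolding \<rho>_def by (rule seg_nonneg) simp
  define I where "I x = p (X j) + tau j x *\<^sub>R (p (X (Suc j)) - p (X j))" for x
  have cav_r: "cav r x = (1 / len j) *\<^sub>R (p (X (Suc j)) - p (X j))" if "X j < x" "x \<le> X (Suc j)" for x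
    using cav_eq[OF j that, of r] seg_element_primitive[OF pr j] by (simp add: len_def)
  have err: "norm (p x - I x) \<le> sqrt (len j * \<rho>)" if x: "X j < x" "x \<le> X (Suc j)" for x
  proof -
    have "p x - p (X j) = seg L r (X j) x" by (rule primitive_ofD[OF pr]) (use Xj x in auto)
    moreover have "p x - I x = (p x - p (X j)) - tau j x *\<^sub>R (p (X (Suc j)) - p (X j))"
      by (simp add: I_def)
    moreover have "seg L (cav r) (X j) x = tau j x *\<^sub>R (p (X (Suc j)) - p (X j))"
    proof -
      have "seg L (cav r) (X j) x = seg L (\<lambda>_. (1 / len j) *\<^sub>R (p (X (Suc j)) - p (X j))) (X j) x"
        using x by (intro seg_cong cav_r) auto
      thus ?thesis using Xj x by (simp add: seg_const tau_def)
    qed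
    moreover have "seg L (\<lambda>t. r t - cav r t) (X j) x = seg L r (X j) x - seg L (cav r) (X j) x"
      using seg_linear[OF ri integrable_cav, of 1 "-1" r "X j" x] by simp
    ultimately have eq: "p x - I x = seg L (\<lambda>t. r t - cav r t) (X j) x"
      by metis
    have "(norm (p x - I x))\<^sup>2 \<le> (x - X j) * seg L (\<lambda>t. (norm (r t - cav r t))\<^sup>2) (X j) x"
      unfolding eq by (rule seg_Cauchy_Schwarz[OF rc]) (use Xj x in auto)
    also have "\<dots> \<le> len j * \<rho>"
      unfolding \<rho>_def using x Xj l
      by (intro mult_mono seg_subset_mono sq_intD rc seg_nonneg) (auto simp: len_def)
    finally show ?thesis by (rule real_le_rsqrt)
  qed
  \<comment> \<open>An explicit quadratic primitive of \<open>I\<close>, whose increment over the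
    element is the trapezoidal value in \<open>hdev\<close>.\<close>
  have Ip: "primitive_of L (\<lambda>x. x *\<^sub>R p (X j) + (len j / 2 * (tau j x)\<^sup>2) *\<^sub>R (p (X (Suc j)) - p (X j))) I"
  proof (rule C1_primitive)
    show "continuous_on {0..L} I" unfolding I_def[abs_def] by (intro continuous_intros tau_continuous)
    fix x
    have 1: "((\<lambda>x. len j / 2 * (tau j x)\<^sup>2) has_real_derivative tau j x) (at x within {0..L})"
      using l by (auto intro!: derivative_eq_intros tau_deriv[OF j] simp: field_simps)
    have 2: "((\<lambda>x. x) has_real_derivative 1) (at x within {0..L})" by (rule DERIV_ident)
    show "((\<lambda>x. x *\<^sub>R p (X j) + (len j / 2 * (tau j x)\<^sup>2) *\<^sub>R (p (X (Suc j)) - p (X j))) has_vector_derivative I x) (at x within {0..L})"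
      unfolding I_def
      using has_vector_derivative_add[OF has_vector_derivative_scaleR_vector[OF 2] has_vector_derivative_scaleR_vector[OF 1]]
      by simp
  qed
  have pint: "integrable (intv L) p" "integrable (intv L) I"
    by (intro continuous_integrable_intv primitive_of_continuous[OF pr])
       (rule primitive_of_integrable[OF Ip])
  have "seg L (\<lambda>x. p x - I x) (X j) (X (Suc j)) = seg L p (X j) (X (Suc j)) - seg L I (X j) (X (Suc j))"
    using seg_linear[OF pint, of 1 "-1" "X j" "X (Suc j)"] by simp
  also have "\<dots> = y (X (Suc j)) - y (X j) - (len j / 2) *\<^sub>R (p (X j) + p (X (Suc j)))"
    unfolding seg_element_primitive[OF yp j] seg_element_primitive[OF Ip j] tau_nodes(1)[OF j] tau_nodes(2)[OF j]
    by (simp add: len_def vec_eq_iff field_simps)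
  also have "\<dots> = len j *\<^sub>R hdev j" using l by (simp add: hdev_def scaleR_diff_right)
  finally have "len j * norm (hdev j) = norm (seg L (\<lambda>x. p x - I x) (X j) (X (Suc j)))" using l by simp
  also have "\<dots> \<le> seg L (\<lambda>x. norm (p x - I x)) (X j) (X (Suc j))"
    using pint by (intro seg_norm_le) simp
  also have "\<dots> \<le> seg L (\<lambda>x. sqrt (len j * \<rho>)) (X j) (X (Suc j))"
    by (intro seg_mono err) (use pint in auto)
  also have "\<dots> = len j * sqrt (len j * \<rho>)" using Xj by (simp add: seg_const len_def)
  finally have "norm (hdev j) \<le> sqrt (len j * \<rho>)" using l by simp
  hence "(norm (hdev j))\<^sup>2 \<le> (sqrt (len j * \<rho>))\<^sup>2" by (intro power_mono) auto
  thus ?thesis using l \<rho>_nn by (simp add: \<rho>_def)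
qed

text \<open>On an element the error is \<open>6 / len\<close> times \<open>1 - 2 * tau\<close>, at
  most one in modulus, times \<open>hdev\<close>. The factor \<open>len\<close> in
  \<open>hdev_bound\<close> cancels one power of \<open>len\<close>, and the other turns the
  integral into an average, whose integral is the full one.\<close>

lemma rh_error: "l2n (intv L) (\<lambda>x. rh x - cav r x) \<le> 6 * l2n (intv L) (\<lambda>x. r x - cav r x)"
proof -
  have rc: "sq_int (intv L) (\<lambda>t. r t - cav r t)" by (rule sq_int_diff[OF r sq_int_cav])
  have "(l2n (intv L) (\<lambda>x. rh x - cav r x))\<^sup>2 \<le> (\<integral>x. 36 * cav (\<lambda>t. (norm (r t - cav r t))\<^sup>2) x \<partial>intv L)"
    unfolding l2n_power2
  proof (rule integral_mono)
    show "integrable (intv L) (\<lambda>x. (norm (rh x - cav r x))\<^sup>2)"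
      by (intro sq_intD sq_int_diff sq_int_rh sq_int_cav)
    show "integrable (intv L) (\<lambda>x. 36 * cav (\<lambda>t. (norm (r t - cav r t))\<^sup>2) x)"
      using integrable_cav[of "\<lambda>t. (norm (r t - cav r t))\<^sup>2"] by simp
    fix x assume "x \<in> space (intv L)"
    hence x: "elem X x < N" "X (elem X x) < x" "x \<le> X (Suc (elem X x))" using elem_props by auto
    define j where "j = elem X x"
    have l: "len j > 0" using len_pos x j_def by simp
    have t: "0 \<le> tau j x" "tau j x \<le> 1" using x l by (auto simp: tau_def j_def len_def)
    have "cav r x = (1 / len j) *\<^sub>R (p (X (Suc j)) - p (X j))"
      using seg_element_primitive[OF pr x(1)] by (simp add: cav_def len_def j_def)
    hence "rh x - cav r x = (6 / len j * (1 - 2 * tau j x)) *\<^sub>R hdev j" by (simp add: rh_def F_def j_def)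
    moreover have "(norm ((6 / len j * c) *\<^sub>R hdev j))\<^sup>2 = 36 / (len j)\<^sup>2 * c\<^sup>2 * (norm (hdev j))\<^sup>2" for c
      by (simp add: power_mult_distrib power_divide)
    ultimately have "(norm (rh x - cav r x))\<^sup>2 = 36 / (len j)\<^sup>2 * (1 - 2 * tau j x)\<^sup>2 * (norm (hdev j))\<^sup>2"
      by metis
    also have "\<dots> \<le> 36 / (len j)\<^sup>2 * 1 * (len j * seg L (\<lambda>t. (norm (r t - cav r t))\<^sup>2) (X j) (X (Suc j)))"
      using t hdev_bound[of j] x(1) by (intro mult_mono) (auto simp: j_def abs_square_le_1)
    also have "\<dots> = 36 * cav (\<lambda>t. (norm (r t - cav r t))\<^sup>2) x"
      using l by (simp add: cav_def j_def[symmetric] len_def[symmetric] power2_eq_square)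
    finally show "(norm (rh x - cav r x))\<^sup>2 \<le> 36 * cav (\<lambda>t. (norm (r t - cav r t))\<^sup>2) x" .
  qed
  also have "\<dots> = 36 * (l2n (intv L) (\<lambda>x. r x - cav r x))\<^sup>2"
    unfolding l2n_power2 using integral_cav[OF sq_intD[OF rc]] by simp
  also have "\<dots> = (6 * l2n (intv L) (\<lambda>x. r x - cav r x))\<^sup>2" by (simp add: power_mult_distrib)
  finally show ?thesis by (rule power2_le_imp_le) simp
qed

lemma midavg_error:
  assumes "x \<in> {0<..<L}" shows "norm (midavg X p x - p x) \<le> sqrt h * l2n (intv L) r"
proof -
  let ?j = "elem X x"
  note a = midavg_tendsto_aux[OF assms]
  have x: "x \<in> {0..L}" using assms by auto
  have hold: "norm (p z - p x) \<le> sqrt h * l2n (intv L) r" if "z \<in> {0..L}" "\<bar>z - x\<bar> \<le> h" for z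
    using order_trans[OF primitive_Hoelder[OF pr r x that(1)] mult_right_mono[OF real_sqrt_le_mono[OF that(2)]]] by simp
  have "midavg X p x - p x = (1/2) *\<^sub>R ((p (X ?j) - p x) + (p (X (Suc ?j)) - p x))"
    by (simp add: midavg_def Let_def vec_eq_iff field_simps)
  also have "norm \<dots> \<le> 1 / 2 * (sqrt h * l2n (intv L) r + sqrt h * l2n (intv L) r)"
    using hold[OF a(1,3)] hold[OF a(2,4)]
    by (simp only: norm_scaleR) (intro mult_mono norm_triangle_le add_mono, auto)
  finally show ?thesis by simp
qed

lemma midavg_cav_orthogonal:
  assumes orth: "AE x in intv L. p x \<bullet> q x = 0"
  shows "(\<integral>x. (midavg X p x \<bullet> cav q x)\<^sup>2 \<partial>intv L) \<le> h * (l2n (intv L) r)\<^sup>2 * (l2n (intv L) q)\<^sup>2"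
proof -
  define v where "v x = midavg X p x \<bullet> q x - p x \<bullet> q x" for x
  have pm: "p \<in> borel_measurable (intv L)" by (rule continuous_measurable_intv[OF primitive_of_continuous[OF pr]])
  have sm: "sq_int (intv L) (\<lambda>x. midavg X p x \<bullet> q x)" by (rule sq_int_midavg_inner[OF q])
  have vm: "v \<in> borel_measurable (intv L)"
    unfolding v_def[abs_def] using sm pm q sq_int_midavg[of p]
    by (intro borel_measurable_diff borel_measurable_inner) (auto simp: sq_int_def)
  have v_le: "(norm (v x))\<^sup>2 \<le> (h * (l2n (intv L) r)\<^sup>2) * (norm (q x))\<^sup>2" if x: "x \<in> {0<..<L}" for x
  proof -
    have "norm (v x) \<le> norm (midavg X p x - p x) * norm (q x)"
      unfolding v_def inner_diff_left[symmetric] real_norm_def by (rule Cauchy_Schwarz_ineq2)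
    also have "\<dots> \<le> sqrt h * l2n (intv L) r * norm (q x)"
      by (intro mult_right_mono midavg_error[OF x]) simp
    finally have "(norm (v x))\<^sup>2 \<le> (sqrt h * l2n (intv L) r * norm (q x))\<^sup>2" by (intro power_mono) auto
    thus ?thesis using h_pos by (simp add: power_mult_distrib)
  qed
  have vi: "integrable (intv L) (\<lambda>x. (h * (l2n (intv L) r)\<^sup>2) * (norm (q x))\<^sup>2)" using sq_intD[OF q] by simp
  have sv: "sq_int (intv L) v"
    by (rule sq_int_bound[OF vm vi]) (use v_le in auto)
  have qi: "integrable (intv L) q" by (rule finite_measure.sq_int_integrable[OF finite_measure_intv q])
  have eq: "midavg X p x \<bullet> cav q x = cav v x" if x: "x \<in> {0<..<L}" for x
  proof -
    let ?j = "elem X x"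
    have j: "?j < N" using elem_props x by auto
    have "midavg X p x \<bullet> seg L q (X ?j) (X (Suc ?j)) = seg L (\<lambda>t. midavg X p x \<bullet> q t) (X ?j) (X (Suc ?j))"
      by (rule seg_inner_const[OF qi, symmetric])
    also have "\<dots> = seg L (\<lambda>t. midavg X p t \<bullet> q t) (X ?j) (X (Suc ?j))"
      using elem_eq[OF j] by (intro seg_cong) (simp add: midavg_def Let_def)
    \<comment> \<open>The constraint enters here: subtracting \<open>p \<bullet> q\<close> changes
      the integrand only on a null set.\<close>
    also have "\<dots> = seg L v (X ?j) (X (Suc ?j))"
      by (rule seg_cong_AE) (use orth sm vm in \<open>auto simp: v_def sq_int_def elim!: eventually_mono\<close>)
    finally show ?thesis by (simp add: cav_def)
  qed
  have "(\<integral>x. (midavg X p x \<bullet> cav q x)\<^sup>2 \<partial>intv L) = (l2n (intv L) (cav v))\<^sup>2"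
    unfolding l2n_power2 by (intro Bochner_Integration.integral_cong) (use eq in auto)
  also have "\<dots> \<le> (l2n (intv L) v)\<^sup>2" by (intro power_mono l2n_cav_le sv) simp
  also have "\<dots> \<le> (\<integral>x. (h * (l2n (intv L) r)\<^sup>2) * (norm (q x))\<^sup>2 \<partial>intv L)"
    unfolding l2n_power2[of "intv L" v] by (intro integral_mono sq_intD sv vi) (use v_le in auto)
  also have "\<dots> = h * (l2n (intv L) r)\<^sup>2 * (l2n (intv L) q)\<^sup>2"
    by (simp add: l2n_power2)
  finally show ?thesis .
qed

end

section \<open>Recovery sequences\<close>

text \<open>Bundles the properties of the interpolants in one predicate of all data, so that a whole
  sequence over varying meshes can be obtained by choice.\<close>

definition interpolant ::
  "real \<Rightarrow> nat \<Rightarrow> (nat \<Rightarrow> real) \<Rightarrow> (real \<Rightarrow> real^3) \<Rightarrow> (real \<Rightarrow> real^3) \<Rightarrow> (real \<Rightarrow> real^3) \<Rightarrow> (real \<Rightarrow> real^3) \<Rightarrow> (real \<Rightarrow> real^3) \<Rightarrow>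
   (real \<Rightarrow> real^3) \<Rightarrow> (real \<Rightarrow> real^3) \<Rightarrow> (real \<Rightarrow> real^3) \<Rightarrow> (real \<Rightarrow> real^3) \<Rightarrow> bool" where
  "interpolant L N X y p r b q yh ph rh bh \<longleftrightarrow>
     (yh, bh) \<in> V_space L \<and> (yh, bh) \<in> V_h L N X \<and> boundary_values L (yh, bh) = boundary_values L (y, b) \<and>
     primitive_of L yh ph \<and> primitive_of L ph rh \<and> sq_int (intv L) rh \<and> primitive_of L bh (mesh_on.cav L X q) \<and>
     (\<forall>j\<le>N. ph (X j) = p (X j) \<and> bh (X j) = b (X j)) \<and> yh 0 = y 0 \<and> ph 0 = p 0 \<and> bh 0 = b 0 \<and>
     (\<forall>x\<in>{0<..<L}. mesh_on.cav L X rh x = mesh_on.cav L X r x) \<and>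
     l2n (intv L) (\<lambda>x. rh x - r x) \<le> 7 * l2n (intv L) (\<lambda>x. mesh_on.cav L X r x - r x)"

lemma (in interpolation) interpolant_exists:
  assumes "\<And>x. x \<in> {0..L} \<Longrightarrow> D L y x = p x"
  shows "\<exists>yh ph rh bh. interpolant L N X y p r b q yh ph rh bh"
proof (intro exI)
  have d1: "sq_int (intv L) (\<lambda>x. rh x - cav r x)" "sq_int (intv L) (\<lambda>x. cav r x - r x)"
    by (intro sq_int_diff sq_int_rh sq_int_cav r)+
  have "l2n (intv L) (\<lambda>x. rh x - r x) = l2n (intv L) (\<lambda>x. (rh x - cav r x) + (cav r x - r x))" by simp
  also have "\<dots> \<le> l2n (intv L) (\<lambda>x. rh x - cav r x) + l2n (intv L) (\<lambda>x. cav r x - r x)"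
    by (rule l2n_triangle[OF d1])
  \<comment> \<open>The factor is \<open>6 + 1\<close>, from \<open>rh_error\<close> and the
    averaging error itself.\<close>
  also have "\<dots> \<le> 7 * l2n (intv L) (\<lambda>x. cav r x - r x)"
    using rh_error l2n_minus[of "intv L" r "cav r"] by simp
  finally have e: "l2n (intv L) (\<lambda>x. rh x - r x) \<le> 7 * l2n (intv L) (\<lambda>x. cav r x - r x)" .
  show "interpolant L N X y p r b q yh ph rh bh"
    unfolding interpolant_def
    using V_yhbh V_h_yhbh boundary_values_yhbh[OF assms] yh_ph ph_rh sq_int_rh bh_cav ph_nodes bh_interp(1)
      yh_nodes[of 0] ph_nodes[of 0] bh_interp(1)[of 0] cav_rh e
    by (intro conjI allI ballI impI) auto
qed

lemma null_squeeze:
  fixes f g :: "nat \<Rightarrow> real"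
  assumes "\<And>n. 0 \<le> f n" "\<And>n. f n \<le> g n" "g \<longlonglongrightarrow> 0" shows "f \<longlonglongrightarrow> 0"
  by (rule tendsto_sandwich[OF _ _ tendsto_const assms(3)]) (use assms in auto)

text \<open>A Poincare inequality. Since the interpolants agree with the data at \<open>0\<close>,
  it reduces all Sobolev errors to those of the highest derivatives.\<close>

lemma primitive_zero_l2n:
  fixes e :: "real \<Rightarrow> 'b::euclidean_space"
  assumes p: "primitive_of L e e'" and e': "sq_int (intv L) e'" and "e 0 = 0" "L > 0"
  shows "l2n (intv L) e \<le> L * l2n (intv L) e'"
proof -
  have "l2n (intv L) e \<le> l2n (intv L) (\<lambda>_. sqrt L * l2n (intv L) e')"
  proof (rule l2n_mono[OF finite_measure.sq_int_const[OF finite_measure_intv]])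
    fix x assume "x \<in> space (intv L)"
    hence x: "x \<in> {0..L}" by auto
    have "norm (e x - e 0) \<le> sqrt \<bar>x - 0\<bar> * l2n (intv L) e'"
      by (rule primitive_Hoelder[OF p e' _ x]) (use assms in auto)
    also have "\<dots> \<le> sqrt L * l2n (intv L) e'" using x by (intro mult_right_mono) auto
    finally show "norm (e x) \<le> norm (sqrt L * l2n (intv L) e')" using assms by simp
  qed
  also have "\<dots> = L * l2n (intv L) e'" using assms by (simp add: l2n_const)
  finally show ?thesis .
qed

lemma integral_norm_square_tendsto:
  fixes f :: "nat \<Rightarrow> 'a \<Rightarrow> 'b::euclidean_space"
  assumes f: "\<And>n. sq_int M (f n)" and g: "sq_int M g" and lim: "(\<lambda>n. l2n M (\<lambda>x. f n x - g x)) \<longlonglongrightarrow> 0"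
  shows "(\<lambda>n. \<integral>x. \<bar>(norm (f n x))\<^sup>2 - (norm (g x))\<^sup>2\<bar> \<partial>M) \<longlonglongrightarrow> 0"
    "(\<lambda>n. \<integral>x. (norm (f n x))\<^sup>2 \<partial>M) \<longlonglongrightarrow> (\<integral>x. (norm (g x))\<^sup>2 \<partial>M)"
proof -
  show a: "(\<lambda>n. \<integral>x. \<bar>(norm (f n x))\<^sup>2 - (norm (g x))\<^sup>2\<bar> \<partial>M) \<longlonglongrightarrow> 0"
  proof (rule tendsto_sandwich[OF _ _ tendsto_const])
    show "\<forall>\<^sub>F n in sequentially. (\<integral>x. \<bar>(norm (f n x))\<^sup>2 - (norm (g x))\<^sup>2\<bar> \<partial>M)
      \<le> l2n M (\<lambda>x. f n x - g x) * (l2n M (\<lambda>x. f n x - g x) + 2 * l2n M g)"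
      using l2n_square_diff[OF f g] by simp
    show "(\<lambda>n. l2n M (\<lambda>x. f n x - g x) * (l2n M (\<lambda>x. f n x - g x) + 2 * l2n M g)) \<longlonglongrightarrow> 0"
      using tendsto_mult[OF lim tendsto_add[OF lim tendsto_const[of "2 * l2n M g"]]] by simp
  qed simp
  have "(\<lambda>n. (\<integral>x. (norm (f n x))\<^sup>2 \<partial>M) - (\<integral>x. (norm (g x))\<^sup>2 \<partial>M)) \<longlonglongrightarrow> 0"
  proof (rule Lim_null_comparison[OF _ a])
    show "\<forall>\<^sub>F n in sequentially. norm ((\<integral>x. (norm (f n x))\<^sup>2 \<partial>M) - (\<integral>x. (norm (g x))\<^sup>2 \<partial>M))
      \<le> (\<integral>x. \<bar>(norm (f n x))\<^sup>2 - (norm (g x))\<^sup>2\<bar> \<partial>M)"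
    proof (intro always_eventually allI)
      fix n
      have "(\<integral>x. (norm (f n x))\<^sup>2 \<partial>M) - (\<integral>x. (norm (g x))\<^sup>2 \<partial>M) = (\<integral>x. (norm (f n x))\<^sup>2 - (norm (g x))\<^sup>2 \<partial>M)"
        using sq_intD[OF f[of n]] sq_intD[OF g] by simp
      thus "norm ((\<integral>x. (norm (f n x))\<^sup>2 \<partial>M) - (\<integral>x. (norm (g x))\<^sup>2 \<partial>M))
        \<le> (\<integral>x. \<bar>(norm (f n x))\<^sup>2 - (norm (g x))\<^sup>2\<bar> \<partial>M)"
        using integral_abs_bound[of M "\<lambda>x. (norm (f n x))\<^sup>2 - (norm (g x))\<^sup>2"] by simp
    qed
  qed
  thus "(\<lambda>n. \<integral>x. (norm (f n x))\<^sup>2 \<partial>M) \<longlonglongrightarrow> (\<integral>x. (norm (g x))\<^sup>2 \<partial>M)" by (rule LIM_zero_cancel)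
qed

lemma strong_imp_weakly_conv:
  assumes U: "\<And>n. (yh n, bh n) \<in> V_space L" and u: "(y, b) \<in> V_space L" and L: "L > 0"
    and lim: "(\<lambda>n. sobolev_norm L 2 (\<lambda>x. yh n x - y x)) \<longlonglongrightarrow> 0" "(\<lambda>n. sobolev_norm L 1 (\<lambda>x. bh n x - b x)) \<longlonglongrightarrow> 0"
  shows "weakly_conv L (\<lambda>n. (yh n, bh n)) (y, b)"
  unfolding weakly_conv_def
proof (intro conjI allI impI U u)
  fix \<Phi> :: "frame \<Rightarrow> real" assume "bounded_linear_on_V L \<Phi>"
  then obtain C where lin: "\<And>u v r s. u \<in> V_space L \<Longrightarrow> v \<in> V_space L \<Longrightarrow> \<Phi> (lin_comb r u s v) = r *\<^sub>R \<Phi> u + s *\<^sub>R \<Phi> v"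
    and C: "\<And>u. u \<in> V_space L \<Longrightarrow> norm (\<Phi> u) \<le> C * V_norm L u"
    unfolding bounded_linear_on_V_def by blast
  have V: "(\<lambda>x. yh n x - y x, \<lambda>x. bh n x - b x) \<in> V_space L" for n
    using V_lin_comb(1)[OF U[of n] u L, where r = 1 and s = "-1"] by simp
  have d: "\<Phi> (yh n, bh n) - \<Phi> (y, b) = \<Phi> (\<lambda>x. yh n x - y x, \<lambda>x. bh n x - b x)" for n
    using lin[OF U[of n] u, of 1 "-1"] by simp
  have "(\<lambda>n. \<Phi> (yh n, bh n) - \<Phi> (y, b)) \<longlonglongrightarrow> 0"
  proof (rule Lim_null_comparison)
    show "\<forall>\<^sub>F n in sequentially. norm (\<Phi> (yh n, bh n) - \<Phi> (y, b)) \<le> C * V_norm L (\<lambda>x. yh n x - y x, \<lambda>x. bh n x - b x)"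
      unfolding d using C[OF V] by (intro always_eventually allI)
    show "(\<lambda>n. C * V_norm L (\<lambda>x. yh n x - y x, \<lambda>x. bh n x - b x)) \<longlonglongrightarrow> 0"
      unfolding V_norm.simps
      using tendsto_mult[OF tendsto_const[of C] tendsto_real_sqrt[OF tendsto_add[OF tendsto_power[OF lim(1), of 2] tendsto_power[OF lim(2), of 2]]]]
      by simp
  qed
  thus "(\<lambda>n. \<Phi> (yh n, bh n)) \<longlonglongrightarrow> \<Phi> (y, b)" by (rule LIM_zero_cancel)
qed

context discretization
begin

text \<open>The energy is split so that \<open>\<epsilon>2\<close> appears only as a prefactor: for
  constant \<open>\<epsilon>2\<close> the limit of \<open>P\<close> is used, and for vanishing
  \<open>\<epsilon>2\<close> the rate in \<open>h\<close> that admissible pairs provide.\<close>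

proposition recovery_sequence:
  assumes A: "(y, b) \<in> A_frame L Lbc lbc"
  obtains yh bh Q P where "\<And>n. (yh n, bh n) \<in> V_space L" "\<And>n. (yh n, bh n) \<in> Ah n"
    "(\<lambda>n. sobolev_norm L 2 (\<lambda>x. yh n x - y x)) \<longlonglongrightarrow> 0"
    "(\<lambda>n. sobolev_norm L 1 (\<lambda>x. bh n x - b x)) \<longlonglongrightarrow> 0"
    "\<And>n. Eh n (yh n, bh n) = ereal (Q n + 1 / (2 * \<epsilon>2 n) * P n)"
    "Q \<longlonglongrightarrow> (LINT x:{0<..<L}|lborel. Qbar (norm (D L (D L y) x)) (norm (D L b x)))"
    "P \<longlonglongrightarrow> (LINT x:{0<..<L}|lborel. (D L y x \<bullet> D L b x)\<^sup>2)"
    "\<And>n. 0 \<le> P n"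
    "(y, b) \<in> admissible L Lbc lbc \<Longrightarrow> \<exists>K. \<forall>n. P n \<le> mesh_size (N n) (X n) * K"
proof -
  have V: "(y, b) \<in> V_space L" and frame: "\<And>x. x \<in> {0..L} \<Longrightarrow> norm (D L y x) = 1 \<and> norm (b x) = 1 \<and> D L y x \<bullet> b x = 0"
    and bc_eq: "Lbc (y, b) = lbc"
    using A unfolding A_frame_iff[OF L] by auto
  define p r q where "p = D L y" and "r = D L (D L y)" and "q = D L b"
  have yb: "primitive_of L y p" "primitive_of L p r" "sq_int (intv L) r" "primitive_of L b q" "sq_int (intv L) q"
    using V_spaceD[OF V L] by (auto simp: p_def r_def q_def)
  have ip: "interpolation L (N n) (X n) y p r b q" for n
    using mesh_on[of n] yb by (simp add: interpolation_def interpolation_axioms_def)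
  define cav where cav_n_def: "cav n v = mesh_on.cav L (X n) v" for n and v :: "real \<Rightarrow> real^3"
  have "\<exists>yh ph rh bh. interpolant L (N n) (X n) y p r b q yh ph rh bh" for n
    by (rule interpolation.interpolant_exists[OF ip]) (simp add: p_def)
  then obtain yh ph rh bh where int: "\<And>n. interpolant L (N n) (X n) y p r b q (yh n) (ph n) (rh n) (bh n)"
    by metis
  have I: "(yh n, bh n) \<in> V_space L" "(yh n, bh n) \<in> V_h L (N n) (X n)" "boundary_values L (yh n, bh n) = boundary_values L (y, b)"
    "primitive_of L (yh n) (ph n)" "primitive_of L (ph n) (rh n)" "sq_int (intv L) (rh n)" "primitive_of L (bh n) (cav n q)"
    "\<And>j. j \<le> N n \<Longrightarrow> ph n (X n j) = p (X n j)" "\<And>j. j \<le> N n \<Longrightarrow> bh n (X n j) = b (X n j)"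
    "yh n 0 = y 0" "ph n 0 = p 0" "bh n 0 = b 0"
    "\<And>x. x \<in> {0<..<L} \<Longrightarrow> cav n (rh n) x = cav n r x"
    "l2n (intv L) (\<lambda>x. rh n x - r x) \<le> 7 * l2n (intv L) (\<lambda>x. cav n r x - r x)" for n
    using int[of n] unfolding interpolant_def cav_n_def by blast+
  have sq_cav: "sq_int (intv L) (cav n v)" for n v
    unfolding cav_n_def by (rule mesh_on.sq_int_cav[OF mesh_on])
  have Dyh: "D L (yh n) x = ph n x" if "x \<in> {0..L}" for n x by (rule D_sobolev2(1)[OF I(4,5) L that])
  note DDyh = D_sobolev2(2,3)[OF I(4) I(5) L]
  have Dbh: "AE x in intv L. D L (bh n) x = cav n q x" "D L (bh n) \<in> borel_measurable (intv L)" for n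
    using D_eq_AE[OF I(7) L] D_measurable[OF I(7) L] by auto
  have Xin: "X n j \<in> {0..L}" if "j \<le> N n" for n j by (rule mesh_on.X_in[OF mesh_on that])
  have nodes: "D L (yh n) (X n j) = p (X n j)" if "j \<le> N n" for n j
    using Dyh[OF Xin[OF that]] I(8)[OF that] by simp
  have adm: "(yh n, bh n) \<in> Ah n" for n
    unfolding discrete_admissible_def mem_Collect_eq prod.case
  proof (intro conjI allI impI I(2))
    fix j assume j: "j \<le> N n"
    show "norm (D L (yh n) (X n j)) = 1" "norm (bh n (X n j)) = 1"
      using frame[OF Xin[OF j]] nodes[OF j] I(9)[OF j] by (auto simp: p_def)
  next
    show "Lbc (yh n, bh n) = lbc"
      using bc I(1) V I(3)[of n] bc_eq unfolding boundary_operator_def by metis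
  qed

  note cav_r = cav_tendsto[OF mesh_on h_lim yb(3), folded cav_n_def]
  note cav_q = cav_tendsto[OF mesh_on h_lim yb(5), folded cav_n_def]
  have rh_lim: "(\<lambda>n. l2n (intv L) (\<lambda>x. rh n x - r x)) \<longlonglongrightarrow> 0"
    by (rule null_squeeze[OF l2n_nonneg I(14) tendsto_mult_right_zero[OF cav_r]])

  have diff_y: "primitive_of L (\<lambda>x. yh n x - y x) (\<lambda>x. ph n x - p x)"
    "primitive_of L (\<lambda>x. ph n x - p x) (\<lambda>x. rh n x - r x)"
    "primitive_of L (\<lambda>x. bh n x - b x) (\<lambda>x. cav n q x - q x)" for n
    using primitive_of_linear[OF I(4)[of n] yb(1), of 1 "-1"] primitive_of_linear[OF I(5)[of n] yb(2), of 1 "-1"]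
      primitive_of_linear[OF I(7)[of n] yb(4), of 1 "-1"] by simp_all
  have sq_diff: "sq_int (intv L) (\<lambda>x. rh n x - r x)" "sq_int (intv L) (\<lambda>x. cav n q x - q x)"
    "sq_int (intv L) (\<lambda>x. ph n x - p x)" for n
    using continuous_sq_int_intv[OF primitive_of_continuous[OF diff_y(2)[of n]]]
    by (auto intro!: sq_int_diff I sq_cav yb)
  have norm_y: "(\<lambda>n. sobolev_norm L 2 (\<lambda>x. yh n x - y x)) \<longlonglongrightarrow> 0"
  proof -
    have ph0: "l2n (intv L) (\<lambda>x. ph n x - p x) \<le> L * l2n (intv L) (\<lambda>x. rh n x - r x)" for n
      by (rule primitive_zero_l2n[OF diff_y(2) sq_diff(1) _ L]) (simp add: I)
    have ph_lim: "(\<lambda>n. l2n (intv L) (\<lambda>x. ph n x - p x)) \<longlonglongrightarrow> 0"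
      by (rule null_squeeze[OF l2n_nonneg ph0 tendsto_mult_right_zero[OF rh_lim]])
    have yh0: "l2n (intv L) (\<lambda>x. yh n x - y x) \<le> L * l2n (intv L) (\<lambda>x. ph n x - p x)" for n
      by (rule primitive_zero_l2n[OF diff_y(1) sq_diff(3) _ L]) (simp add: I)
    have yh_lim: "(\<lambda>n. l2n (intv L) (\<lambda>x. yh n x - y x)) \<longlonglongrightarrow> 0"
      by (rule null_squeeze[OF l2n_nonneg yh0 tendsto_mult_right_zero[OF ph_lim]])
    have e1: "l2n (intv L) (D L (\<lambda>x. yh n x - y x)) = l2n (intv L) (\<lambda>x. ph n x - p x)" for n
      using D_sobolev2(1)[OF diff_y(1)[of n] diff_y(2)[of n] L] sq_diff(3)[of n] D_measurable[OF diff_y(1)[of n] L]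
      by (intro l2n_cong_AE AE_I2) (auto simp: sq_int_def)
    have e2: "l2n (intv L) (D L (D L (\<lambda>x. yh n x - y x))) = l2n (intv L) (\<lambda>x. rh n x - r x)" for n
      using D_sobolev2(2,3)[OF diff_y(1)[of n] diff_y(2)[of n] L] sq_diff(1)[of n]
      by (intro l2n_cong_AE) (auto simp: sq_int_def)
    have "(\<lambda>n. sobolev_norm L 2 (\<lambda>x. yh n x - y x)) \<longlonglongrightarrow> sqrt (0\<^sup>2 + 0\<^sup>2 + 0\<^sup>2)"
      unfolding sobolev_norm_2 e1 e2 by (intro tendsto_intros yh_lim ph_lim rh_lim)
    thus ?thesis by simp
  qed
  have norm_b: "(\<lambda>n. sobolev_norm L 1 (\<lambda>x. bh n x - b x)) \<longlonglongrightarrow> 0"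
  proof -
    have bh0: "l2n (intv L) (\<lambda>x. bh n x - b x) \<le> L * l2n (intv L) (\<lambda>x. cav n q x - q x)" for n
      by (rule primitive_zero_l2n[OF diff_y(3) sq_diff(2) _ L]) (simp add: I)
    have bh_lim: "(\<lambda>n. l2n (intv L) (\<lambda>x. bh n x - b x)) \<longlonglongrightarrow> 0"
      by (rule null_squeeze[OF l2n_nonneg bh0 tendsto_mult_right_zero[OF cav_q]])
    have e1: "l2n (intv L) (D L (\<lambda>x. bh n x - b x)) = l2n (intv L) (\<lambda>x. cav n q x - q x)" for n
      using D_eq_AE[OF diff_y(3)[of n] L] sq_diff(2)[of n] D_measurable[OF diff_y(3)[of n] L]
      by (intro l2n_cong_AE) (auto simp: sq_int_def)
    have "(\<lambda>n. sobolev_norm L 1 (\<lambda>x. bh n x - b x)) \<longlonglongrightarrow> sqrt (0\<^sup>2 + 0\<^sup>2)"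
      unfolding sobolev_norm_1 e1 by (intro tendsto_intros bh_lim cav_q)
    thus ?thesis by simp
  qed

  define \<Psi> where "\<Psi> n = (\<integral>x. psi (m (\<delta> n)) ((norm (cav n r x))\<^sup>2) ((norm (cav n q x))\<^sup>2) \<partial>intv L)" for n
  define \<Psi>0 where "\<Psi>0 = (\<integral>x. psi abs ((norm (r x))\<^sup>2) ((norm (q x))\<^sup>2) \<partial>intv L)"
  define Q where "Q n = 1 / 2 * ((\<integral>x. (norm (rh n x))\<^sup>2 \<partial>intv L) + 5 * (\<integral>x. (norm (cav n q x))\<^sup>2 \<partial>intv L) + \<Psi> n)" for n
  define P where "P n = (\<integral>x. (midavg (X n) p x \<bullet> cav n q x)\<^sup>2 \<partial>intv L)" for n
  have \<psi>_int: "integrable (intv L) (\<lambda>x. psi (m (\<delta> n)) ((norm (cav n r x))\<^sup>2) ((norm (cav n q x))\<^sup>2))" for n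
    by (rule integrable_psi_modulus[OF sq_cav sq_cav])
  have \<psi>0_int: "integrable (intv L) (\<lambda>x. psi abs ((norm (r x))\<^sup>2) ((norm (q x))\<^sup>2))"
    by (rule integrable_psi[OF finite_measure_intv _ _ _ yb(3,5), where \<eta> = 0]) (auto intro!: continuous_intros)

  have energy: "Eh n (yh n, bh n) = ereal (Q n + 1 / (2 * \<epsilon>2 n) * P n)" for n
  proof -
    interpret mesh_on L "N n" "X n" by (rule mesh_on)
    have rm: "rh n \<in> borel_measurable (intv L)" using I(6) by (simp add: sq_int_def)
    have qm: "cav n q \<in> borel_measurable (intv L)" using sq_cav by (simp add: sq_int_def)
    \<comment> \<open>The derivative chosen by \<open>D\<close> equals \<open>rh n\<close> only
      almost everywhere, which averages do not notice.\<close>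
    have c: "mesh_on.cav L (X n) (D L (D L (yh n))) = cav n (rh n)"
      unfolding cav_n_def by (rule cav_cong_AE[OF DDyh(1)[of n] DDyh(2)[of n] rm])
    have cm: "(\<lambda>x. (norm (cav n (rh n) x))\<^sup>2) \<in> borel_measurable (intv L)"
      by (rule borel_measurable_integrable[OF sq_intD[OF sq_cav]])
    have "(\<integral>x. (norm (D L (D L (yh n)) x))\<^sup>2 + 5 * (norm (D L (bh n) x))\<^sup>2
            + psi (m (\<delta> n)) ((norm (cav n (rh n) x))\<^sup>2) ((norm (D L (bh n) x))\<^sup>2) \<partial>intv L)
      = (\<integral>x. (norm (rh n x))\<^sup>2 + 5 * (norm (cav n q x))\<^sup>2
            + psi (m (\<delta> n)) ((norm (cav n r x))\<^sup>2) ((norm (cav n q x))\<^sup>2) \<partial>intv L)"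
    proof (rule integral_cong_AE)
      show "AE x in intv L. (norm (D L (D L (yh n)) x))\<^sup>2 + 5 * (norm (D L (bh n) x))\<^sup>2
            + psi (m (\<delta> n)) ((norm (cav n (rh n) x))\<^sup>2) ((norm (D L (bh n) x))\<^sup>2)
          = (norm (rh n x))\<^sup>2 + 5 * (norm (cav n q x))\<^sup>2
            + psi (m (\<delta> n)) ((norm (cav n r x))\<^sup>2) ((norm (cav n q x))\<^sup>2)"
        using DDyh(1)[of n] Dbh(1)[of n] AE_space
        by eventually_elim (use I(13)[of _ n] in simp)
      show "(\<lambda>x. (norm (D L (D L (yh n)) x))\<^sup>2 + 5 * (norm (D L (bh n) x))\<^sup>2
            + psi (m (\<delta> n)) ((norm (cav n (rh n) x))\<^sup>2) ((norm (D L (bh n) x))\<^sup>2)) \<in> borel_measurable (intv L)"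
        using DDyh(2)[of n] Dbh(2)[of n] cm by (intro borel_measurable_add psi_measurable modulus_props) simp_all
      show "(\<lambda>x. (norm (rh n x))\<^sup>2 + 5 * (norm (cav n q x))\<^sup>2
            + psi (m (\<delta> n)) ((norm (cav n r x))\<^sup>2) ((norm (cav n q x))\<^sup>2)) \<in> borel_measurable (intv L)"
        using rm qm \<psi>_int[of n] by (intro borel_measurable_add) auto
    qed
    also have "\<dots> = (\<integral>x. (norm (rh n x))\<^sup>2 \<partial>intv L) + 5 * (\<integral>x. (norm (cav n q x))\<^sup>2 \<partial>intv L) + \<Psi> n"
      unfolding \<Psi>_def using sq_intD[OF I(6)[of n]] sq_intD[OF sq_cav[of n q]] \<psi>_int[of n] by simp
    finally have bend: "1 / 2 * (\<integral>x. (norm (D L (D L (yh n)) x))\<^sup>2 + 5 * (norm (D L (bh n) x))\<^sup>2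
            + psi (m (\<delta> n)) ((norm (cav n (rh n) x))\<^sup>2) ((norm (D L (bh n) x))\<^sup>2) \<partial>intv L) = Q n"
      by (simp add: Q_def)
    have "nodal_interp (X n) (\<lambda>t. (D L (yh n) t \<bullet> bh n t)\<^sup>2) x = 0" if x: "x \<in> {0<..<L}" for x
    proof -
      have z: "(D L (yh n) (X n j) \<bullet> bh n (X n j))\<^sup>2 = 0" if "j \<le> N n" for j
        using nodes[OF that] I(9)[OF that] frame[OF Xin[OF that]] by (simp add: p_def)
      have e: "elem (X n) x \<le> N n" "Suc (elem (X n) x) \<le> N n" using midavg_tendsto_aux(5)[OF x] by auto
      show ?thesis
        by (rule nodal_interp_convex[OF x, of "\<lambda>t. (D L (yh n) t \<bullet> bh n t)\<^sup>2"])
           (simp only: z[OF e(1)] z[OF e(2)] mult_zero_right add_0_right)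
    qed
    hence "(\<integral>x. nodal_interp (X n) (\<lambda>t. (D L (yh n) t \<bullet> bh n t)\<^sup>2) x \<partial>intv L) = (\<integral>x. 0 \<partial>intv L)"
      by (intro Bochner_Integration.integral_cong) auto
    hence pen1: "(\<integral>x. nodal_interp (X n) (\<lambda>t. (D L (yh n) t \<bullet> bh n t)\<^sup>2) x \<partial>intv L) = 0" by simp
    have mid: "midavg (X n) (D L (yh n)) x = midavg (X n) p x" if "x \<in> {0<..<L}" for x
      using nodes[of "elem (X n) x" n] nodes[of "Suc (elem (X n) x)" n] midavg_tendsto_aux(5)[OF that]
      by (simp add: midavg_def Let_def)
    have pen2: "(\<integral>x. (midavg (X n) (D L (yh n)) x \<bullet> D L (bh n) x)\<^sup>2 \<partial>intv L) = P n"
      unfolding P_def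
    proof (rule integral_cong_AE)
      show "AE x in intv L. (midavg (X n) (D L (yh n)) x \<bullet> D L (bh n) x)\<^sup>2 = (midavg (X n) p x \<bullet> cav n q x)\<^sup>2"
        using Dbh(1)[of n] AE_space by eventually_elim (use mid in simp)
      show "(\<lambda>x. (midavg (X n) (D L (yh n)) x \<bullet> D L (bh n) x)\<^sup>2) \<in> borel_measurable (intv L)"
        using sq_int_midavg[of "D L (yh n)"] Dbh(2)[of n]
        by (intro borel_measurable_power borel_measurable_inner) (auto simp: sq_int_def)
      show "(\<lambda>x. (midavg (X n) p x \<bullet> cav n q x)\<^sup>2) \<in> borel_measurable (intv L)"
        using sq_int_midavg[of p] qm
        by (intro borel_measurable_power borel_measurable_inner) (auto simp: sq_int_def)
    qed
    show ?thesis
      unfolding E_quad_eq[OF I(1)] c bend pen1 pen2 using adm[of n] by simp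
  qed

  have P_nn: "0 \<le> P n" for n unfolding P_def by simp
  have \<Psi>_lim: "\<Psi> \<longlonglongrightarrow> \<Psi>0"
  proof -
    \<comment> \<open>The first term is the modulus error of \<open>psi_md_diff\<close>, the second
      the Lipschitz bound for \<open>psi\<close> applied to the squared norms.\<close>
    define e where "e n = L * (5 * (cuni * \<delta> n)) + 7 * ((\<integral>x. \<bar>(norm (cav n r x))\<^sup>2 - (norm (r x))\<^sup>2\<bar> \<partial>intv L)
        + (\<integral>x. \<bar>(norm (cav n q x))\<^sup>2 - (norm (q x))\<^sup>2\<bar> \<partial>intv L))" for n
    note l1 = integral_norm_square_tendsto(1)[OF sq_cav yb(3) cav_r] and l2 = integral_norm_square_tendsto(1)[OF sq_cav yb(5) cav_q]
    have "e \<longlonglongrightarrow> L * (5 * (cuni * 0)) + 7 * (0 + 0)"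
      unfolding e_def[abs_def] by (intro tendsto_intros \<delta>_lim l1 l2)
    hence e0: "e \<longlonglongrightarrow> 0" by simp
    have "(\<lambda>n. \<Psi> n - \<Psi>0) \<longlonglongrightarrow> 0"
    proof (rule Lim_null_comparison[OF _ e0], intro always_eventually allI)
      fix n
      define a where "a x = \<bar>(norm (cav n r x))\<^sup>2 - (norm (r x))\<^sup>2\<bar>" for x
      define c where "c x = \<bar>(norm (cav n q x))\<^sup>2 - (norm (q x))\<^sup>2\<bar>" for x
      have ai: "integrable (intv L) a" "integrable (intv L) c"
        unfolding a_def c_def using sq_intD[OF sq_cav[of n r]] sq_intD[OF sq_cav[of n q]] sq_intD[OF yb(3)] sq_intD[OF yb(5)]
        by auto
      have "norm (\<Psi> n - \<Psi>0) = \<bar>\<integral>x. psi (m (\<delta> n)) ((norm (cav n r x))\<^sup>2) ((norm (cav n q x))\<^sup>2)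
          - psi abs ((norm (r x))\<^sup>2) ((norm (q x))\<^sup>2) \<partial>intv L\<bar>"
        unfolding \<Psi>_def \<Psi>0_def using \<psi>_int[of n] \<psi>0_int by simp
      also have "\<dots> \<le> (\<integral>x. \<bar>psi (m (\<delta> n)) ((norm (cav n r x))\<^sup>2) ((norm (cav n q x))\<^sup>2)
          - psi abs ((norm (r x))\<^sup>2) ((norm (q x))\<^sup>2)\<bar> \<partial>intv L)" by (rule integral_abs_bound)
      also have "\<dots> \<le> (\<integral>x. 5 * (cuni * \<delta> n) + 7 * (a x + c x) \<partial>intv L)"
      proof (rule integral_mono)
        fix x
        have "\<bar>psi (m (\<delta> n)) ((norm (cav n r x))\<^sup>2) ((norm (cav n q x))\<^sup>2) - psi abs ((norm (cav n r x))\<^sup>2) ((norm (cav n q x))\<^sup>2)\<bar>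
            \<le> 5 * (cuni * \<delta> n)" by (rule psi_modulus_diff) auto
        moreover have "\<bar>psi abs ((norm (cav n r x))\<^sup>2) ((norm (cav n q x))\<^sup>2) - psi abs ((norm (r x))\<^sup>2) ((norm (q x))\<^sup>2)\<bar>
            \<le> 7 * (a x + c x)" unfolding a_def c_def by (rule psi_abs_Lipschitz) auto
        ultimately show "\<bar>psi (m (\<delta> n)) ((norm (cav n r x))\<^sup>2) ((norm (cav n q x))\<^sup>2)
          - psi abs ((norm (r x))\<^sup>2) ((norm (q x))\<^sup>2)\<bar> \<le> 5 * (cuni * \<delta> n) + 7 * (a x + c x)"
          using abs_triangle_ineq4 by (smt (verit))
      qed (use ai \<psi>_int[of n] \<psi>0_int in auto)
      also have "\<dots> = e n"
        unfolding e_def a_def[symmetric] c_def[symmetric] using ai L by (simp add: measure_intv)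
      finally show "norm (\<Psi> n - \<Psi>0) \<le> e n" .
    qed
    thus ?thesis by (rule LIM_zero_cancel)
  qed
  have Q_lim: "Q \<longlonglongrightarrow> (LINT x:{0<..<L}|lborel. Qbar (norm (D L (D L y) x)) (norm (D L b x)))"
  proof -
    have "Q \<longlonglongrightarrow> 1 / 2 * ((\<integral>x. (norm (r x))\<^sup>2 \<partial>intv L) + 5 * (\<integral>x. (norm (q x))\<^sup>2 \<partial>intv L) + \<Psi>0)"
      unfolding Q_def[abs_def]
      by (intro tendsto_intros \<Psi>_lim integral_norm_square_tendsto(2)[OF I(6) yb(3) rh_lim]
          integral_norm_square_tendsto(2)[OF sq_cav yb(5) cav_q])
    also have "1 / 2 * ((\<integral>x. (norm (r x))\<^sup>2 \<partial>intv L) + 5 * (\<integral>x. (norm (q x))\<^sup>2 \<partial>intv L) + \<Psi>0) =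
        (\<integral>x. 1 / 2 * ((norm (r x))\<^sup>2 + 5 * (norm (q x))\<^sup>2 + psi abs ((norm (r x))\<^sup>2) ((norm (q x))\<^sup>2)) \<partial>intv L)"
      unfolding \<Psi>0_def using sq_intD[OF yb(3)] sq_intD[OF yb(5)] \<psi>0_int by simp
    also have "\<dots> = (LINT x:{0<..<L}|lborel. Qbar (norm (D L (D L y) x)) (norm (D L b x)))"
      unfolding integral_intv by (simp add: Qbar_eq_psi r_def q_def)
    finally show ?thesis .
  qed
  have P_lim: "P \<longlonglongrightarrow> (LINT x:{0<..<L}|lborel. (D L y x \<bullet> D L b x)\<^sup>2)"
  proof -
    have pm: "p \<in> borel_measurable (intv L)" by (rule continuous_measurable_intv[OF primitive_of_continuous[OF yb(2)]])
    have qm: "q \<in> borel_measurable (intv L)" using yb(5) by (simp add: sq_int_def)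
    have sf: "sq_int (intv L) (\<lambda>x. midavg (X n) p x \<bullet> cav n q x)" for n
      by (rule mesh_on.sq_int_midavg_inner[OF mesh_on sq_cav])
    have s1: "sq_int (intv L) (\<lambda>x. midavg (X n) p x \<bullet> (cav n q x - q x))" for n
      by (rule mesh_on.sq_int_midavg_inner[OF mesh_on sq_diff(2)])
    have pq_le: "\<bar>p x \<bullet> q x\<bar> \<le> norm (q x)" if "x \<in> {0<..<L}" for x
      using Cauchy_Schwarz_ineq2[of "p x" "q x"] frame[of x] that by (simp add: p_def)
    have sg: "sq_int (intv L) (\<lambda>x. p x \<bullet> q x)"
    proof (rule sq_int_bound[OF borel_measurable_inner[OF pm qm] sq_intD[OF yb(5)]])
      show "AE x in intv L. (norm (p x \<bullet> q x))\<^sup>2 \<le> (norm (q x))\<^sup>2"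
        by (intro AE_I2 power_mono) (use pq_le in auto)
    qed
    have s2: "sq_int (intv L) (\<lambda>x. midavg (X n) p x \<bullet> q x - p x \<bullet> q x)" for n
      by (intro sq_int_diff mesh_on.sq_int_midavg_inner[OF mesh_on] yb sg)
    \<comment> \<open>The first term replaces the averaged \<open>q\<close> by \<open>q\<close>,
      using that midpoint averages of unit vectors have norm at most one; the second is the midpoint
      error of \<open>p\<close>, Hoelder with exponent one half.\<close>
    define e where "e n = l2n (intv L) (\<lambda>x. cav n q x - q x) + sqrt (mesh_size (N n) (X n)) * l2n (intv L) r * l2n (intv L) q" for n
    have le: "l2n (intv L) (\<lambda>x. midavg (X n) p x \<bullet> cav n q x - p x \<bullet> q x) \<le> e n" for n
    proof -
      interpret interpolation L "N n" "X n" y p r b q by (rule ip)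
      have "l2n (intv L) (\<lambda>x. midavg (X n) p x \<bullet> cav n q x - p x \<bullet> q x)
        = l2n (intv L) (\<lambda>x. midavg (X n) p x \<bullet> (cav n q x - q x) + (midavg (X n) p x \<bullet> q x - p x \<bullet> q x))"
        by (simp add: inner_diff_right)
      also have "\<dots> \<le> l2n (intv L) (\<lambda>x. midavg (X n) p x \<bullet> (cav n q x - q x)) + l2n (intv L) (\<lambda>x. midavg (X n) p x \<bullet> q x - p x \<bullet> q x)"
        by (rule l2n_triangle[OF s1 s2])
      also have "l2n (intv L) (\<lambda>x. midavg (X n) p x \<bullet> (cav n q x - q x)) \<le> l2n (intv L) (\<lambda>x. norm (cav n q x - q x))"
      proof (rule l2n_mono[OF sq_int_norm[OF sq_diff(2)]])
        fix x assume "x \<in> space (intv L)"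
        hence "norm (midavg (X n) p x) \<le> 1"
          by (intro midavg_norm_le) (use frame[OF Xin] in \<open>auto simp: p_def\<close>)
        hence "norm (midavg (X n) p x) * norm (cav n q x - q x) \<le> norm (cav n q x - q x)"
          by (simp add: mult_left_le_one_le)
        thus "norm (midavg (X n) p x \<bullet> (cav n q x - q x)) \<le> norm (norm (cav n q x - q x))"
          using Cauchy_Schwarz_ineq2[of "midavg (X n) p x" "cav n q x - q x"] by simp
      qed
      also have "l2n (intv L) (\<lambda>x. norm (cav n q x - q x)) = l2n (intv L) (\<lambda>x. cav n q x - q x)"
        by (simp add: l2n_def)
      also have "l2n (intv L) (\<lambda>x. midavg (X n) p x \<bullet> q x - p x \<bullet> q x)
        \<le> l2n (intv L) (\<lambda>x. (sqrt h * l2n (intv L) r) *\<^sub>R q x)"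
      proof (rule l2n_mono[OF sq_int_scaleR[OF yb(5)]])
        fix x assume "x \<in> space (intv L)"
        hence x: "x \<in> {0<..<L}" by simp
        have "norm (midavg (X n) p x \<bullet> q x - p x \<bullet> q x) \<le> norm (midavg (X n) p x - p x) * norm (q x)"
          unfolding inner_diff_left[symmetric] real_norm_def by (rule Cauchy_Schwarz_ineq2)
        also have "\<dots> \<le> (sqrt h * l2n (intv L) r) * norm (q x)"
          by (intro mult_right_mono midavg_error[OF x]) simp
        finally show "norm (midavg (X n) p x \<bullet> q x - p x \<bullet> q x) \<le> norm ((sqrt h * l2n (intv L) r) *\<^sub>R q x)"
          using h_pos by simp
      qed
      finally show ?thesis using h_pos by (simp add: e_def l2n_scaleR abs_mult)
    qed
    have "e \<longlonglongrightarrow> 0 + sqrt 0 * l2n (intv L) r * l2n (intv L) q"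
      unfolding e_def[abs_def] by (intro tendsto_intros cav_q h_lim)
    hence e0: "e \<longlonglongrightarrow> 0" by simp
    have "(\<lambda>n. l2n (intv L) (\<lambda>x. midavg (X n) p x \<bullet> cav n q x - p x \<bullet> q x)) \<longlonglongrightarrow> 0"
      by (rule null_squeeze[OF l2n_nonneg le e0])
    from integral_norm_square_tendsto(2)[OF sf sg this] show ?thesis
      unfolding P_def[abs_def] integral_intv by (simp add: p_def q_def)
  qed
  have P_adm: "\<exists>K. \<forall>n. P n \<le> mesh_size (N n) (X n) * K" if "(y, b) \<in> admissible L Lbc lbc"
  proof (intro exI allI)
    fix n
    have "AE x in lborel. x \<in> {0<..<L} \<longrightarrow> p x \<bullet> q x = 0" using that by (simp add: admissible_def p_def q_def)
    from interpolation.midavg_cav_orthogonal[OF ip this[unfolded AE_intv], of n]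
    show "P n \<le> mesh_size (N n) (X n) * ((l2n (intv L) r)\<^sup>2 * (l2n (intv L) q)\<^sup>2)"
      unfolding P_def cav_n_def by (simp add: mult.assoc)
  qed
  show ?thesis
    by (rule that[OF I(1) adm norm_y norm_b energy Q_lim P_lim P_nn P_adm])
qed

end

section \<open>Gamma-convergence\<close>

text \<open>If the lower limit were smaller than \<open>e\<close>, a real \<open>C\<close> would lie
  strictly between them, and the infinitely many indices with value below \<open>C\<close> would
  form a subsequence bounded by \<open>C\<close>. Infinite \<open>e\<close> is included.\<close>

lemma le_liminfI:
  fixes F :: "nat \<Rightarrow> ereal"
  assumes "\<And>r C. strict_mono (r :: nat \<Rightarrow> nat) \<Longrightarrow> (\<And>n. F (r n) \<le> ereal C) \<Longrightarrow> e \<le> ereal C"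
  shows "e \<le> liminf F"
proof (rule ccontr)
  assume "\<not> e \<le> liminf F"
  hence "liminf F < e" by simp
  then obtain C where C: "liminf F < ereal C" "ereal C < e" using ereal_dense2 by blast
  have "\<not> (\<forall>\<^sub>F n in sequentially. ereal C \<le> F n)"
    using Liminf_bounded[of "ereal C" F sequentially] C(1) by auto
  hence "infinite {n. F n < ereal C}"
    by (simp add: not_eventually not_le frequently_cofinite flip: cofinite_eq_sequentially)
  then obtain r :: "nat \<Rightarrow> nat" where "strict_mono r" "\<And>n. r n \<in> {n. F n < ereal C}"
    using infinite_enumerate by blast
  hence "e \<le> ereal C" by (intro assms[of r]) (auto intro: less_imp_le)
  with C(2) show False by simp
qed

lemma weakly_conv_subseq:
  assumes "weakly_conv L U u" "strict_mono r" shows "weakly_conv L (U \<circ> r) u"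
  using assms LIMSEQ_subseq_LIMSEQ[OF _ assms(2)] unfolding weakly_conv_def by (fastforce simp: o_def)

lemma weakly_conv_const: "u \<in> V_space L \<Longrightarrow> weakly_conv L (\<lambda>_. u) u"
  by (simp add: weakly_conv_def)

text \<open>Where the limit functional is infinite, the constant sequence recovers it, because the
  lower bound already forces its energies to infinity.\<close>

lemma gamma_convI:
  assumes liminf: "\<And>U u. weakly_conv L U u \<Longrightarrow> E u \<le> liminf (\<lambda>n. F n (U n))"
    and recovery: "\<And>u. u \<in> V_space L \<Longrightarrow> E u \<noteq> \<infinity> \<Longrightarrow> \<exists>U. weakly_conv L U u \<and> (\<lambda>n. F n (U n)) \<longlonglongrightarrow> E u"
  shows "gamma_conv L F E"
  unfolding gamma_conv_def
proof (intro conjI allI impI ballI)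
  fix u assume u: "u \<in> V_space L"
  show "\<exists>U. weakly_conv L U u \<and> (\<lambda>n. F n (U n)) \<longlonglongrightarrow> E u"
  proof (cases "E u = \<infinity>")
    case True
    have inf: "liminf (\<lambda>n. F n u) = \<infinity>" using liminf[OF weakly_conv_const[OF u]] True by simp
    moreover have "limsup (\<lambda>n. F n u) = \<infinity>"
      using Liminf_le_Limsup[of sequentially "\<lambda>n. F n u"] inf by simp
    ultimately have "(\<lambda>n. F n u) \<longlonglongrightarrow> E u"
      using True by (subst tendsto_iff_Liminf_eq_Limsup) auto
    thus ?thesis using weakly_conv_const[OF u] by (intro exI[of _ "\<lambda>_. u"]) simp
  qed (rule recovery[OF u])
qed (rule liminf)

context discretization
begin

lemma liminf_E_constr:
  assumes w: "weakly_conv L U u" and e2: "\<epsilon>2 \<longlonglongrightarrow> 0"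
  shows "E_constr L Lbc lbc u \<le> liminf (\<lambda>n. Eh n (U n))"
proof (rule le_liminfI)
  fix r :: "nat \<Rightarrow> nat" and C assume r: "strict_mono r" and C: "\<And>n. Eh (r n) (U (r n)) \<le> ereal C"
  interpret S: discretization L Lbc lbc m c0 c1 c2 cuni "N \<circ> r" "X \<circ> r" "\<delta> \<circ> r" "\<epsilon>1 \<circ> r" "\<epsilon>2 \<circ> r"
    by (rule discretization_subseq[OF r])
  show "E_constr L Lbc lbc u \<le> ereal C"
    using S.liminf_bound(2)[OF weakly_conv_subseq[OF w r], of C] C LIMSEQ_subseq_LIMSEQ[OF e2 r] by simp
qed

lemma liminf_E_pen:
  assumes w: "weakly_conv L U u" and e2: "\<And>n. \<epsilon>2 n = e2"
  shows "E_pen L Lbc lbc e2 u \<le> liminf (\<lambda>n. Eh n (U n))"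
proof (rule le_liminfI)
  fix r :: "nat \<Rightarrow> nat" and C assume r: "strict_mono r" and C: "\<And>n. Eh (r n) (U (r n)) \<le> ereal C"
  interpret S: discretization L Lbc lbc m c0 c1 c2 cuni "N \<circ> r" "X \<circ> r" "\<delta> \<circ> r" "\<epsilon>1 \<circ> r" "\<epsilon>2 \<circ> r"
    by (rule discretization_subseq[OF r])
  show "E_pen L Lbc lbc e2 u \<le> ereal C"
    using S.liminf_bound(3)[OF weakly_conv_subseq[OF w r], of C e2] C e2 by simp
qed

text \<open>The rate \<open>P n \<le> h * K\<close> bounds the second penalty by
  \<open>K / 2\<close> times \<open>h / \<epsilon>2\<close>, so the mesh condition makes it
  vanish.\<close>

lemma recovery_E_constr:
  assumes A: "(y, b) \<in> admissible L Lbc lbc" and h: "(\<lambda>n. mesh_size (N n) (X n) / \<epsilon>2 n) \<longlonglongrightarrow> 0"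
  obtains yh bh where "\<And>n. (yh n, bh n) \<in> Ah n" "weakly_conv L (\<lambda>n. (yh n, bh n)) (y, b)"
    "(\<lambda>n. sobolev_norm L 2 (\<lambda>x. yh n x - y x)) \<longlonglongrightarrow> 0"
    "(\<lambda>n. sobolev_norm L 1 (\<lambda>x. bh n x - b x)) \<longlonglongrightarrow> 0"
    "(\<lambda>n. Eh n (yh n, bh n)) \<longlonglongrightarrow> E_constr L Lbc lbc (y, b)"
proof -
  have frame: "(y, b) \<in> A_frame L Lbc lbc" using A by (simp add: admissible_def)
  hence V: "(y, b) \<in> V_space L" using L by (simp add: A_frame_iff)
  obtain yh bh Q P where R: "\<And>n. (yh n, bh n) \<in> V_space L" "\<And>n. (yh n, bh n) \<in> Ah n"
    "(\<lambda>n. sobolev_norm L 2 (\<lambda>x. yh n x - y x)) \<longlonglongrightarrow> 0" "(\<lambda>n. sobolev_norm L 1 (\<lambda>x. bh n x - b x)) \<longlonglongrightarrow> 0"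
    "\<And>n. Eh n (yh n, bh n) = ereal (Q n + 1 / (2 * \<epsilon>2 n) * P n)"
    "Q \<longlonglongrightarrow> (LINT x:{0<..<L}|lborel. Qbar (norm (D L (D L y) x)) (norm (D L b x)))"
    "P \<longlonglongrightarrow> (LINT x:{0<..<L}|lborel. (D L y x \<bullet> D L b x)\<^sup>2)" "\<And>n. 0 \<le> P n"
    "(y, b) \<in> admissible L Lbc lbc \<Longrightarrow> \<exists>K. \<forall>n. P n \<le> mesh_size (N n) (X n) * K"
    by (rule recovery_sequence[OF frame]) (rule that)
  obtain K where K: "\<And>n. P n \<le> mesh_size (N n) (X n) * K" using R(9)[OF A] by blast
  have "(\<lambda>n. 1 / (2 * \<epsilon>2 n) * P n) \<longlonglongrightarrow> 0"
  proof (rule tendsto_sandwich[OF _ _ tendsto_const])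
    show "\<forall>\<^sub>F n in sequentially. 0 \<le> 1 / (2 * \<epsilon>2 n) * P n"
      using R(8) \<epsilon>2_pos by (intro always_eventually allI) (simp add: less_imp_le)
    show "\<forall>\<^sub>F n in sequentially. 1 / (2 * \<epsilon>2 n) * P n \<le> mesh_size (N n) (X n) / \<epsilon>2 n * (K / 2)"
    proof (intro always_eventually allI)
      fix n show "1 / (2 * \<epsilon>2 n) * P n \<le> mesh_size (N n) (X n) / \<epsilon>2 n * (K / 2)"
        using mult_left_mono[OF K[of n], of "1 / (2 * \<epsilon>2 n)"] \<epsilon>2_pos[of n] by simp
    qed
    show "(\<lambda>n. mesh_size (N n) (X n) / \<epsilon>2 n * (K / 2)) \<longlonglongrightarrow> 0"
      using tendsto_mult[OF h tendsto_const[of "K / 2"]] by simp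
  qed
  from tendsto_add[OF R(6) this]
  have "(\<lambda>n. Eh n (yh n, bh n)) \<longlonglongrightarrow> E_constr L Lbc lbc (y, b)"
    unfolding R(5) using A by simp
  thus ?thesis
    using that[OF R(2) strong_imp_weakly_conv[OF R(1) V L R(3,4)] R(3,4)] by blast
qed

lemma recovery_E_pen:
  assumes A: "(y, b) \<in> A_frame L Lbc lbc" and e2: "\<And>n. \<epsilon>2 n = e2"
  shows "\<exists>U. weakly_conv L U (y, b) \<and> (\<lambda>n. Eh n (U n)) \<longlonglongrightarrow> E_pen L Lbc lbc e2 (y, b)"
proof -
  have V: "(y, b) \<in> V_space L" using A L by (simp add: A_frame_iff)
  obtain yh bh Q P where R: "\<And>n. (yh n, bh n) \<in> V_space L" "\<And>n. (yh n, bh n) \<in> Ah n"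
    "(\<lambda>n. sobolev_norm L 2 (\<lambda>x. yh n x - y x)) \<longlonglongrightarrow> 0" "(\<lambda>n. sobolev_norm L 1 (\<lambda>x. bh n x - b x)) \<longlonglongrightarrow> 0"
    "\<And>n. Eh n (yh n, bh n) = ereal (Q n + 1 / (2 * \<epsilon>2 n) * P n)"
    "Q \<longlonglongrightarrow> (LINT x:{0<..<L}|lborel. Qbar (norm (D L (D L y) x)) (norm (D L b x)))"
    "P \<longlonglongrightarrow> (LINT x:{0<..<L}|lborel. (D L y x \<bullet> D L b x)\<^sup>2)"
    by (rule recovery_sequence[OF A]) (rule that)
  have "(\<lambda>n. Eh n (yh n, bh n)) \<longlonglongrightarrow> E_pen L Lbc lbc e2 (y, b)"
    unfolding R(5) unfolding e2 using A tendsto_add[OF R(6) tendsto_mult[OF tendsto_const[of "1 / (2 * e2)"] R(7)]] by simp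
  thus ?thesis using strong_imp_weakly_conv[OF R(1) V L R(3,4)] by blast
qed

proposition gamma_conv_E_constr:
  assumes e2: "\<epsilon>2 \<longlonglongrightarrow> 0" and h: "(\<lambda>n. mesh_size (N n) (X n) / \<epsilon>2 n) \<longlonglongrightarrow> 0"
  shows "gamma_conv L Eh (E_constr L Lbc lbc)"
proof (rule gamma_convI)
  fix u assume "E_constr L Lbc lbc u \<noteq> \<infinity>"
  moreover obtain y b where u: "u = (y, b)" by (cases u)
  ultimately have "(y, b) \<in> admissible L Lbc lbc" by (auto split: if_splits)
  then obtain yh bh where "weakly_conv L (\<lambda>n. (yh n, bh n)) (y, b)"
    "(\<lambda>n. Eh n (yh n, bh n)) \<longlonglongrightarrow> E_constr L Lbc lbc (y, b)"
    by (rule recovery_E_constr[OF _ h]) (rule that)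
  thus "\<exists>U. weakly_conv L U u \<and> (\<lambda>n. Eh n (U n)) \<longlonglongrightarrow> E_constr L Lbc lbc u"
    unfolding u by (intro exI[of _ "\<lambda>n. (yh n, bh n)"]) blast
qed (rule liminf_E_constr[OF _ e2])

proposition gamma_conv_E_pen:
  assumes e2: "\<And>n. \<epsilon>2 n = e2"
  shows "gamma_conv L Eh (E_pen L Lbc lbc e2)"
proof (rule gamma_convI)
  fix u assume "E_pen L Lbc lbc e2 u \<noteq> \<infinity>"
  moreover obtain y b where u: "u = (y, b)" by (cases u)
  ultimately have "(y, b) \<in> A_frame L Lbc lbc" by (auto split: if_splits)
  thus "\<exists>U. weakly_conv L U u \<and> (\<lambda>n. Eh n (U n)) \<longlonglongrightarrow> E_pen L Lbc lbc e2 u"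
    unfolding u by (rule recovery_E_pen[OF _ e2])
qed (rule liminf_E_pen[OF _ e2])

text \<open>Along the subsequence, near minimality compares \<open>U\<close> with the recovery
  sequence of an arbitrary competitor, and the lower bound transfers the comparison to the limits.
  Competitors of infinite energy need no comparison.\<close>

proposition accumulation_point_minimizes:
  assumes e2: "\<epsilon>2 \<longlonglongrightarrow> 0" and h: "(\<lambda>n. mesh_size (N n) (X n) / \<epsilon>2 n) \<longlonglongrightarrow> 0"
    and min: "\<And>n v. v \<in> Ah n \<Longrightarrow> Eh n (U n) \<le> Eh n v + ereal (tol n)" and tol: "tol \<longlonglongrightarrow> 0"
    and acc: "weak_accumulation_point L U u"
  shows "minimizer_of L (E_constr L Lbc lbc) u"
  unfolding minimizer_of_def
proof (intro conjI ballI)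
  obtain r where r: "strict_mono r" and w: "weakly_conv L (U \<circ> r) u"
    using acc unfolding weak_accumulation_point_def by blast
  show "u \<in> V_space L" using w by (simp add: weakly_conv_def)
  fix v assume "v \<in> V_space L"
  obtain y b where v: "v = (y, b)" by (cases v)
  show "E_constr L Lbc lbc u \<le> E_constr L Lbc lbc v"
  proof (cases "(y, b) \<in> admissible L Lbc lbc")
    case True
    then obtain yh bh where R: "\<And>n. (yh n, bh n) \<in> Ah n" "(\<lambda>n. Eh n (yh n, bh n)) \<longlonglongrightarrow> E_constr L Lbc lbc (y, b)"
      by (rule recovery_E_constr[OF _ h]) (rule that)
    interpret S: discretization L Lbc lbc m c0 c1 c2 cuni "N \<circ> r" "X \<circ> r" "\<delta> \<circ> r" "\<epsilon>1 \<circ> r" "\<epsilon>2 \<circ> r"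
      by (rule discretization_subseq[OF r])
    have t: "(\<lambda>n. ereal (tol n)) \<longlonglongrightarrow> 0" using tol by (simp add: zero_ereal_def)
    have "(\<lambda>n. Eh n (yh n, bh n) + ereal (tol n)) \<longlonglongrightarrow> E_constr L Lbc lbc v + 0"
      by (rule tendsto_add_ereal_general[OF _ R(2)[folded v] t]) auto
    hence lim: "(\<lambda>n. Eh (r n) (yh (r n), bh (r n)) + ereal (tol (r n))) \<longlonglongrightarrow> E_constr L Lbc lbc v"
      using LIMSEQ_subseq_LIMSEQ[OF _ r] by (simp add: o_def)
    have "E_constr L Lbc lbc u \<le> liminf (\<lambda>n. Eh (r n) (U (r n)))"
      using S.liminf_E_constr[OF w LIMSEQ_subseq_LIMSEQ[OF e2 r]] by simp
    also have "\<dots> \<le> liminf (\<lambda>n. Eh (r n) (yh (r n), bh (r n)) + ereal (tol (r n)))"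
      by (intro Liminf_mono always_eventually allI min R(1))
    also have "\<dots> = E_constr L Lbc lbc v" by (rule lim_imp_Liminf[OF _ lim]) simp
    finally show ?thesis .
  qed (simp add: v)
qed

end

text \<open>A nonnegative summand of a null sequence of nonnegative sums is null; squaring it puts
  the condition on \<open>h\<close> and \<open>\<epsilon>2\<close> into the form used for the
  penalty.\<close>

lemma div_tendsto_0_if_sqrt:
  fixes f g k :: "nat \<Rightarrow> real"
  assumes lim: "(\<lambda>n. f n + sqrt (g n) / sqrt (k n)) \<longlonglongrightarrow> 0"
    and pos: "\<And>n. 0 \<le> f n" "\<And>n. 0 \<le> g n" "\<And>n. 0 < k n"
  shows "(\<lambda>n. g n / k n) \<longlonglongrightarrow> 0"
proof -
  have "(\<lambda>n. sqrt (g n) / sqrt (k n)) \<longlonglongrightarrow> 0"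
    by (rule tendsto_sandwich[OF _ _ tendsto_const lim]) (use pos in \<open>auto simp: less_imp_le\<close>)
  from tendsto_power[OF this, of 2] show ?thesis
    using pos by (simp add: power_divide less_imp_le)
qed

text \<open>Limits in the parameters are taken along arbitrary sequences, with smooth frames
  \<open>S n\<close> for the parameters \<open>\<sigma> n\<close>. In (1)(ii) admissibility of the
  limit is tied to bounded energies, while the liminf inequality also speaks of limits that are not
  admissible, where \<open>E_constr\<close> is infinite.\<close>

theorem proposition4p6:
  fixes L :: real
    and Lbc :: "frame \<Rightarrow> 'w::real_normed_vector" and lbc :: 'w
    and m :: "real \<Rightarrow> real \<Rightarrow> real" and c0 c1 c2 cuni :: real
    and N :: "nat \<Rightarrow> nat" and X :: "nat \<Rightarrow> nat \<Rightarrow> real"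
    and h \<delta> \<epsilon>1 \<epsilon>2 :: "nat \<Rightarrow> real"
    and Eh :: "nat \<Rightarrow> frame \<Rightarrow> ereal" and Ah :: "nat \<Rightarrow> frame set"
  assumes "L > 0"
    and "boundary_operator L Lbc"
    and "regularized_modulus c0 c1 c2 cuni m"
    and "\<And>n. mesh L (N n) (X n)"
    and "quasiuniform N X"
    and "\<And>n. h n = mesh_size (N n) (X n)"
    and "\<And>n. \<delta> n > 0" and "\<And>n. \<epsilon>1 n > 0" and "\<And>n. \<epsilon>2 n > 0"
    and "h \<longlonglongrightarrow> 0" and "\<delta> \<longlonglongrightarrow> 0" and "\<epsilon>1 \<longlonglongrightarrow> 0"
    and "(\<lambda>n. h n / \<epsilon>1 n + sqrt (h n) / sqrt (\<epsilon>2 n)) \<longlonglongrightarrow> 0"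
    and "Eh = (\<lambda>n. E_quad L Lbc lbc (m (\<delta> n)) (\<epsilon>1 n) (\<epsilon>2 n) (N n) (X n))"
    and "Ah = (\<lambda>n. discrete_admissible L Lbc lbc (N n) (X n))"
  shows
    \<comment> \<open>(1)(i)\<close>
    "(\<epsilon>2 \<longlonglongrightarrow> 0 \<longrightarrow>
      (\<forall>y b (\<sigma> :: nat \<Rightarrow> real) (S :: nat \<Rightarrow> frame).
         (y, b) \<in> admissible L Lbc lbc \<and>
         (\<forall>n. \<sigma> n > 0 \<and> smooth_frame L Lbc lbc (y, b) (\<sigma> n) (S n)) \<and> \<sigma> \<longlonglongrightarrow> 0 \<and>
         (\<lambda>n. (h n)\<^sup>2 / \<epsilon>1 n + (\<sigma> n)\<^sup>2 / \<epsilon>2 n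
              + (h n)\<^sup>2 * (smooth_frame_norm L (S n))\<^sup>2 / \<epsilon>2 n) \<longlonglongrightarrow> 0 \<longrightarrow>
         (\<exists>yh bh. (\<forall>n. (yh n, bh n) \<in> Ah n) \<and>
            (\<lambda>n. sobolev_norm L 2 (\<lambda>x. yh n x - y x)) \<longlonglongrightarrow> 0 \<and>
            (\<lambda>n. sobolev_norm L 1 (\<lambda>x. bh n x - b x)) \<longlonglongrightarrow> 0 \<and>
            (\<lambda>n. Eh n (yh n, bh n)) \<longlonglongrightarrow> E_constr L Lbc lbc (y, b))))
     \<and>
     \<comment> \<open>(1)(ii)\<close>
     (\<epsilon>2 \<longlonglongrightarrow> 0 \<longrightarrow>
      (\<forall>U u. (\<forall>n. U n \<in> Ah n) \<and> weakly_conv L U u \<longrightarrow>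
         ((\<exists>C :: real. \<forall>n. Eh n (U n) \<le> ereal C) \<longrightarrow> u \<in> admissible L Lbc lbc) \<and>
         E_constr L Lbc lbc u \<le> liminf (\<lambda>n. Eh n (U n))))
     \<and>
     \<comment> \<open>(2)\<close>
     (\<epsilon>2 \<longlonglongrightarrow> 0 \<longrightarrow>
      (\<forall>U (tol :: nat \<Rightarrow> real).
         (\<forall>n. U n \<in> Ah n \<and> tol n \<ge> 0 \<and> (\<forall>v \<in> Ah n. Eh n (U n) \<le> Eh n v + ereal (tol n))) \<and>
         tol \<longlonglongrightarrow> 0 \<and>
         (\<exists>u (\<sigma> :: nat \<Rightarrow> real) (S :: nat \<Rightarrow> frame).
            weak_accumulation_point L U u \<and> u \<in> admissible L Lbc lbc \<and>
            (\<forall>n. \<sigma> n > 0 \<and> smooth_frame L Lbc lbc u (\<sigma> n) (S n)) \<and> \<sigma> \<longlonglongrightarrow> 0 \<and>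
            (\<lambda>n. (h n)\<^sup>2 / \<epsilon>1 n + (\<sigma> n)\<^sup>2 / \<epsilon>2 n
                 + (h n)\<^sup>2 * (smooth_frame_norm L (S n))\<^sup>2 / \<epsilon>2 n) \<longlonglongrightarrow> 0) \<longrightarrow>
         (\<forall>u. weak_accumulation_point L U u \<longrightarrow> minimizer_of L (E_constr L Lbc lbc) u)))
     \<and>
     \<comment> \<open>(3)\<close>
     (\<epsilon>2 \<longlonglongrightarrow> 0 \<and>
      (\<forall>u \<in> admissible L Lbc lbc. \<forall>\<sigma>>0. \<exists>ys bs. smooth_frame L Lbc lbc u \<sigma> (ys, bs) \<and>
         (\<forall>x\<in>{0<..<L}. D L ys x \<bullet> D L bs x = 0)) \<and>
      (\<lambda>n. (h n)\<^sup>2 / \<epsilon>1 n + (h n)\<^sup>2 / \<epsilon>2 n) \<longlonglongrightarrow> 0 \<longrightarrow>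
      gamma_conv L Eh (E_constr L Lbc lbc))
     \<and>
     \<comment> \<open>(4)\<close>
     (\<forall>e2>0. (\<forall>n. \<epsilon>2 n = e2) \<and> (\<lambda>n. (h n)\<^sup>2 / \<epsilon>1 n) \<longlonglongrightarrow> 0 \<longrightarrow>
      gamma_conv L Eh (E_pen L Lbc lbc e2))"
proof -
  have h_nn: "0 \<le> h n" for n
    using mesh_on.h_pos[of L "N n" "X n"] assms(1,4,6) by (simp add: mesh_on_def less_imp_le)
  have h_eps: "(\<lambda>n. h n / \<epsilon>2 n) \<longlonglongrightarrow> 0"
    by (rule div_tendsto_0_if_sqrt[OF assms(13)]) (use h_nn assms(8,9) in \<open>auto simp: less_imp_le\<close>)
  interpret discretization L Lbc lbc m c0 c1 c2 cuni N X \<delta> \<epsilon>1 \<epsilon>2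
    by unfold_locales (use assms in \<open>auto simp flip: assms(6)\<close>)
  note h_eps' = h_eps[unfolded assms(6)]
  show ?thesis
    unfolding assms(14,15)
  proof (intro conjI impI allI, goal_cases)
    case (1 y b \<sigma> S)
    then have A: "(y, b) \<in> admissible L Lbc lbc" by blast
    obtain yh bh where "\<And>n. (yh n, bh n) \<in> discrete_admissible L Lbc lbc (N n) (X n)" "weakly_conv L (\<lambda>n. (yh n, bh n)) (y, b)"
      "(\<lambda>n. sobolev_norm L 2 (\<lambda>x. yh n x - y x)) \<longlonglongrightarrow> 0"
      "(\<lambda>n. sobolev_norm L 1 (\<lambda>x. bh n x - b x)) \<longlonglongrightarrow> 0"
      "(\<lambda>n. E_quad L Lbc lbc (m (\<delta> n)) (\<epsilon>1 n) (\<epsilon>2 n) (N n) (X n) (yh n, bh n)) \<longlonglongrightarrow> E_constr L Lbc lbc (y, b)"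
      by (rule recovery_E_constr[OF A h_eps']) (rule that)
    then show ?case by (intro exI[of _ yh] exI[of _ bh]) blast
  next
    case (2 U u)
    then obtain C where C: "\<And>n. E_quad L Lbc lbc (m (\<delta> n)) (\<epsilon>1 n) (\<epsilon>2 n) (N n) (X n) (U n) \<le> ereal C" by blast
    show ?case using liminf_bound(2)[OF _ C] 2 by blast
  next
    case (3 U u)
    then show ?case using liminf_E_constr by blast
  next
    case (4 U tol u)
    then show ?case by (intro accumulation_point_minimizes[OF 4(1) h_eps', of U tol]) blast+
  next
    case 5
    then show ?case by (intro gamma_conv_E_constr h_eps') blast
  next
    case (6 e2)
    then show ?case by (intro gamma_conv_E_pen) blast
  qed
qed

end
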